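(* Let $n\ge 4$ and $2\le k\le n-2$. Let $(M^n,g(t))$ be an $n$-dimensional, $SO(k)\times SO(n-k+1)$-symmetric ancient oval of the Ricci flow whose tangent flow at $-\infty$ is $\mathbb{R}^k\times S^{n-k}(\sqrt{2(n-k-1)|t|})$, and write $$g(t)=dz\otimes dz+F^2(z,t)\,g_{S^{k-1}}+G^2(z,t)\,g_{S^{n-k}},\qquad z\in[0,z_{\max}(t)].$$ Then for $z\in(0,z_{\max}(t)]$ the function $F$ is given in terms of $G$ by $$F(z,t)=z\exp\left(\int_0^z\left[\sqrt{Q^G(\tilde z,t)}-\frac1{\tilde z}\right]d\tilde z\right),$$ where $$Q^G(z,t)=-\frac1{k-1}\left[\partial_z\left(\frac{G_t-G_{zz}+(n-k-1)\frac{1-G_z^2}{G}}{G_z}\right)+(n-k)\frac{G_{zz}}{G}\right],$$ and this representation formula extends smoothly to $z=0$. In particular, let $(M^n,g_i(t))$, $i=1,2$, be two $SO(k)\times SO(n-k+1)$-symmetric $n$-dimensional ancient ovals of the Ricci flow whose tangent flow at $-\infty$ is $\mathbb{R}^k\times S^{n-k}(\sqrt{2(n-k-1)|t|})$, and, after suitably fixing the time translation, parabolic scaling, origin and orientation of the $z$-coordinate, and the labeling of the two spherical factors, let them be represented by profile functions $(F_i(z,t),G_i(z,t))$ in the form $$g_i(t)=dz\otimes dz+F_i^2(z,t)\,g_{S^{k-1}}+G_i^2(z,t)\,g_{S^{n-k}},\qquad i=1,2.$$ Then $G_1(z,t)=G_2(z,t)$ implies $F_1(z,t)=F_2(z,t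)$.
   Context: A $\kappa$-solution is an ancient solution of the Ricci flow that is complete with bounded curvature on compact time intervals, has nonnegative curvature operator and positive scalar curvature, and is $\kappa$-noncollapsed at all scales. An $n$-dimensional ancient oval ($n\ge3$) is a compact, simply-connected, non-self-similar $\kappa$-solution whose tangent flow at $-\infty$ is a self-shrinking cylinder $\mathbb{R}^j\times S^{n-j}(\sqrt{2(n-j-1)|t|})$ for some $1\le j\le n-2$. The tangent flow at $-\infty$ is the smooth pointed limit of the flow parabolically dilated by the factor $(-t_i)^{-1/2}$, $t_i\to-\infty$, around points $x_i$ of uniformly bounded reduced distance from a fixed base point $(q,0)$. $SO(k)\times SO(n-k+1)$-symmetric: the group acts by isometries with principal orbits $S^{k-1}\times S^{n-k}$. Here $z$ is the distance to the orbit fixed by the $SO(k)$-action; $F$, $G$ are the radii of the $S^{k-1}$ and $S^{n-k}$ fibers; $g_{S^m}$ is the unit sphere metric. Smoothness at the singular orbits: $F(0,t)=0$, $F_z(0,t)=1$, $G_z(0,t)=0$, $G(0,t)>0$ (with $F$ odd and $G$ even at $z=0$); $G(z_{\max},t)=0$, $G_z(z_{\max},t)=-1$, $F_z(z_{\max},t)=0$, $F(z_{\max},t)>0$ (with $F$ even and $G$ odd at $z_{\max}$). Subscripts denote partial derivatives; $G_t$ is the time derivative at fixed $z$ (so it includes the effect of the time dependence of the distance coordinate $z$). *)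

theory Defs
  imports "HOL-Analysis.Analysis"
begin

section \<open>Smooth functions\<close>

fun iter_pd :: "'e::euclidean_space list \<Rightarrow> ('e \<Rightarrow> 'b::real_normed_vector) \<Rightarrow> 'e \<Rightarrow> 'b" where
  "iter_pd [] f = f"
| "iter_pd (b # bs) f = (\<lambda>x. frechet_derivative (iter_pd bs f) (at x) b)"

text \<open>On a set that is not open, smooth means: restriction of a smooth function on an open
  neighbourhood. On closed intervals and half spaces this is smoothness up to the boundary.\<close>

definition smooth_on :: "('e::euclidean_space \<Rightarrow> 'b::real_normed_vector) \<Rightarrow> 'e set \<Rightarrow> bool" where
  "smooth_on f S \<longleftrightarrow> (\<exists>U h. open U \<and> S \<subseteq> U \<and>
     (\<forall>bs. set bs \<subseteq> Basis \<longrightarrow> (\<forall>x\<in>U. iter_pd bs h differentiable (at x))) \<and>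
     (\<forall>x\<in>S. h x = f x))"


section \<open>Smooth manifolds\<close>

text \<open>The manifold is the whole (topological) type \<open>'a\<close>; its dimension is \<open>CARD('n)\<close>. A chart is
  a domain together with a coordinate map, whose values outside the domain are irrelevant.\<close>

type_synonym ('a, 'n) chart = "'a set \<times> ('a \<Rightarrow> real^'n)"

definition chart_inv :: "('a, 'n::finite) chart \<Rightarrow> real^'n \<Rightarrow> 'a" where
  "chart_inv c = inv_into (fst c) (snd c)"

definition chart_image :: "('a, 'n::finite) chart \<Rightarrow> (real^'n) set" where
  "chart_image c = snd c ` fst c"

definition is_chart :: "('a::topological_space, 'n::finite) chart \<Rightarrow> bool" where
  "is_chart c \<longleftrightarrow> open (fst c) \<and> open (chart_image c) \<and>
     homeomorphism (fst c) (chart_image c) (snd c) (chart_inv c)"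

definition transition :: "('a, 'n::finite) chart \<Rightarrow> ('a, 'n) chart \<Rightarrow> real^'n \<Rightarrow> real^'n" where
  "transition c d = snd d \<circ> chart_inv c"

definition compatible :: "('a, 'n::finite) chart \<Rightarrow> ('a, 'n) chart \<Rightarrow> bool" where
  "compatible c d \<longleftrightarrow> smooth_on (transition c d) (snd c ` (fst c \<inter> fst d)) \<and>
     smooth_on (transition d c) (snd d ` (fst c \<inter> fst d))"

text \<open>A smooth structure is a maximal atlas.\<close>

definition smooth_structure ::
  "('a::{t2_space,second_countable_topology}, 'n::finite) chart set \<Rightarrow> bool" where
  "smooth_structure A \<longleftrightarrow>
     (\<forall>c\<in>A. is_chart c) \<and> (\<Union>c\<in>A. fst c) = UNIV \<and>
     (\<forall>c\<in>A. \<forall>d\<in>A. compatible c d) \<and>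
     (\<forall>c. is_chart c \<and> (\<forall>d\<in>A. compatible c d) \<longrightarrow> c \<in> A)"

definition chart_at :: "('a, 'n::finite) chart set \<Rightarrow> 'a \<Rightarrow> ('a, 'n) chart" where
  "chart_at A p = (SOME c. c \<in> A \<and> p \<in> fst c)"

definition smooth_into ::
  "('a::topological_space, 'n::finite) chart set \<Rightarrow> ('e::euclidean_space \<Rightarrow> 'a) \<Rightarrow> 'e set \<Rightarrow> bool" where
  "smooth_into A f S \<longleftrightarrow> continuous_on S f \<and>
     (\<forall>c\<in>A. smooth_on (snd c \<circ> f) (S \<inter> f -` fst c))"

definition smooth_map :: "('a::topological_space, 'n::finite) chart set \<Rightarrow> ('a \<Rightarrow> 'a) \<Rightarrow> bool" where
  "smooth_map A f \<longleftrightarrow> (\<forall>c\<in>A. smooth_into A (f \<circ> chart_inv c) (chart_image c))"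

definition diffeo :: "('a::topological_space, 'n::finite) chart set \<Rightarrow> ('a \<Rightarrow> 'a) \<Rightarrow> bool" where
  "diffeo A f \<longleftrightarrow> bij f \<and> smooth_map A f \<and> smooth_map A (inv f)"


section \<open>Riemannian metrics\<close>

text \<open>A metric is given by its coordinate matrices in all charts, related by the transformation
  law of covariant 2-tensors.\<close>

type_synonym ('a, 'n) metric = "('a, 'n) chart \<Rightarrow> real^'n \<Rightarrow> real^'n^'n"

definition riemannian_metric :: "('a, 'n::finite) chart set \<Rightarrow> ('a, 'n) metric \<Rightarrow> bool" where
  "riemannian_metric A h \<longleftrightarrow>
     (\<forall>c\<in>A. smooth_on (h c) (chart_image c) \<and>
        (\<forall>x\<in>chart_image c. transpose (h c x) = h c x \<and> (\<forall>v. v \<noteq> 0 \<longrightarrow> 0 < v \<bullet> (h c x *v v)))) \<and>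
     (\<forall>c\<in>A. \<forall>d\<in>A. \<forall>p\<in>fst c \<inter> fst d.
        let J = matrix (frechet_derivative (transition c d) (at (snd c p)))
        in h c (snd c p) = transpose J ** h d (snd d p) ** J)"

definition pullback ::
  "('a, 'n::finite) chart set \<Rightarrow> ('a, 'n) metric \<Rightarrow> ('e::euclidean_space \<Rightarrow> 'a) \<Rightarrow> 'e \<Rightarrow> 'e \<Rightarrow> 'e \<Rightarrow> real" where
  "pullback A h f x v w =
     (let c = chart_at A (f x); D = frechet_derivative (snd c \<circ> f) (at x)
      in D v \<bullet> (h c (snd c (f x)) *v D w))"

text \<open>\<open>f\<^sup>* h' = h\<close>\<close>

definition pulls_back ::
  "('a, 'n::finite) chart set \<Rightarrow> ('a \<Rightarrow> 'a) \<Rightarrow> ('a, 'n) metric \<Rightarrow> ('a, 'n) metric \<Rightarrow> bool" where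
  "pulls_back A f h' h \<longleftrightarrow> (\<forall>c\<in>A. \<forall>x\<in>chart_image c. \<forall>v w.
     pullback A h' (f \<circ> chart_inv c) x v w = v \<bullet> (h c x *v w))"

definition speed_sq ::
  "('a, 'n::finite) chart set \<Rightarrow> ('a, 'n) metric \<Rightarrow> (real \<Rightarrow> 'a) \<Rightarrow> real \<Rightarrow> real" where
  "speed_sq A h \<gamma> s =
     (let c = chart_at A (\<gamma> s); v = vector_derivative (snd c \<circ> \<gamma>) (at s)
      in v \<bullet> (h c (snd c (\<gamma> s)) *v v))"

definition admissible_curve ::
  "('a::topological_space, 'n::finite) chart set \<Rightarrow> (real \<Rightarrow> 'a) \<Rightarrow> real \<Rightarrow> real \<Rightarrow> bool" where
  "admissible_curve A \<gamma> a b \<longleftrightarrow> continuous_on {a..b} \<gamma> \<and>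
     (\<exists>S. finite S \<and> (\<forall>s\<in>{a<..<b} - S. \<exists>c\<in>A. \<exists>\<epsilon>>0.
        \<gamma> ` ball s \<epsilon> \<subseteq> fst c \<and> (snd c \<circ> \<gamma>) C1_differentiable_on (ball s \<epsilon>)))"

definition riem_dist ::
  "('a::topological_space, 'n::finite) chart set \<Rightarrow> ('a, 'n) metric \<Rightarrow> 'a \<Rightarrow> 'a \<Rightarrow> real" where
  "riem_dist A h p q = Inf {integral {0..1} (\<lambda>s. sqrt (speed_sq A h \<gamma> s)) | \<gamma>.
     admissible_curve A \<gamma> 0 1 \<and> \<gamma> 0 = p \<and> \<gamma> 1 = q \<and>
     (\<lambda>s. sqrt (speed_sq A h \<gamma> s)) integrable_on {0..1}}"

definition complete_metric ::
  "('a::topological_space, 'n::finite) chart set \<Rightarrow> ('a, 'n) metric \<Rightarrow> bool" where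
  "complete_metric A h \<longleftrightarrow> (\<forall>X::nat \<Rightarrow> 'a.
     (\<forall>e>0. \<exists>N. \<forall>i\<ge>N. \<forall>j\<ge>N. riem_dist A h (X i) (X j) < e) \<longrightarrow>
     (\<exists>p. (\<lambda>i. riem_dist A h (X i) p) \<longlonglongrightarrow> 0))"

definition riem_volume ::
  "('a::topological_space, 'n::finite) chart set \<Rightarrow> ('a, 'n) metric \<Rightarrow> 'a measure \<Rightarrow> bool" where
  "riem_volume A h \<mu> \<longleftrightarrow> sets \<mu> = sets borel \<and>
     (\<forall>c\<in>A. \<forall>B\<in>sets borel. B \<subseteq> fst c \<longrightarrow>
        emeasure \<mu> B = (\<integral>\<^sup>+x\<in>snd c ` B. ennreal (sqrt (det (h c x))) \<partial>lborel))"


section \<open>Curvature, in coordinates\<close>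

definition pd :: "'n::finite \<Rightarrow> (real^'n \<Rightarrow> real) \<Rightarrow> real^'n \<Rightarrow> real" where
  "pd i f x = frechet_derivative f (at x) (axis i 1)"

text \<open>\<open>christoffel h i j m\<close> is \<open>\<Gamma>\<^sup>m\<^sub>i\<^sub>j\<close>.\<close>

definition christoffel ::
  "(real^'n::finite \<Rightarrow> real^'n^'n) \<Rightarrow> 'n \<Rightarrow> 'n \<Rightarrow> 'n \<Rightarrow> real^'n \<Rightarrow> real" where
  "christoffel h i j m x = (1/2) * (\<Sum>l\<in>UNIV. matrix_inv (h x) $ m $ l *
     (pd i (\<lambda>y. h y $ j $ l) x + pd j (\<lambda>y. h y $ i $ l) x - pd l (\<lambda>y. h y $ i $ j) x))"

text \<open>\<open>riem13 h i j k l\<close> is the coefficient of \<open>\<partial>\<^sub>l\<close> in \<open>R(\<partial>\<^sub>i, \<partial>\<^sub>j) \<partial>\<^sub>k\<close>, and \<open>riem04 h i j k l\<close> is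
  \<open>\<langle>R(\<partial>\<^sub>i, \<partial>\<^sub>j) \<partial>\<^sub>k, \<partial>\<^sub>l\<rangle>\<close>; sectional curvatures are \<open>\<langle>R(X, Y) Y, X\<rangle>\<close>.\<close>

definition riem13 ::
  "(real^'n::finite \<Rightarrow> real^'n^'n) \<Rightarrow> 'n \<Rightarrow> 'n \<Rightarrow> 'n \<Rightarrow> 'n \<Rightarrow> real^'n \<Rightarrow> real" where
  "riem13 h i j k l x =
     pd i (christoffel h j k l) x - pd j (christoffel h i k l) x +
     (\<Sum>m\<in>UNIV. christoffel h j k m x * christoffel h i m l x
              - christoffel h i k m x * christoffel h j m l x)"

definition riem04 ::
  "(real^'n::finite \<Rightarrow> real^'n^'n) \<Rightarrow> 'n \<Rightarrow> 'n \<Rightarrow> 'n \<Rightarrow> 'n \<Rightarrow> real^'n \<Rightarrow> real" where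
  "riem04 h i j k l x = (\<Sum>m\<in>UNIV. h x $ l $ m * riem13 h i j k m x)"

definition ricci :: "(real^'n::finite \<Rightarrow> real^'n^'n) \<Rightarrow> real^'n \<Rightarrow> real^'n^'n" where
  "ricci h x = (\<chi> j k. \<Sum>i\<in>UNIV. riem13 h i j k i x)"

definition scalar_curv :: "(real^'n::finite \<Rightarrow> real^'n^'n) \<Rightarrow> real^'n \<Rightarrow> real" where
  "scalar_curv h x = (\<Sum>j\<in>UNIV. \<Sum>k\<in>UNIV. matrix_inv (h x) $ j $ k * ricci h x $ j $ k)"

definition riem_norm :: "(real^'n::finite \<Rightarrow> real^'n^'n) \<Rightarrow> real^'n \<Rightarrow> real" where
  "riem_norm h x = (let H = matrix_inv (h x) in
     sqrt (\<Sum>i\<in>UNIV. \<Sum>j\<in>UNIV. \<Sum>k\<in>UNIV. \<Sum>l\<in>UNIV. \<Sum>i'\<in>UNIV. \<Sum>j'\<in>UNIV. \<Sum>k'\<in>UNIV. \<Sum>l'\<in>UNIV.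
       H $ i $ i' * H $ j $ j' * H $ k $ k' * H $ l $ l' *
       riem04 h i j k l x * riem04 h i' j' k' l' x))"

text \<open>\<open>\<omega>\<close> ranges over the 2-vectors \<open>\<Sum> \<omega>\<^sup>i\<^sup>j \<partial>\<^sub>i \<and> \<partial>\<^sub>j\<close>; the index order makes the form positive on
  spheres.\<close>

definition curv_op_nonneg :: "(real^'n::finite \<Rightarrow> real^'n^'n) \<Rightarrow> real^'n \<Rightarrow> bool" where
  "curv_op_nonneg h x \<longleftrightarrow> (\<forall>\<omega>::real^'n^'n. transpose \<omega> = - \<omega> \<longrightarrow>
     0 \<le> (\<Sum>i\<in>UNIV. \<Sum>j\<in>UNIV. \<Sum>k\<in>UNIV. \<Sum>l\<in>UNIV. riem04 h i j k l x * \<omega> $ i $ j * \<omega> $ l $ k))"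

definition at_point ::
  "('a, 'n::finite) chart set \<Rightarrow> ('a, 'n) metric \<Rightarrow> ((real^'n \<Rightarrow> real^'n^'n) \<Rightarrow> real^'n \<Rightarrow> 'b) \<Rightarrow> 'a \<Rightarrow> 'b" where
  "at_point A h T p = (let c = chart_at A p in T (h c) (snd c p))"


section \<open>Ancient Ricci flows on the time interval up to and including 0\<close>

type_synonym ('a, 'n) flow = "real \<Rightarrow> ('a, 'n) metric"

definition ancient_ricci_flow ::
  "('a::{t2_space,second_countable_topology}, 'n::finite) chart set \<Rightarrow> ('a, 'n) flow \<Rightarrow> bool" where
  "ancient_ricci_flow A g \<longleftrightarrow> smooth_structure A \<and> connected (UNIV :: 'a set) \<and>
     (\<forall>t\<le>0. riemannian_metric A (g t)) \<and>
     (\<forall>c\<in>A. smooth_on (\<lambda>(t, x). g t c x) ({..0} \<times> chart_image c)) \<and>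
     (\<forall>t\<le>0. \<forall>c\<in>A. \<forall>x\<in>chart_image c.
        ((\<lambda>s. g s c x) has_vector_derivative (- 2) *\<^sub>R ricci (g t c) x) (at t within {..0}))"

definition noncollapsed ::
  "real \<Rightarrow> ('a::topological_space, 'n::finite) chart set \<Rightarrow> ('a, 'n) metric \<Rightarrow> bool" where
  "noncollapsed \<kappa> A h \<longleftrightarrow> (\<exists>\<mu>. riem_volume A h \<mu> \<and>
     (\<forall>p. \<forall>r>0. (\<forall>q. riem_dist A h p q < r \<longrightarrow> at_point A h riem_norm q \<le> 1 / r\<^sup>2) \<longrightarrow>
        ennreal (\<kappa> * r ^ CARD('n)) \<le> emeasure \<mu> {q. riem_dist A h p q < r}))"

definition kappa_solution ::
  "real \<Rightarrow> ('a::{t2_space,second_countable_topology}, 'n::finite) chart set \<Rightarrow> ('a, 'n) flow \<Rightarrow> bool" where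
  "kappa_solution \<kappa> A g \<longleftrightarrow> \<kappa> > 0 \<and> ancient_ricci_flow A g \<and>
     (\<forall>t\<le>0. complete_metric A (g t)) \<and>
     (\<forall>a b. a \<le> b \<and> b \<le> 0 \<longrightarrow> (\<exists>C. \<forall>t\<in>{a..b}. \<forall>p. at_point A (g t) riem_norm p \<le> C)) \<and>
     (\<forall>t\<le>0. \<forall>p. at_point A (g t) curv_op_nonneg p) \<and>
     (\<forall>t\<le>0. \<forall>p. at_point A (g t) scalar_curv p > 0) \<and>
     (\<forall>t\<le>0. noncollapsed \<kappa> A (g t))"

definition scale_metric :: "real \<Rightarrow> ('a, 'n::finite) metric \<Rightarrow> ('a, 'n) metric" where
  "scale_metric \<sigma> h = (\<lambda>c x. \<sigma> *\<^sub>R h c x)"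

definition self_similar ::
  "('a::topological_space, 'n::finite) chart set \<Rightarrow> ('a, 'n) flow \<Rightarrow> bool" where
  "self_similar A g \<longleftrightarrow> (\<exists>\<sigma> \<psi>. \<forall>t\<le>0. \<sigma> t > 0 \<and> diffeo A (\<psi> t) \<and>
     pulls_back A (\<psi> t) (scale_metric (\<sigma> t) (g 0)) (g t))"

text \<open>Perelman's reduced distance from the base point \<open>(q, 0)\<close>, with backward time \<open>\<tau> = - t\<close>.\<close>

definition reduced_dist ::
  "('a::topological_space, 'n::finite) chart set \<Rightarrow> ('a, 'n) flow \<Rightarrow> 'a \<Rightarrow> 'a \<Rightarrow> real \<Rightarrow> real" where
  "reduced_dist A g q x t =
     (let L = (\<lambda>\<gamma> s. sqrt s * (at_point A (g (- s)) scalar_curv (\<gamma> s) + speed_sq A (g (- s)) \<gamma> s))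
      in 1 / (2 * sqrt (- t)) * Inf {integral {0..- t} (L \<gamma>) | \<gamma>.
           admissible_curve A \<gamma> 0 (- t) \<and> \<gamma> 0 = q \<and> \<gamma> (- t) = x \<and> L \<gamma> integrable_on {0..- t}})"


section \<open>Shrinking cylinders as tangent flows at minus infinity\<close>

text \<open>The cylinder of dimension \<open>n = CARD('n)\<close> with flat factor of dimension \<open>j\<close> is realised in
  \<open>\<real>\<^sup>n\<^sup>+\<^sup>1\<close>, with coordinates indexed by \<open>'n option\<close>: the flat directions are those in a set \<open>J\<close> of \<open>j\<close>
  indices, and the cross section is the unit sphere in the remaining \<open>n + 1 - j\<close> directions. The
  radius of the sphere enters through the metric only.\<close>

definition cross_norm :: "'n::finite option set \<Rightarrow> real^'n option \<Rightarrow> real" where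
  "cross_norm J x = sqrt (\<Sum>i\<in>- J. (x $ i)\<^sup>2)"

definition cylinder :: "'n::finite option set \<Rightarrow> (real^'n option) set" where
  "cylinder J = {x. cross_norm J x = 1}"

definition cyl_proj :: "'n::finite option set \<Rightarrow> real^'n option \<Rightarrow> real^'n option" where
  "cyl_proj J x = (\<chi> i. if i \<in> J then x $ i else x $ i / cross_norm J x)"

text \<open>The pullback under \<open>cyl_proj J\<close> of the metric at time \<open>t < 0\<close> of the shrinking cylinder
  \<open>\<real>\<^sup>j \<times> S\<^sup>n\<^sup>-\<^sup>j(sqrt (2 (n - j - 1) \<bar>t\<bar>))\<close>. Tensors on the cylinder are compared through their
  pullbacks under this retraction, defined on the open set \<open>cross_norm J x \<noteq> 0\<close>.\<close>

definition cyl_form ::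
  "'n::finite option set \<Rightarrow> real \<Rightarrow> real^'n option \<Rightarrow> real^'n option \<Rightarrow> real^'n option \<Rightarrow> real" where
  "cyl_form J t x v w =
     (let D = frechet_derivative (cyl_proj J) (at x);
          r = sqrt (2 * (real CARD('n) - real (card J) - 1) * \<bar>t\<bar>)
      in (\<Sum>i\<in>J. D v $ i * D w $ i) + r\<^sup>2 * (\<Sum>i\<in>- J. D v $ i * D w $ i))"

definition parabolic_dilation :: "real \<Rightarrow> ('a, 'n::finite) flow \<Rightarrow> ('a, 'n) flow" where
  "parabolic_dilation lam g t = scale_metric (lam\<^sup>2) (g (t / lam\<^sup>2))"

text \<open>Smooth convergence of the pointed flows \<open>(M, gs i, X i)\<close> to the shrinking cylinder on
  \<open>t < 0\<close>, in the sense of Cheeger, Gromov and Hamilton: there are open sets \<open>U i\<close> exhausting the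
  cylinder and diffeomorphisms \<open>f i\<close> from \<open>U i\<close> onto open subsets of \<open>M\<close> taking the base point to
  \<open>X i\<close>, such that the pulled back metrics converge with all space-time derivatives, locally
  uniformly.\<close>

definition converges_to_cylinder ::
  "('a::topological_space, 'n::finite) chart set \<Rightarrow> (nat \<Rightarrow> ('a, 'n) flow) \<Rightarrow> (nat \<Rightarrow> 'a) \<Rightarrow>
   'n option set \<Rightarrow> bool" where
  "converges_to_cylinder A gs X J \<longleftrightarrow> (\<exists>p0 U f. p0 \<in> cylinder J \<and>
     (\<forall>i. openin (top_of_set (cylinder J)) (U i) \<and> p0 \<in> U i \<and> f i p0 = X i) \<and>
     (\<forall>K. compact K \<and> K \<subseteq> cylinder J \<longrightarrow> (\<forall>\<^sub>F i in sequentially. K \<subseteq> U i)) \<and>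
     (\<forall>i. inj_on (f i) (U i) \<and>
        smooth_into A (f i \<circ> cyl_proj J) {x. cross_norm J x \<noteq> 0 \<and> cyl_proj J x \<in> U i} \<and>
        (\<forall>x\<in>U i. \<forall>v. v \<noteq> 0 \<and> (\<Sum>m\<in>- J. x $ m * v $ m) = 0 \<longrightarrow>
           frechet_derivative (snd (chart_at A (f i x)) \<circ> (f i \<circ> cyl_proj J)) (at x) v \<noteq> 0)) \<and>
     (\<forall>K. compact K \<and> K \<subseteq> {..<0} \<times> {x. cross_norm J x \<noteq> 0} \<longrightarrow>
        (\<forall>bs. set bs \<subseteq> Basis \<longrightarrow> (\<forall>a b. uniform_limit K
           (\<lambda>i. iter_pd bs (\<lambda>(t, x). pullback A (gs i t) (f i \<circ> cyl_proj J) x (axis a 1) (axis b 1)))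
           (iter_pd bs (\<lambda>(t, x). cyl_form J t x (axis a 1) (axis b 1)))
           sequentially))))"

definition tangent_flow_cylinder ::
  "('a::topological_space, 'n::finite) chart set \<Rightarrow> ('a, 'n) flow \<Rightarrow> nat \<Rightarrow> bool" where
  "tangent_flow_cylinder A g j \<longleftrightarrow> (\<exists>q C T X J.
     (\<forall>i. T i < 0) \<and> filterlim T at_bot sequentially \<and>
     (\<forall>i. reduced_dist A g q (X i) (T i) \<le> C) \<and> card J = j \<and>
     converges_to_cylinder A (\<lambda>i. parabolic_dilation ((- T i) powr (- 1/2)) g) X J)"

definition ancient_oval ::
  "('a::{t2_space,second_countable_topology}, 'n::finite) chart set \<Rightarrow> ('a, 'n) flow \<Rightarrow> bool" where
  "ancient_oval A g \<longleftrightarrow> 3 \<le> CARD('n) \<and> (\<exists>\<kappa>. kappa_solution \<kappa> A g) \<and>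
     compact (UNIV :: 'a set) \<and> simply_connected (UNIV :: 'a set) \<and> \<not> self_similar A g \<and>
     (\<exists>j. 1 \<le> j \<and> j \<le> CARD('n) - 2 \<and> tangent_flow_cylinder A g j)"


section \<open>Symmetry and profile functions\<close>

definition SO :: "(real^'k^'k::finite) set" where
  "SO = {R. orthogonal_matrix R \<and> det R = 1}"

text \<open>With \<open>k = CARD('k)\<close> and \<open>n - k + 1 = CARD('l)\<close>, the unit spheres of \<open>real^'k\<close> and
  \<open>real^'l\<close> are \<open>S\<^sup>k\<^sup>-\<^sup>1\<close> and \<open>S\<^sup>n\<^sup>-\<^sup>k\<close>. One action is isometric at all times.\<close>

definition orbit ::
  "(real^'k^'k::finite \<Rightarrow> real^'l^'l::finite \<Rightarrow> 'a \<Rightarrow> 'a) \<Rightarrow> 'a \<Rightarrow> 'a set" where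
  "orbit \<rho> p = {\<rho> R S p | R S. R \<in> SO \<and> S \<in> SO}"

definition so_symmetric ::
  "('a::topological_space, 'n::finite) chart set \<Rightarrow> ('a, 'n) flow \<Rightarrow>
   (real^'k^'k::finite \<Rightarrow> real^'l^'l::finite \<Rightarrow> 'a \<Rightarrow> 'a) \<Rightarrow> bool" where
  "so_symmetric A g \<rho> \<longleftrightarrow>
     \<rho> (mat 1) (mat 1) = id \<and>
     (\<forall>R\<in>SO. \<forall>S\<in>SO. \<forall>R'\<in>SO. \<forall>S'\<in>SO. \<rho> (R ** R') (S ** S') = \<rho> R S \<circ> \<rho> R' S') \<and>
     continuous_on (SO \<times> SO \<times> UNIV) (\<lambda>(R, S, p). \<rho> R S p) \<and>
     (\<forall>R\<in>SO. \<forall>S\<in>SO. diffeo A (\<rho> R S) \<and> (\<forall>t\<le>0. pulls_back A (\<rho> R S) (g t) (g t))) \<and>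
     (\<exists>W. open W \<and> closure W = UNIV \<and> (\<forall>p\<in>W. \<exists>e.
        continuous_on (sphere 0 1 \<times> sphere 0 1) e \<and>
        bij_betw e (sphere 0 1 \<times> sphere 0 1) (orbit \<rho> p) \<and>
        (\<forall>R\<in>SO. \<forall>S\<in>SO. \<forall>x\<in>sphere 0 1. \<forall>y\<in>sphere 0 1. e (R *v x, S *v y) = \<rho> R S (e (x, y)))))"

definition SO_k_fixed ::
  "(real^'k^'k::finite \<Rightarrow> real^'l^'l::finite \<Rightarrow> 'a \<Rightarrow> 'a) \<Rightarrow> 'a set" where
  "SO_k_fixed \<rho> = {p. \<forall>R\<in>SO. \<rho> R (mat 1) p = p}"

text \<open>The form \<open>g(t) = dz \<otimes> dz + F\<^sup>2 g\<^sub>S + G\<^sup>2 g\<^sub>S\<close>: at each time \<open>t\<close>, \<open>P t z x y\<close> is the point with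
  coordinates \<open>(z, x, y) \<in> [0, zmax t] \<times> S\<^sup>k\<^sup>-\<^sup>1 \<times> S\<^sup>n\<^sup>-\<^sup>k\<close>. Since a tangent vector at a point of the unit
  sphere is an orthogonal vector, and \<open>sgn x = x / norm x\<close> retracts onto the unit sphere, the
  clause about \<open>pullback\<close> says that \<open>g t\<close> has this form.\<close>

definition polar_coordinates ::
  "('a::topological_space, 'n::finite) chart set \<Rightarrow> ('a, 'n) flow \<Rightarrow>
   (real^'k^'k::finite \<Rightarrow> real^'l^'l::finite \<Rightarrow> 'a \<Rightarrow> 'a) \<Rightarrow>
   (real \<Rightarrow> real) \<Rightarrow> (real \<Rightarrow> real \<Rightarrow> real) \<Rightarrow> (real \<Rightarrow> real \<Rightarrow> real) \<Rightarrow>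
   (real \<Rightarrow> real \<Rightarrow> real^'k \<Rightarrow> real^'l \<Rightarrow> 'a) \<Rightarrow> bool" where
  "polar_coordinates A g \<rho> zmax F G P \<longleftrightarrow>
     smooth_into A (\<lambda>(t, z, x, y). P t z (sgn x) (sgn y))
       {(t, z, x, y). t \<le> 0 \<and> 0 < z \<and> z < zmax t \<and> x \<noteq> 0 \<and> y \<noteq> 0} \<and>
     (\<forall>t\<le>0.
       continuous_on ({0..zmax t} \<times> sphere 0 1 \<times> sphere 0 1) (\<lambda>(z, x, y). P t z x y) \<and>
       (\<forall>z\<in>{0..zmax t}. \<forall>x\<in>sphere 0 1. \<forall>y\<in>sphere 0 1. \<forall>R\<in>SO. \<forall>S\<in>SO.
          \<rho> R S (P t z x y) = P t z (R *v x) (S *v y)) \<and>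
       (\<forall>z\<in>{0<..<zmax t}. \<forall>x\<in>sphere 0 1. \<forall>y\<in>sphere 0 1. \<forall>\<zeta> u v \<zeta>' u' v'.
          u \<bullet> x = 0 \<and> u' \<bullet> x = 0 \<and> v \<bullet> y = 0 \<and> v' \<bullet> y = 0 \<longrightarrow>
          pullback A (g t) (\<lambda>(z, x, y). P t z (sgn x) (sgn y)) (z, x, y) (\<zeta>, u, v) (\<zeta>', u', v')
            = \<zeta> * \<zeta>' + (F z t)\<^sup>2 * (u \<bullet> u') + (G z t)\<^sup>2 * (v \<bullet> v')) \<and>
       (\<lambda>(z, x, y). P t z x y) ` ({0..zmax t} \<times> sphere 0 1 \<times> sphere 0 1) = UNIV \<and>
       inj_on (\<lambda>(z, x, y). P t z x y) ({0<..<zmax t} \<times> sphere 0 1 \<times> sphere 0 1) \<and>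
       (\<forall>x\<in>sphere 0 1. \<forall>y\<in>sphere 0 1. \<forall>x'\<in>sphere 0 1. \<forall>y'\<in>sphere 0 1.
          (P t 0 x y = P t 0 x' y' \<longleftrightarrow> y = y') \<and>
          (P t (zmax t) x y = P t (zmax t) x' y' \<longleftrightarrow> x = x')) \<and>
       (\<forall>z\<in>{0..zmax t}. \<forall>x\<in>sphere 0 1. \<forall>y\<in>sphere 0 1.
          Inf (riem_dist A (g t) (P t z x y) ` SO_k_fixed \<rho>) = z))"

definition profile_functions ::
  "('a::topological_space, 'n::finite) chart set \<Rightarrow> ('a, 'n) flow \<Rightarrow>
   (real^'k^'k::finite \<Rightarrow> real^'l^'l::finite \<Rightarrow> 'a \<Rightarrow> 'a) \<Rightarrow>
   (real \<Rightarrow> real) \<Rightarrow> (real \<Rightarrow> real \<Rightarrow> real) \<Rightarrow> (real \<Rightarrow> real \<Rightarrow> real) \<Rightarrow> bool" where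
  "profile_functions A g \<rho> zmax F G \<longleftrightarrow>
     (\<exists>P. polar_coordinates A g \<rho> zmax F G P) \<and>
     smooth_on zmax {..0} \<and>
     smooth_on (\<lambda>(z, t). F z t) {(z, t). t \<le> 0 \<and> 0 \<le> z \<and> z \<le> zmax t} \<and>
     smooth_on (\<lambda>(z, t). G z t) {(z, t). t \<le> 0 \<and> 0 \<le> z \<and> z \<le> zmax t} \<and>
     (\<forall>t\<le>0. zmax t > 0 \<and>
       (\<forall>z\<in>{0<..zmax t}. F z t > 0) \<and> (\<forall>z\<in>{0..<zmax t}. G z t > 0) \<and>
       F 0 t = 0 \<and> G (zmax t) t = 0 \<and>
       ((\<lambda>z. F z t) has_real_derivative 1) (at 0 within {0..zmax t}) \<and>
       ((\<lambda>z. G z t) has_real_derivative 0) (at 0 within {0..zmax t}) \<and>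
       ((\<lambda>z. F z t) has_real_derivative 0) (at (zmax t) within {0..zmax t}) \<and>
       ((\<lambda>z. G z t) has_real_derivative - 1) (at (zmax t) within {0..zmax t}) \<and>
       \<comment> \<open>odd and even reflections across the singular orbits are smooth\<close>
       smooth_on (\<lambda>z. sgn z * F \<bar>z\<bar> t) {- zmax t<..<zmax t} \<and>
       smooth_on (\<lambda>z. G \<bar>z\<bar> t) {- zmax t<..<zmax t} \<and>
       smooth_on (\<lambda>s. F (zmax t - \<bar>s\<bar>) t) {- zmax t<..<zmax t} \<and>
       smooth_on (\<lambda>s. sgn s * G (zmax t - \<bar>s\<bar>) t) {- zmax t<..<zmax t})"


section \<open>The representation formula\<close>

text \<open>The time derivative at fixed \<open>z\<close>; at \<open>t = 0\<close> it is one-sided.\<close>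

definition d_t :: "(real \<Rightarrow> real \<Rightarrow> real) \<Rightarrow> real \<Rightarrow> real \<Rightarrow> real" where
  "d_t G z t = vector_derivative (\<lambda>s. G z s) (at t within {..0})"

definition d_z :: "(real \<Rightarrow> real \<Rightarrow> real) \<Rightarrow> real \<Rightarrow> real \<Rightarrow> real" where
  "d_z G z t = deriv (\<lambda>s. G s t) z"

definition inner_quotient :: "nat \<Rightarrow> nat \<Rightarrow> (real \<Rightarrow> real \<Rightarrow> real) \<Rightarrow> real \<Rightarrow> real \<Rightarrow> real" where
  "inner_quotient n k G z t =
     (d_t G z t - d_z (d_z G) z t + (real n - real k - 1) * ((1 - (d_z G z t)\<^sup>2) / G z t)) / d_z G z t"

definition Q_G :: "nat \<Rightarrow> nat \<Rightarrow> (real \<Rightarrow> real \<Rightarrow> real) \<Rightarrow> real \<Rightarrow> real \<Rightarrow> real" where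
  "Q_G n k G z t = - (1 / (real k - 1)) *
     (d_z (inner_quotient n k G) z t + (real n - real k) * (d_z (d_z G) z t / G z t))"

definition F_formula :: "nat \<Rightarrow> nat \<Rightarrow> (real \<Rightarrow> real \<Rightarrow> real) \<Rightarrow> real \<Rightarrow> real \<Rightarrow> real" where
  "F_formula n k G z t = z * exp (integral {0..z} (\<lambda>s. sqrt (Q_G n k G s t) - 1 / s))"

end

theory Submission
  imports Defs
begin

text \<open>
  In the coordinates \<open>(z, x, y)\<close> the flow is a doubly warped product moving with a velocity field whose
  \<open>z\<close>-component is denoted \<open>\<zeta>\<close>. The \<open>zz\<close>- and \<open>yy\<close>-components of the Ricci flow equation are

    \<open>\<zeta>\<^sub>z = Ric\<^sub>z\<^sub>z = - (k - 1) F\<^sub>z\<^sub>z / F - (n - k) G\<^sub>z\<^sub>z / G\<close>,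

    \<open>G\<^sub>t = \<zeta> G\<^sub>z + G\<^sub>z\<^sub>z + (k - 1) F\<^sub>z G\<^sub>z / F - (n - k - 1) (1 - G\<^sub>z\<^sup>2) / G\<close>.

  Solving the second for \<open>\<zeta> + (k - 1) F\<^sub>z / F\<close>, differentiating, and inserting the first, all second
  derivatives of \<open>F\<close> cancel and \<open>Q\<^sup>G = (F\<^sub>z / F)\<^sup>2\<close>. Nonnegative curvature makes \<open>F\<close> and \<open>G\<close> concave in \<open>z\<close>,
  so \<open>F\<^sub>z \<ge> 0\<close> and \<open>G\<^sub>z \<le> 0\<close>; that \<open>G\<^sub>z\<close> does not vanish in the interior is the strong maximum principle for
  the linear parabolic equation satisfied by \<open>G\<^sub>z\<close>. Integrating \<open>F\<^sub>z / F = sqrt Q\<^sup>G\<close> gives the formula.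

  Curvatures are not transformed between charts. Writing \<open>u\<close> for the coordinates in a given chart of the
  point with parameters \<open>(z, x, y)\<close>, all components of the curvature that are needed follow from the inner
  products of the partial derivatives of \<open>u\<close>, which are known from the warped product form.
\<close>

section \<open>Smooth functions and directional derivatives\<close>

text \<open>The polar map depends on time: at fixed parameters \<open>(z, x, y)\<close> the point of
  the manifold moves, and its velocity \<open>W\<close> adds a Lie derivative to the - 2 Ric of the
  flow. Two components of that term are needed. Along \<open>Z\<close> it yields \<zeta>_z, because
  the z-lines are geodesics; along a spherical direction \<open>Y j\<close> it yields G G_z \<zeta>,
  provided that \<open>W\<close> is orthogonal to \<open>Y j\<close>. This orthogonality is where
  the group action enters: an isometry that fixes the moving point at all times and reverses the
  direction \<open>Y j\<close> must preserve the inner product of the two, which is therefore 0. To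
  have determinant 1 it must reverse a second direction too, hence the need for three coordinates in
  \<open>real^'l\<close>.

  Concavity alone leaves G_z \<le> 0. Strictness, without which the quotient in Q^G makes no sense,
  comes from G_z = - 1 at the far end of the interval, carried inward by the maximum principle. In
  the equation for G_z the second derivative of F cancels as well, and what remains is linear with
  locally bounded coefficients.\<close>

definition dird :: "'e::euclidean_space \<Rightarrow> ('e \<Rightarrow> 'b::real_normed_vector) \<Rightarrow> 'e \<Rightarrow> 'b" where
  "dird a f = (\<lambda>x. frechet_derivative f (at x) a)"

text \<open>The condition that \<open>smooth_on\<close> places on the extension. Once an extension
  to an open set is chosen, derivatives are taken of it, also at the final time and at the singular
  orbits, where the given functions have only one-sided ones.\<close>

definition Cinf :: "('e::euclidean_space \<Rightarrow> 'b::real_normed_vector) \<Rightarrow> 'e set \<Rightarrow> bool" where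
  "Cinf f N \<longleftrightarrow> (\<forall>bs. set bs \<subseteq> Basis \<longrightarrow> (\<forall>x\<in>N. iter_pd bs f differentiable (at x)))"

lemma smooth_on_iff: "smooth_on f S \<longleftrightarrow> (\<exists>U h. open U \<and> S \<subseteq> U \<and> Cinf h U \<and> (\<forall>x\<in>S. h x = f x))"
  unfolding smooth_on_def Cinf_def by blast

lemma iter_pd_Cons: "iter_pd (b # bs) f = dird b (iter_pd bs f)"
  by (simp add: dird_def)

lemma iter_pd_append: "iter_pd (as @ bs) f = iter_pd as (iter_pd bs f)"
  by (induction as) auto

lemma Cinf_differentiable: "Cinf f N \<Longrightarrow> x \<in> N \<Longrightarrow> f differentiable (at x)"
  unfolding Cinf_def by (metis empty_set empty_subsetI iter_pd.simps(1))

lemma Cinf_subset: "Cinf f N \<Longrightarrow> M \<subseteq> N \<Longrightarrow> Cinf f M"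
  unfolding Cinf_def by blast

lemma Cinf_dird: "Cinf f N \<Longrightarrow> b \<in> Basis \<Longrightarrow> Cinf (dird b f) N"
  unfolding Cinf_def
proof (intro allI impI ballI)
  fix bs :: "'a list" and x assume *: "\<forall>bs. set bs \<subseteq> Basis \<longrightarrow> (\<forall>x\<in>N. iter_pd bs f differentiable at x)"
    "b \<in> Basis" "set bs \<subseteq> Basis" "x \<in> N"
  have "iter_pd bs (dird b f) = iter_pd (bs @ [b]) f"
    by (simp add: iter_pd_append dird_def)
  then show "iter_pd bs (dird b f) differentiable at x" using * by auto
qed

lemma dird_has_derivative:
  "f differentiable (at x) \<Longrightarrow> (f has_derivative (\<lambda>v. dird v f x)) (at x)"
  unfolding dird_def using frechet_derivative_works by blast

lemma dird_eqI: "(f has_derivative f') (at x) \<Longrightarrow> dird a f x = f' a"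
  unfolding dird_def by (metis frechet_derivative_at)

lemma dird_cong_open:
  assumes "open N" "x \<in> N" "\<And>y. y \<in> N \<Longrightarrow> f y = g y"
  shows "dird a f x = dird a g x"
proof -
  have "frechet_derivative f (at x) = frechet_derivative g (at x)"
  proof -
    have "(f has_derivative f') (at x) \<longleftrightarrow> (g has_derivative f') (at x)" for f'
      by (metis assms has_derivative_transform_within_open)
    then show ?thesis unfolding frechet_derivative_def by simp
  qed
  then show ?thesis by (simp add: dird_def)
qed

lemma differentiable_cong_open:
  assumes "open N" "x \<in> N" "\<And>y. y \<in> N \<Longrightarrow> f y = g y" "f differentiable (at x)"
  shows "g differentiable (at x)"
  by (metis assms differentiable_def has_derivative_transform_within_open)

lemma iter_pd_cong_open:
  assumes "open N" "\<And>y. y \<in> N \<Longrightarrow> f y = g y"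
  shows "y \<in> N \<Longrightarrow> iter_pd bs f y = iter_pd bs g y"
proof (induction bs arbitrary: y)
  case (Cons b bs)
  then show ?case unfolding iter_pd_Cons using dird_cong_open[OF assms(1)] by blast
qed (use assms in auto)

lemma Cinf_cong:
  assumes "open N" "\<And>y. y \<in> N \<Longrightarrow> f y = g y" "Cinf f N"
  shows "Cinf g N"
  unfolding Cinf_def
proof (intro allI impI ballI)
  fix bs :: "'a list" and x assume x: "set bs \<subseteq> Basis" "x \<in> N"
  show "iter_pd bs g differentiable at x"
  proof (rule differentiable_cong_open[OF assms(1) x(2)])
    show "iter_pd bs f differentiable at x" using x assms(3) by (auto simp: Cinf_def)
  qed (use iter_pd_cong_open[OF assms(1,2)] in auto)
qed

lemma Cinf_continuous_on: "Cinf f N \<Longrightarrow> continuous_on N f"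
  by (meson Cinf_differentiable continuous_at_imp_continuous_on differentiable_imp_continuous_within)

lemma dird_line:
  assumes "f differentiable (at (x + s *\<^sub>R a))"
  shows "((\<lambda>s. f (x + s *\<^sub>R a)) has_vector_derivative dird a f (x + s *\<^sub>R a)) (at s within S)"
proof -
  have 1: "((\<lambda>s. x + s *\<^sub>R a) has_derivative (\<lambda>r. r *\<^sub>R a)) (at s within S)"
    by (auto intro!: derivative_eq_intros)
  have 2: "(f has_derivative (\<lambda>v. dird v f (x + s *\<^sub>R a))) (at (x + s *\<^sub>R a))"
    using dird_has_derivative[OF assms] .
  have "((\<lambda>s. f (x + s *\<^sub>R a)) has_derivative (\<lambda>r. dird (r *\<^sub>R a) f (x + s *\<^sub>R a))) (at s within S)"
    using has_derivative_compose[OF 1 2] .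
  moreover have "dird (r *\<^sub>R a) f (x + s *\<^sub>R a) = r *\<^sub>R dird a f (x + s *\<^sub>R a)" for r
    using linear_frechet_derivative[OF assms] by (simp add: dird_def linear_scale)
  ultimately show ?thesis unfolding has_vector_derivative_def by simp
qed

lemma dird_line0:
  assumes "f differentiable (at x)"
  shows "((\<lambda>s. f (x + s *\<^sub>R a)) has_vector_derivative dird a f x) (at 0 within S)"
  using dird_line[of f x 0 a] assms by simp

lemma dird_second_difference:
  fixes f :: "'e::euclidean_space \<Rightarrow> real"
  assumes h: "h > 0"
    and f: "\<And>s r. 0 \<le> s \<Longrightarrow> s \<le> h \<Longrightarrow> 0 \<le> r \<Longrightarrow> r \<le> h \<Longrightarrow> f differentiable (at (x + s *\<^sub>R a + r *\<^sub>R b))"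
    and fa: "\<And>s r. 0 \<le> s \<Longrightarrow> s \<le> h \<Longrightarrow> 0 \<le> r \<Longrightarrow> r \<le> h \<Longrightarrow> dird a f differentiable (at (x + s *\<^sub>R a + r *\<^sub>R b))"
  shows "\<exists>s r. 0 < s \<and> s < h \<and> 0 < r \<and> r < h \<and>
     f (x + h *\<^sub>R a + h *\<^sub>R b) - f (x + h *\<^sub>R a) - f (x + h *\<^sub>R b) + f x
       = h * (h * dird b (dird a f) (x + s *\<^sub>R a + r *\<^sub>R b))"
proof -
  define \<phi> where "\<phi> s = f (x + s *\<^sub>R a + h *\<^sub>R b) - f (x + s *\<^sub>R a)" for s
  have d\<phi>: "(\<phi> has_real_derivative dird a f (x + s *\<^sub>R a + h *\<^sub>R b) - dird a f (x + s *\<^sub>R a)) (at s)"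
    if "0 \<le> s" "s \<le> h" for s
  proof -
    have 1: "((\<lambda>s. f ((x + h *\<^sub>R b) + s *\<^sub>R a)) has_vector_derivative dird a f ((x + h *\<^sub>R b) + s *\<^sub>R a)) (at s)"
      using f[OF that, of h] h by (intro dird_line) (simp add: algebra_simps)
    have 2: "((\<lambda>s. f (x + s *\<^sub>R a)) has_vector_derivative dird a f (x + s *\<^sub>R a)) (at s)"
      using f[OF that, of 0] h by (intro dird_line) (simp add: algebra_simps)
    show ?thesis using has_vector_derivative_diff[OF 1 2]
      unfolding \<phi>_def has_real_derivative_iff_has_vector_derivative by (simp add: algebra_simps)
  qed
  obtain s where s: "0 < s" "s < h" "\<phi> h - \<phi> 0 = (h - 0) * (dird a f (x + s *\<^sub>R a + h *\<^sub>R b) - dird a f (x + s *\<^sub>R a))"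
    using MVT2[OF h d\<phi>] by auto
  have d: "((\<lambda>r. dird a f (x + s *\<^sub>R a + r *\<^sub>R b)) has_real_derivative dird b (dird a f) (x + s *\<^sub>R a + r *\<^sub>R b)) (at r)"
    if "0 \<le> r" "r \<le> h" for r
    unfolding has_real_derivative_iff_has_vector_derivative
    using s that by (intro dird_line fa) auto
  obtain r where r: "0 < r" "r < h" "dird a f (x + s *\<^sub>R a + h *\<^sub>R b) - dird a f (x + s *\<^sub>R a + 0 *\<^sub>R b)
       = (h - 0) * dird b (dird a f) (x + s *\<^sub>R a + r *\<^sub>R b)"
    using MVT2[OF h d] by auto
  show ?thesis using s r by (intro exI[of _ s] exI[of _ r]) (auto simp: \<phi>_def)
qed

text \<open>Schwarz's theorem: the second derivatives are differentiable, hence continuous, so if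
  the two mixed ones differed at \<open>x\<close> they could not agree at the two nearby
  intermediate points supplied by the second difference.\<close>

lemma dird_commute_real:
  fixes f :: "'e::euclidean_space \<Rightarrow> real"
  assumes N: "open N" "x \<in> N" and f: "Cinf f N" and ab: "a \<in> Basis" "b \<in> Basis"
  shows "dird a (dird b f) x = dird b (dird a f) x"
proof (rule ccontr)
  assume ne: "\<not> ?thesis"
  define e where "e = \<bar>dird a (dird b f) x - dird b (dird a f) x\<bar> / 2"
  have e: "e > 0" using ne by (simp add: e_def)
  have cont: "\<exists>d>0. \<forall>y. dist y x < d \<longrightarrow> dist (dird p (dird q f) y) (dird p (dird q f) x) < e"
    if "p \<in> Basis" "q \<in> Basis" for p q
  proof -
    have "dird p (dird q f) differentiable at x"
      using Cinf_dird[OF Cinf_dird[OF f]] that N Cinf_differentiable by blast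
    then have "continuous (at x) (dird p (dird q f))"
      by (rule differentiable_imp_continuous_within)
    then show ?thesis using e unfolding continuous_at_eps_delta by blast
  qed
  obtain d1 where d: "d1 > 0" "\<And>y. dist y x < d1 \<Longrightarrow> dist (dird a (dird b f) y) (dird a (dird b f) x) < e"
    using cont[OF ab] by blast
  obtain d2 where d': "d2 > 0" "\<And>y. dist y x < d2 \<Longrightarrow> dist (dird b (dird a f) y) (dird b (dird a f) x) < e"
    using cont[OF ab(2,1)] by blast
  obtain d3 where d3: "d3 > 0" "ball x d3 \<subseteq> N" using N openE by blast
  \<comment> \<open>Two displacements of length at most \<open>h\<close> add up to less than
    \<open>3 * h\<close>.\<close>
  define h where "h = min d1 (min d2 d3) / 3"
  have h: "h > 0" using d d' d3 by (simp add: h_def)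
  have near: "dist (x + s *\<^sub>R a + r *\<^sub>R b) x < min d1 (min d2 d3)" if "0 \<le> s" "s \<le> h" "0 \<le> r" "r \<le> h" for s r
  proof -
    have "norm (s *\<^sub>R a + r *\<^sub>R b) \<le> s + r"
      using norm_triangle_ineq[of "s *\<^sub>R a" "r *\<^sub>R b"] that ab by simp
    also have "\<dots> < 3 * h" using that h by linarith
    finally show ?thesis by (simp add: dist_norm h_def)
  qed
  have inN: "x + s *\<^sub>R a + r *\<^sub>R b \<in> N" if "0 \<le> s" "s \<le> h" "0 \<le> r" "r \<le> h" for s r
    using near[OF that] d3 by (auto simp: dist_commute)
  have inN': "x + r *\<^sub>R b + s *\<^sub>R a \<in> N" if "0 \<le> r" "r \<le> h" "0 \<le> s" "s \<le> h" for s r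
    using inN[OF that(3,4,1,2)] by (simp add: algebra_simps)
  obtain s r where sr: "0 < s" "s < h" "0 < r" "r < h"
    "f (x + h *\<^sub>R a + h *\<^sub>R b) - f (x + h *\<^sub>R a) - f (x + h *\<^sub>R b) + f x
       = h * (h * dird b (dird a f) (x + s *\<^sub>R a + r *\<^sub>R b))"
    using dird_second_difference[OF h, of f x a b] inN Cinf_differentiable[OF f]
      Cinf_differentiable[OF Cinf_dird[OF f ab(1)]] by blast
  obtain s' r' where sr': "0 < s'" "s' < h" "0 < r'" "r' < h"
    "f (x + h *\<^sub>R b + h *\<^sub>R a) - f (x + h *\<^sub>R b) - f (x + h *\<^sub>R a) + f x
       = h * (h * dird a (dird b f) (x + s' *\<^sub>R b + r' *\<^sub>R a))"
    using dird_second_difference[OF h, of f x b a] inN' Cinf_differentiable[OF f]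
      Cinf_differentiable[OF Cinf_dird[OF f ab(2)]] by blast
  have "h * (h * dird b (dird a f) (x + s *\<^sub>R a + r *\<^sub>R b)) = h * (h * dird a (dird b f) (x + s' *\<^sub>R b + r' *\<^sub>R a))"
    using sr(5) sr'(5) by (simp add: algebra_simps)
  then have eq: "dird b (dird a f) (x + s *\<^sub>R a + r *\<^sub>R b) = dird a (dird b f) (x + s' *\<^sub>R b + r' *\<^sub>R a)"
    using h by simp
  have "dist (dird b (dird a f) (x + s *\<^sub>R a + r *\<^sub>R b)) (dird b (dird a f) x) < e"
    using d'(2) near[of s r] sr by auto
  moreover have "dist (dird a (dird b f) (x + s' *\<^sub>R b + r' *\<^sub>R a)) (dird a (dird b f) x) < e"
    using d(2) near[of r' s'] sr' by (auto simp: algebra_simps)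
  ultimately show False using eq unfolding e_def dist_real_def by (auto simp: abs_if split: if_splits)
qed

lemma dird_inner:
  assumes "f differentiable (at x)"
  shows "dird a (\<lambda>y. f y \<bullet> c) x = dird a f x \<bullet> c"
  using has_derivative_inner_left[OF dird_has_derivative[OF assms]] by (rule dird_eqI)

lemma Cinf_inner:
  assumes "open N" "Cinf f N"
  shows "Cinf (\<lambda>y. f y \<bullet> c) N \<and> (set bs \<subseteq> Basis \<longrightarrow> (\<forall>x\<in>N. iter_pd bs (\<lambda>y. f y \<bullet> c) x = iter_pd bs f x \<bullet> c))"
proof -
  have eq: "set bs \<subseteq> Basis \<Longrightarrow> x \<in> N \<Longrightarrow> iter_pd bs (\<lambda>y. f y \<bullet> c) x = iter_pd bs f x \<bullet> c" for bs x
  proof (induction bs arbitrary: x)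
    case (Cons b bs)
    have "dird b (iter_pd bs (\<lambda>y. f y \<bullet> c)) x = dird b (\<lambda>x. iter_pd bs f x \<bullet> c) x"
      using Cons by (intro dird_cong_open[OF assms(1)]) auto
    also have "\<dots> = dird b (iter_pd bs f) x \<bullet> c"
      using Cons assms by (intro dird_inner) (auto simp: Cinf_def)
    finally show ?case unfolding iter_pd_Cons .
  qed auto
  have "iter_pd bs (\<lambda>y. f y \<bullet> c) differentiable (at x)" if "set bs \<subseteq> Basis" "x \<in> N" for bs x
  proof (rule differentiable_cong_open[OF assms(1) that(2)])
    show "(\<lambda>x. iter_pd bs f x \<bullet> c) differentiable at x"
      using assms that by (intro differentiable_inner) (auto simp: Cinf_def)
  qed (use eq that in auto)
  then show ?thesis using eq unfolding Cinf_def by auto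
qed

lemma dird_commute:
  fixes f :: "'e::euclidean_space \<Rightarrow> 'b::euclidean_space"
  assumes N: "open N" "x \<in> N" and f: "Cinf f N" and ab: "a \<in> Basis" "b \<in> Basis"
  shows "dird a (dird b f) x = dird b (dird a f) x"
proof (rule euclidean_eqI)
  fix c :: 'b assume "c \<in> Basis"
  have "dird p (dird q f) x \<bullet> c = dird p (dird q (\<lambda>y. f y \<bullet> c)) x" if "p \<in> Basis" "q \<in> Basis" for p q
    using Cinf_inner[OF N(1) f, of c "[p, q]"] that N by (simp add: dird_def)
  moreover have "dird a (dird b (\<lambda>y. f y \<bullet> c)) x = dird b (dird a (\<lambda>y. f y \<bullet> c)) x"
    using Cinf_inner[OF N(1) f] by (intro dird_commute_real[OF N _ ab]) blast
  ultimately show "dird a (dird b f) x \<bullet> c = dird b (dird a f) x \<bullet> c"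
    using ab by simp
qed

text \<open>Basis vectors must go to basis vectors because \<open>iter_pd\<close> differentiates
  along those only. The use is restriction of smooth functions of time and space to a slice.\<close>

lemma Cinf_affine:
  fixes L :: "'d::euclidean_space \<Rightarrow> 'e::euclidean_space" and f :: "'e \<Rightarrow> 'b::real_normed_vector"
  assumes N: "open N" and f: "Cinf f N" and L: "linear L" "\<And>b. b \<in> Basis \<Longrightarrow> L b \<in> Basis"
  shows "Cinf (\<lambda>q. f (c + L q)) {q. c + L q \<in> N}"
    and "set bs \<subseteq> Basis \<Longrightarrow> c + L q \<in> N \<Longrightarrow> iter_pd bs (\<lambda>q. f (c + L q)) q = iter_pd (map L bs) f (c + L q)"
    and "open {q. c + L q \<in> N}"
proof -
  show op: "open {q. c + L q \<in> N}"
  proof -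
    have "{q. c + L q \<in> N} = (\<lambda>q. c + L q) -` N" by auto
    moreover have "continuous_on UNIV (\<lambda>q. c + L q)"
      using L(1) by (intro continuous_intros linear_continuous_on) (auto simp: linear_conv_bounded_linear)
    ultimately show ?thesis using N open_vimage by metis
  qed
  have bl: "bounded_linear L" using L(1) using linear_conv_bounded_linear by blast
  have comp: "((\<lambda>q. g (c + L q)) has_derivative (\<lambda>v. dird (L v) g (c + L q))) (at q)"
    if "g differentiable (at (c + L q))" for g :: "'e \<Rightarrow> 'b" and q
  proof -
    have 1: "((\<lambda>q. c + L q) has_derivative L) (at q)"
      by (auto intro!: derivative_eq_intros bounded_linear_imp_has_derivative[OF bl])
    show ?thesis
      using has_derivative_compose[OF 1 dird_has_derivative[OF that]] .
  qed
  have mapB: "set (map L bs) \<subseteq> Basis" if "set bs \<subseteq> Basis" for bs using that L(2) by auto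
  have eq: "set bs \<subseteq> Basis \<Longrightarrow> c + L q \<in> N \<Longrightarrow> iter_pd bs (\<lambda>q. f (c + L q)) q = iter_pd (map L bs) f (c + L q)" for bs q
  proof (induction bs arbitrary: q)
    case (Cons b bs)
    have "dird b (iter_pd bs (\<lambda>q. f (c + L q))) q = dird b (\<lambda>q. iter_pd (map L bs) f (c + L q)) q"
      using Cons by (intro dird_cong_open[OF op]) auto
    also have "\<dots> = dird (L b) (iter_pd (map L bs) f) (c + L q)"
      using Cons mapB[of bs] f by (intro dird_eqI[OF comp]) (auto simp: Cinf_def)
    finally show ?case unfolding iter_pd_Cons list.map .
  qed auto
  then show "set bs \<subseteq> Basis \<Longrightarrow> c + L q \<in> N \<Longrightarrow> iter_pd bs (\<lambda>q. f (c + L q)) q = iter_pd (map L bs) f (c + L q)" .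
  have "iter_pd bs (\<lambda>q. f (c + L q)) differentiable (at q)" if "set bs \<subseteq> Basis" "c + L q \<in> N" for bs q
  proof (rule differentiable_cong_open[OF op, of q])
    show "(\<lambda>q. iter_pd (map L bs) f (c + L q)) differentiable at q"
      using comp[of "iter_pd (map L bs) f"] f mapB[OF that(1)] that(2)
      unfolding Cinf_def differentiable_def by blast
  qed (use eq that in auto)
  then show "Cinf (\<lambda>q. f (c + L q)) {q. c + L q \<in> N}" unfolding Cinf_def by auto
qed

section \<open>The Levi-Civita connection in coordinates\<close>

lemma has_vector_derivative_vec_iff:
  fixes f :: "real \<Rightarrow> real^'n::finite"
  shows "(f has_vector_derivative f') (at s within S) \<longleftrightarrow>
     (\<forall>i. ((\<lambda>s. f s $ i) has_real_derivative f' $ i) (at s within S))"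
  unfolding has_vector_derivative_def has_field_derivative_def
  by (subst has_derivative_componentwise_within)
     (auto simp: Basis_vec_def inner_axis cart_eq_inner_axis [symmetric] mult.commute[of _ "f' $ _"])

lemma differentiable_prod:
  fixes f :: "'i \<Rightarrow> 'a::real_normed_vector \<Rightarrow> real"
  assumes "\<And>i. i \<in> I \<Longrightarrow> f i differentiable (at x)"
  shows "(\<lambda>x. \<Prod>i\<in>I. f i x) differentiable (at x)"
  using assms
proof (induction I rule: infinite_finite_induct)
  case (insert x I)
  then show ?case by (auto intro!: differentiable_mult)
qed auto

lemma differentiable_det:
  fixes M :: "'a::real_normed_vector \<Rightarrow> real^'n::finite^'n"
  assumes "\<And>i j. (\<lambda>x. M x $ i $ j) differentiable (at x)"
  shows "(\<lambda>x. det (M x)) differentiable (at x)"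
  unfolding det_def using assms
  by (intro differentiable_sum finite_permutations finite ballI differentiable_mult
      differentiable_const differentiable_prod) auto

lemma matrix_inv_cramer:
  fixes A :: "real^'n::finite^'n"
  assumes "det A \<noteq> 0"
  shows "matrix_inv A $ m $ l = det (\<chi> i j. if j = m then axis l 1 $ i else A $ i $ j) / det A"
proof -
  have "invertible A" using assms invertible_det_nz by blast
  then have AI: "A ** matrix_inv A = mat 1"
    unfolding invertible_def matrix_inv_def by (rule someI2_ex) auto
  have "A *v (matrix_inv A *v axis l 1) = axis l 1"
    by (simp add: matrix_vector_mul_assoc AI)
  then have "matrix_inv A *v axis l 1 = (\<chi> k. det (\<chi> i j. if j = k then axis l 1 $ i else A $ i $ j) / det A)"
    by (rule iffD1[OF cramer[OF assms]])
  then have "(matrix_inv A *v axis l 1) $ m = det (\<chi> i j. if j = m then axis l 1 $ i else A $ i $ j) / det A"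
    by simp
  moreover have "(matrix_inv A *v axis l 1) $ m = matrix_inv A $ m $ l"
    by (simp add: matrix_vector_mul_component inner_axis)
  ultimately show ?thesis by simp
qed

lemma posdef_det:
  fixes A :: "real^'n::finite^'n"
  assumes "\<And>v. v \<noteq> 0 \<Longrightarrow> 0 < v \<bullet> (A *v v)"
  shows "det A \<noteq> 0"
proof
  assume "det A = 0"
  then have "\<not> (\<exists>B. B ** A = mat 1)"
    using invertible_det_nz invertible_left_inverse by metis
  then obtain v where "v \<noteq> 0" "A *v v = 0"
    unfolding matrix_left_invertible_ker by auto
  then show False using assms[of v] by simp
qed

lemma matrix_inv_right:
  fixes A :: "real^'n::finite^'n"
  assumes "det A \<noteq> 0"
  shows "A ** matrix_inv A = mat 1"
proof -
  have "invertible A" using assms invertible_det_nz by blast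
  then show ?thesis
    unfolding invertible_def matrix_inv_def by (rule someI2_ex) auto
qed

abbreviation sum_UNIV :: "('i::finite \<Rightarrow> real) \<Rightarrow> real"  (binder "\<Sum>\<^sub>U" 10) where
  "sum_UNIV f \<equiv> sum f UNIV"

text \<open>The Christoffel symbols as a bilinear map, their derivative in direction \<open>x\<close>, and \<open>R(x, v) w\<close>.\<close>
definition Gam :: "(real^'n::finite \<Rightarrow> real^'n^'n) \<Rightarrow> real^'n \<Rightarrow> real^'n \<Rightarrow> real^'n \<Rightarrow> real^'n" where
  "Gam h p v w = (\<chi> m. \<Sum>\<^sub>U i j. christoffel h i j m p * v $ i * w $ j)"

definition dGam :: "(real^'n::finite \<Rightarrow> real^'n^'n) \<Rightarrow> real^'n \<Rightarrow> real^'n \<Rightarrow> real^'n \<Rightarrow> real^'n \<Rightarrow> real^'n" where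
  "dGam h p x v w = (\<chi> m. \<Sum>\<^sub>U i j. dird x (christoffel h i j m) p * v $ i * w $ j)"

definition Rv :: "(real^'n::finite \<Rightarrow> real^'n^'n) \<Rightarrow> real^'n \<Rightarrow> real^'n \<Rightarrow> real^'n \<Rightarrow> real^'n \<Rightarrow> real^'n" where
  "Rv h p x v w = dGam h p x v w - dGam h p v x w + Gam h p x (Gam h p v w) - Gam h p v (Gam h p x w)"

lemma Gam_add: "Gam h p (v + v') w = Gam h p v w + Gam h p v' w" "Gam h p v (w + w') = Gam h p v w + Gam h p v w'"
  by (auto simp: Gam_def vec_eq_iff sum.distrib algebra_simps)

lemma dird_expand:
  fixes f :: "real^'n::finite \<Rightarrow> 'b::real_normed_vector"
  assumes "f differentiable (at p)"
  shows "dird v f p = (\<Sum>i\<in>UNIV. v $ i *\<^sub>R dird (axis i 1) f p)"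
proof -
  have lin: "linear (\<lambda>v. dird v f p)"
    unfolding dird_def using linear_frechet_derivative[OF assms] by simp
  have "v = (\<Sum>i\<in>UNIV. v $ i *\<^sub>R axis i 1)"
    using basis_expansion[of v] by (simp add: scalar_mult_eq_scaleR)
  then have "dird v f p = dird (\<Sum>i\<in>UNIV. v $ i *\<^sub>R axis i 1) f p" by simp
  also have "\<dots> = (\<Sum>i\<in>UNIV. v $ i *\<^sub>R dird (axis i 1) f p)"
    using linear_sum[OF lin, of "\<lambda>i. v $ i *\<^sub>R axis i 1" UNIV] by (simp add: linear_scale[OF lin])
  finally show ?thesis .
qed

lemma pd_eq_dird: "pd i f p = dird (axis i 1) f p"
  by (simp add: pd_def dird_def)

lemma differentiable_vec_nth:
  assumes "f differentiable F" shows "(\<lambda>x. f x $ i) differentiable F"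
  using assms bounded_linear.has_derivative[OF bounded_linear_vec_nth] unfolding differentiable_def by blast

lemma dird_vec_nth:
  fixes f :: "'e::euclidean_space \<Rightarrow> 'b::real_normed_vector^'n::finite"
  assumes "f differentiable (at p)"
  shows "dird v (\<lambda>y. f y $ i) p = dird v f p $ i"
  by (rule dird_eqI[OF bounded_linear.has_derivative[OF bounded_linear_vec_nth dird_has_derivative[OF assms]]])

locale coord_metric =
  fixes h :: "real^'n::finite \<Rightarrow> real^'n^'n" and \<Omega> :: "(real^'n) set"
  assumes open_\<Omega>: "open \<Omega>" and Cinf_h: "Cinf h \<Omega>"
    and sym_h: "p \<in> \<Omega> \<Longrightarrow> transpose (h p) = h p"
    and pos_h: "p \<in> \<Omega> \<Longrightarrow> v \<noteq> 0 \<Longrightarrow> 0 < v \<bullet> (h p *v v)"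
begin

abbreviation ip :: "real^'n \<Rightarrow> real^'n \<Rightarrow> real^'n \<Rightarrow> real" where
  "ip p v w \<equiv> v \<bullet> (h p *v w)"

lemma ip_commute: "p \<in> \<Omega> \<Longrightarrow> ip p v w = ip p w v"
  using dot_lmul_matrix[of v "h p" w] transpose_matrix_vector[of "h p" v] sym_h[of p]
  by (simp add: inner_commute)

lemma h_nth_commute: "p \<in> \<Omega> \<Longrightarrow> h p $ i $ j = h p $ j $ i"
  using arg_cong[OF sym_h[of p], of "\<lambda>M. M $ j $ i"] by (simp add: transpose_def)

lemma h_differentiable: "p \<in> \<Omega> \<Longrightarrow> h differentiable (at p)"
  using Cinf_differentiable Cinf_h by blast

lemma dird_h_commute: "p \<in> \<Omega> \<Longrightarrow> dird v h p $ i $ j = dird v h p $ j $ i"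
proof -
  assume p: "p \<in> \<Omega>"
  have "dird v h p $ i $ j = dird v (\<lambda>y. h y $ i $ j) p" for i j
    by (simp add: dird_vec_nth differentiable_vec_nth h_differentiable p)
  moreover have "dird v (\<lambda>y. h y $ i $ j) p = dird v (\<lambda>y. h y $ j $ i) p"
    by (rule dird_cong_open[OF open_\<Omega> p]) (rule h_nth_commute)
  ultimately show ?thesis by simp
qed

lemma pd_h: "p \<in> \<Omega> \<Longrightarrow> pd i (\<lambda>y. h y $ j $ l) p = dird (axis i 1) h p $ j $ l"
  by (simp add: pd_eq_dird dird_vec_nth differentiable_vec_nth h_differentiable)

lemma christoffel_commute: "p \<in> \<Omega> \<Longrightarrow> christoffel h i j m p = christoffel h j i m p"
  unfolding christoffel_def by (simp add: pd_h dird_h_commute[of p _ i j] add.commute)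

lemma Gam_commute: "p \<in> \<Omega> \<Longrightarrow> Gam h p v w = Gam h p w v"
proof -
  assume p: "p \<in> \<Omega>"
  have "(\<Sum>\<^sub>U i j. christoffel h i j m p * v $ i * w $ j) = (\<Sum>\<^sub>U i j. christoffel h i j m p * w $ i * v $ j)" for m
  proof (subst sum.swap, intro sum.cong refl)
    fix i j show "christoffel h j i m p * v $ j * w $ i = christoffel h i j m p * w $ i * v $ j"
      using christoffel_commute[OF p, of i j m] by simp
  qed
  then show ?thesis by (simp add: Gam_def vec_eq_iff)
qed

lemma quad_sum: "w \<bullet> (M *v z) = (\<Sum>\<^sub>U j l. M $ j $ l * w $ j * z $ l)" for M :: "real^'n^'n"
  by (simp add: inner_vec_def matrix_vector_mult_def sum_distrib_left sum_distrib_right algebra_simps)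

lemma quad_dird:
  assumes "p \<in> \<Omega>"
  shows "w \<bullet> (dird v h p *v z) = (\<Sum>\<^sub>U i j l. dird (axis i 1) h p $ j $ l * v $ i * w $ j * z $ l)"
proof -
  have *: "dird v h p $ j $ l = (\<Sum>\<^sub>U i. dird (axis i 1) h p $ j $ l * v $ i)" for j l
    by (subst dird_expand[OF h_differentiable[OF assms]]) (simp add: sum_component mult.commute)
  have "w \<bullet> (dird v h p *v z) = (\<Sum>\<^sub>U j l i. dird (axis i 1) h p $ j $ l * v $ i * w $ j * z $ l)"
    by (simp add: quad_sum * sum_distrib_right)
  also have "\<dots> = (\<Sum>\<^sub>U j i l. dird (axis i 1) h p $ j $ l * v $ i * w $ j * z $ l)"
    by (rule sum.cong[OF refl], rule sum.swap)
  also have "\<dots> = (\<Sum>\<^sub>U i j l. dird (axis i 1) h p $ j $ l * v $ i * w $ j * z $ l)"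
    by (rule sum.swap)
  finally show ?thesis .
qed

text \<open>Christoffel symbols of the first kind: taking the inner product multiplies by
  \<open>h\<close>, which cancels the \<open>matrix_inv\<close> in
  \<open>christoffel\<close>.\<close>

lemma ip_Gam:
  assumes p: "p \<in> \<Omega>"
  shows "ip p (Gam h p v w) z = (1/2) * (w \<bullet> (dird v h p *v z) + v \<bullet> (dird w h p *v z) - v \<bullet> (dird z h p *v w))"
proof -
  define H where "H = matrix_inv (h p)"
  have det: "det (h p) \<noteq> 0" using posdef_det pos_h[OF p] by blast
  have hH: "h p *v (H *v x) = x" for x
    by (simp add: H_def matrix_vector_mul_assoc matrix_inv_right[OF det])
  \<comment> \<open>Twice the Christoffel symbol of the first kind with lower index
    \<open>l\<close>.\<close>
  define c where "c l i j = dird (axis i 1) h p $ j $ l + dird (axis j 1) h p $ i $ l - dird (axis l 1) h p $ i $ j" for l i j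
  define C :: "real^'n" where "C = (\<chi> l. \<Sum>\<^sub>U i j. c l i j * v $ i * w $ j)"
  have "Gam h p v w = (1/2) *\<^sub>R (H *v C)"
  proof -
   have "Gam h p v w $ m = (H *v C) $ m / 2" for m
   proof -
    have "Gam h p v w $ m = (\<Sum>\<^sub>U i j l. (1/2) * H $ m $ l * c l i j * v $ i * w $ j)"
      by (simp add: Gam_def christoffel_def pd_h[OF p] c_def H_def sum_distrib_left sum_distrib_right sum_divide_distrib mult.assoc)
    also have "\<dots> = (\<Sum>\<^sub>U i l j. (1/2) * H $ m $ l * c l i j * v $ i * w $ j)"
      by (rule sum.cong[OF refl], rule sum.swap)
    also have "\<dots> = (\<Sum>\<^sub>U l i j. (1/2) * H $ m $ l * c l i j * v $ i * w $ j)"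
      by (rule sum.swap)
    also have "\<dots> = (1/2) * (H *v C) $ m"
      by (simp add: matrix_vector_mult_def C_def sum_distrib_left mult.assoc sum_divide_distrib)
    finally show ?thesis by simp
   qed
   then show ?thesis by (simp add: vec_eq_iff)
  qed
  then have "ip p (Gam h p v w) z = (1/2) * (z \<bullet> C)"
    using ip_commute[OF p] by (simp add: matrix_vector_mult_scaleR hH)
  also have "z \<bullet> C = (\<Sum>\<^sub>U l i j. c l i j * v $ i * w $ j * z $ l)"
    by (simp add: inner_vec_def C_def sum_distrib_left mult_ac)
  also have "\<dots> = (\<Sum>\<^sub>U l i j. dird (axis i 1) h p $ j $ l * v $ i * w $ j * z $ l)
      + (\<Sum>\<^sub>U l i j. dird (axis j 1) h p $ i $ l * v $ i * w $ j * z $ l)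
      - (\<Sum>\<^sub>U l i j. dird (axis l 1) h p $ i $ j * v $ i * w $ j * z $ l)"
    by (simp add: c_def algebra_simps sum.distrib sum_subtractf)
  also have "(\<Sum>\<^sub>U l i j. dird (axis i 1) h p $ j $ l * v $ i * w $ j * z $ l) = w \<bullet> (dird v h p *v z)"
  proof -
    have "(\<Sum>\<^sub>U l i j. dird (axis i 1) h p $ j $ l * v $ i * w $ j * z $ l)
       = (\<Sum>\<^sub>U i l j. dird (axis i 1) h p $ j $ l * v $ i * w $ j * z $ l)"
      by (rule sum.swap)
    also have "\<dots> = (\<Sum>\<^sub>U i j l. dird (axis i 1) h p $ j $ l * v $ i * w $ j * z $ l)"
      by (rule sum.cong[OF refl], rule sum.swap)
    finally show ?thesis by (simp add: quad_dird[OF p])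
  qed
  also have "(\<Sum>\<^sub>U l i j. dird (axis j 1) h p $ i $ l * v $ i * w $ j * z $ l) = v \<bullet> (dird w h p *v z)"
  proof -
    have "(\<Sum>\<^sub>U l i j. dird (axis j 1) h p $ i $ l * v $ i * w $ j * z $ l)
       = (\<Sum>\<^sub>U l j i. dird (axis j 1) h p $ i $ l * v $ i * w $ j * z $ l)"
      by (rule sum.cong[OF refl], rule sum.swap)
    also have "\<dots> = (\<Sum>\<^sub>U j l i. dird (axis j 1) h p $ i $ l * v $ i * w $ j * z $ l)"
      by (rule sum.swap)
    also have "\<dots> = (\<Sum>\<^sub>U j i l. dird (axis j 1) h p $ i $ l * v $ i * w $ j * z $ l)"
      by (rule sum.cong[OF refl], rule sum.swap)
    finally show ?thesis by (simp add: quad_dird[OF p] mult_ac)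
  qed
  also have "(\<Sum>\<^sub>U l i j. dird (axis l 1) h p $ i $ j * v $ i * w $ j * z $ l) = v \<bullet> (dird z h p *v w)"
    by (simp add: quad_dird[OF p] mult_ac)
  finally show ?thesis .
qed

text \<open>Metric compatibility. In the sum of the two instances of \<open>ip_Gam\<close> the
  derivatives of \<open>h\<close> along \<open>w\<close> and \<open>z\<close> cancel, and the two
  derivatives along \<open>v\<close> agree by symmetry of \<open>h\<close>.\<close>

lemma ip_Gam_compat:
  assumes p: "p \<in> \<Omega>"
  shows "ip p (Gam h p v w) z + ip p w (Gam h p v z) = w \<bullet> (dird v h p *v z)"
proof -
  have sw: "x \<bullet> (dird v h p *v y) = y \<bullet> (dird v h p *v x)" for x y v
    unfolding quad_sum by (subst sum.swap) (simp add: dird_h_commute[OF p] mult_ac)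
  show ?thesis
    unfolding ip_commute[OF p, of w "Gam h p v z"] ip_Gam[OF p, of v w z] ip_Gam[OF p, of v z w]
    using sw[of z v w] by argo
qed

lemma christoffel_differentiable:
  assumes p: "p \<in> \<Omega>"
  shows "christoffel h i j m differentiable (at p)"
proof -
  have hd: "(\<lambda>p. h p $ i $ j) differentiable (at p)" for i j
    by (intro differentiable_vec_nth h_differentiable p)
  have det: "det (h p) \<noteq> 0" if "p \<in> \<Omega>" for p using posdef_det pos_h[OF that] by blast
  have inv: "(\<lambda>p. matrix_inv (h p) $ m $ l) differentiable (at p)" for m l
  proof (rule differentiable_cong_open[OF open_\<Omega> p])
    show "det (\<chi> i j. if j = m then axis l 1 $ i else h y $ i $ j) / det (h y) = matrix_inv (h y) $ m $ l" if "y \<in> \<Omega>" for y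
      using matrix_inv_cramer[OF det[OF that]] by simp
    show "(\<lambda>y. det (\<chi> i j. if j = m then axis l 1 $ i else h y $ i $ j) / det (h y)) differentiable at p"
    proof (intro differentiable_divide differentiable_det det p hd)
      fix i j show "(\<lambda>x. (\<chi> i j. if j = m then axis l 1 $ i else h x $ i $ j) $ i $ j) differentiable at p"
        using hd by (cases "j = m") auto
    qed
  qed
  have pdd: "pd i (\<lambda>y. h y $ j $ l) differentiable (at p)" for i j l
  proof (rule differentiable_cong_open[OF open_\<Omega> p])
    show "dird (axis i 1) h y $ j $ l = pd i (\<lambda>y. h y $ j $ l) y" if "y \<in> \<Omega>" for y
      using pd_h[OF that] by simp
    have "dird (axis i 1) h differentiable (at p)"
      using Cinf_differentiable[OF Cinf_dird[OF Cinf_h] p] by (simp add: axis_in_Basis_iff)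
    then show "(\<lambda>y. dird (axis i 1) h y $ j $ l) differentiable at p"
      by (intro differentiable_vec_nth)
  qed
  show ?thesis unfolding christoffel_def
    by (intro differentiable_mult differentiable_const differentiable_sum
        inv differentiable_add differentiable_diff pdd ballI finite)
qed

text \<open>Ties the curvature that arises from commuting covariant derivatives to the index
  expression \<open>riem13\<close>, in which Ricci and the curvature operator are defined.\<close>

lemma Rv_nth:
  assumes p: "p \<in> \<Omega>"
  shows "Rv h p x v w $ l = (\<Sum>\<^sub>U i j k. riem13 h i j k l p * x $ i * v $ j * w $ k)"
proof -
  have e: "dird x (christoffel h i j m) p = (\<Sum>\<^sub>U r. x $ r * pd r (christoffel h i j m) p)" for i j m x
    using dird_expand[OF christoffel_differentiable[OF p], of x i j m] by (simp add: pd_eq_dird)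
  have 1: "dGam h p x v w $ l = (\<Sum>\<^sub>U i j k. pd i (christoffel h j k l) p * x $ i * v $ j * w $ k)" for x v
  proof -
    have "dGam h p x v w $ l = (\<Sum>\<^sub>U j k i. pd i (christoffel h j k l) p * x $ i * v $ j * w $ k)"
      by (simp add: dGam_def e sum_distrib_left sum_distrib_right mult_ac)
    also have "\<dots> = (\<Sum>\<^sub>U j i k. pd i (christoffel h j k l) p * x $ i * v $ j * w $ k)"
      by (rule sum.cong[OF refl], rule sum.swap)
    also have "\<dots> = (\<Sum>\<^sub>U i j k. pd i (christoffel h j k l) p * x $ i * v $ j * w $ k)"
      by (rule sum.swap)
    finally show ?thesis .
  qed
  have 2: "Gam h p x (Gam h p v w) $ l = (\<Sum>\<^sub>U i j k. (\<Sum>\<^sub>U m. christoffel h j k m p * christoffel h i m l p) * x $ i * v $ j * w $ k)" for x v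
  proof -
    have "Gam h p x (Gam h p v w) $ l = (\<Sum>\<^sub>U i m j k. christoffel h j k m p * christoffel h i m l p * x $ i * v $ j * w $ k)"
      by (simp add: Gam_def sum_distrib_left mult_ac)
    also have "\<dots> = (\<Sum>\<^sub>U i j m k. christoffel h j k m p * christoffel h i m l p * x $ i * v $ j * w $ k)"
      by (rule sum.cong[OF refl], rule sum.swap)
    also have "\<dots> = (\<Sum>\<^sub>U i j k m. christoffel h j k m p * christoffel h i m l p * x $ i * v $ j * w $ k)"
      by (rule sum.cong[OF refl], rule sum.cong[OF refl], rule sum.swap)
    finally show ?thesis by (simp add: sum_distrib_right)
  qed
  have sw: "(\<Sum>\<^sub>U i j k. f i j k * v $ i * x $ j * w $ k) =
       (\<Sum>\<^sub>U i j k. f j i k * x $ i * v $ j * w $ k)" for f :: "'n \<Rightarrow> 'n \<Rightarrow> 'n \<Rightarrow> real"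
    by (subst sum.swap) (simp add: mult_ac)
  show ?thesis
    unfolding Rv_def vector_minus_component vector_add_component 1 2
      sw[of "\<lambda>i j k. pd i (christoffel h j k l) p"]
      sw[of "\<lambda>i j k. \<Sum>\<^sub>U m. christoffel h j k m p * christoffel h i m l p"] riem13_def
    by (simp add: sum_subtractf sum.distrib algebra_simps)
qed

lemma has_vector_derivative_h:
  assumes u: "(u has_vector_derivative u') (at s within T)" and p: "u s \<in> \<Omega>"
  shows "((\<lambda>s. h (u s)) has_vector_derivative dird u' h (u s)) (at s within T)"
proof -
  have lin: "linear (\<lambda>v. dird v h (u s))"
    unfolding dird_def using linear_frechet_derivative[OF h_differentiable[OF p]] by simp
  have "((\<lambda>s. h (u s)) has_derivative (\<lambda>r. dird (r *\<^sub>R u') h (u s))) (at s within T)"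
    using has_derivative_compose[OF u[unfolded has_vector_derivative_def] dird_has_derivative[OF h_differentiable[OF p]]] .
  then show ?thesis unfolding has_vector_derivative_def by (simp add: linear_scale[OF lin])
qed

end

section \<open>Covariant product rules along a curve\<close>

lemma bounded_bilinear_matrix_vector_mult:
  "bounded_bilinear ((*v) :: real^'n::finite^'m::finite \<Rightarrow> real^'n \<Rightarrow> real^'m)"
  unfolding bilinear_conv_bounded_bilinear[symmetric] bilinear_def
  by (auto intro!: linearI simp: matrix_vector_mult_add_rdistrib matrix_vector_right_distrib
      matrix_vector_mult_scaleR scaleR_matrix_vector_assoc)

lemma has_vector_derivative_quad:
  fixes M :: "real \<Rightarrow> real^'n::finite^'n"
  assumes "(X has_vector_derivative X') (at s within T)" "(Y has_vector_derivative Y') (at s within T)"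
    "(M has_vector_derivative M') (at s within T)"
  shows "((\<lambda>s. X s \<bullet> (M s *v Y s)) has_real_derivative X' \<bullet> (M s *v Y s) + X s \<bullet> (M' *v Y s) + X s \<bullet> (M s *v Y')) (at s within T)"
  using bounded_bilinear.has_vector_derivative[OF bounded_bilinear_inner assms(1)
      bounded_bilinear.has_vector_derivative[OF bounded_bilinear_matrix_vector_mult assms(3,2)]]
  by (simp add: has_real_derivative_iff_has_vector_derivative inner_add_right algebra_simps)

context coord_metric
begin

text \<open>The derivative of \<open>h\<close> along the curve is absorbed by
  \<open>ip_Gam_compat\<close>. \<open>X\<close> and \<open>Y\<close> are arbitrary fields along the
  curve and need not extend to the chart.\<close>

lemma ip_derivative:
  assumes u: "(u has_vector_derivative u') (at s within T)" and p: "u s \<in> \<Omega>"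
    and X: "(X has_vector_derivative X') (at s within T)" and Y: "(Y has_vector_derivative Y') (at s within T)"
  shows "((\<lambda>s. ip (u s) (X s) (Y s)) has_real_derivative
     ip (u s) (X' + Gam h (u s) u' (X s)) (Y s) + ip (u s) (X s) (Y' + Gam h (u s) u' (Y s))) (at s within T)"
  using has_vector_derivative_quad[OF X Y has_vector_derivative_h[OF u p]] ip_Gam_compat[OF p, of u' "X s" "Y s"]
  by (simp add: inner_add_left matrix_vector_right_distrib inner_add_right algebra_simps)

lemma Gam_derivative:
  assumes u: "(u has_vector_derivative u') (at s within T)" and p: "u s \<in> \<Omega>"
    and X: "(X has_vector_derivative X') (at s within T)" and Y: "(Y has_vector_derivative Y') (at s within T)"
  shows "((\<lambda>s. Gam h (u s) (X s) (Y s)) has_vector_derivative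
     dGam h (u s) u' (X s) (Y s) + Gam h (u s) X' (Y s) + Gam h (u s) (X s) Y') (at s within T)"
  unfolding has_vector_derivative_vec_iff
proof
  fix m
  have c: "((\<lambda>s. christoffel h i j m (u s)) has_real_derivative dird u' (christoffel h i j m) (u s)) (at s within T)" for i j
  proof -
    have lin: "linear (\<lambda>v. dird v (christoffel h i j m) (u s))"
      unfolding dird_def using linear_frechet_derivative[OF christoffel_differentiable[OF p]] by simp
    have "((\<lambda>s. christoffel h i j m (u s)) has_derivative (\<lambda>r. dird (r *\<^sub>R u') (christoffel h i j m) (u s))) (at s within T)"
      using has_derivative_compose[OF u[unfolded has_vector_derivative_def] dird_has_derivative[OF christoffel_differentiable[OF p]]] .
    then show ?thesis unfolding has_field_derivative_def
      by (simp add: linear_scale[OF lin] mult_commute_abs)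
  qed
  have Xi: "((\<lambda>s. X s $ i) has_real_derivative X' $ i) (at s within T)" and Yi: "((\<lambda>s. Y s $ i) has_real_derivative Y' $ i) (at s within T)" for i
    using X Y unfolding has_vector_derivative_vec_iff by auto
  have "((\<lambda>s. \<Sum>\<^sub>U i j. christoffel h i j m (u s) * X s $ i * Y s $ j) has_real_derivative
     (\<Sum>\<^sub>U i j. dird u' (christoffel h i j m) (u s) * X s $ i * Y s $ j + christoffel h i j m (u s) * X' $ i * Y s $ j
       + christoffel h i j m (u s) * X s $ i * Y' $ j)) (at s within T)"
    by (intro DERIV_sum) (rule derivative_eq_intros c Xi Yi refl | simp add: algebra_simps)+
  then show "((\<lambda>s. Gam h (u s) (X s) (Y s) $ m) has_real_derivative
     (dGam h (u s) u' (X s) (Y s) + Gam h (u s) X' (Y s) + Gam h (u s) (X s) Y') $ m) (at s within T)"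
    by (simp add: Gam_def dGam_def sum.distrib)
qed

end

section \<open>Curvature along maps\<close>

context coord_metric
begin

lemma Rv_antisym: "Rv h p v x w = - Rv h p x v w"
  by (simp add: Rv_def)

lemma Rv_add: "Rv h p (x + x') v w = Rv h p x v w + Rv h p x' v w" if "p \<in> \<Omega>"
  by (simp add: vec_eq_iff Rv_nth[OF that] sum.distrib algebra_simps)

lemma Rv_scale: "Rv h p (r *\<^sub>R x) v w = r *\<^sub>R Rv h p x v w" if "p \<in> \<Omega>"
  by (simp add: vec_eq_iff Rv_nth[OF that] sum_distrib_left algebra_simps)

lemma ricci_quad:
  assumes "p \<in> \<Omega>"
  shows "w \<bullet> (ricci h p *v w) = (\<Sum>\<^sub>U i. Rv h p (axis i 1) w w $ i)"
proof -
  have "Rv h p (axis i 1) w w $ i = (\<Sum>\<^sub>U j k. riem13 h i j k i p * w $ j * w $ k)" for i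
  proof -
    have "Rv h p (axis i 1) w w $ i =
      (\<Sum>\<^sub>U i'. if i' = i then \<Sum>\<^sub>U j k. riem13 h i j k i p * w $ j * w $ k else 0)"
      unfolding Rv_nth[OF assms] by (intro sum.cong) (auto simp: axis_def)
    then show ?thesis by simp
  qed
  then have "(\<Sum>\<^sub>U i. Rv h p (axis i 1) w w $ i) = (\<Sum>\<^sub>U i j k. riem13 h i j k i p * w $ j * w $ k)"
    by simp
  also have "\<dots> = (\<Sum>\<^sub>U j i k. riem13 h i j k i p * w $ j * w $ k)"
    by (rule sum.swap)
  also have "\<dots> = (\<Sum>\<^sub>U j k i. riem13 h i j k i p * w $ j * w $ k)"
    by (rule sum.cong[OF refl], rule sum.swap)
  also have "\<dots> = w \<bullet> (ricci h p *v w)"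
    by (simp add: quad_sum ricci_def sum_distrib_right)
  finally show ?thesis by simp
qed

text \<open>The order \<open>z $ l * w $ k\<close> is the one in which \<open>curv_op_nonneg\<close>
  pairs the last two indices, so that products of vectors can be inserted there term by
  term.\<close>

lemma riem04_quad:
  assumes "p \<in> \<Omega>"
  shows "(\<Sum>\<^sub>U i j k l. riem04 h i j k l p * (x $ i * v $ j * (z $ l * w $ k))) = ip p (Rv h p x v w) z"
proof -
  have "ip p (Rv h p x v w) z = (\<Sum>\<^sub>U l m. h p $ l $ m * z $ l * Rv h p x v w $ m)"
    unfolding ip_commute[OF assms, of "Rv h p x v w" z] unfolding quad_sum by (rule refl)
  also have "\<dots> = (\<Sum>\<^sub>U l m i j k. h p $ l $ m * riem13 h i j k m p * (x $ i * v $ j * (z $ l * w $ k)))"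
    by (simp add: Rv_nth[OF assms] sum_distrib_left mult_ac)
  also have "\<dots> = (\<Sum>\<^sub>U l i m j k. h p $ l $ m * riem13 h i j k m p * (x $ i * v $ j * (z $ l * w $ k)))"
    by (rule sum.cong[OF refl], rule sum.swap)
  also have "\<dots> = (\<Sum>\<^sub>U i l m j k. h p $ l $ m * riem13 h i j k m p * (x $ i * v $ j * (z $ l * w $ k)))"
    by (rule sum.swap)
  also have "\<dots> = (\<Sum>\<^sub>U i l j m k. h p $ l $ m * riem13 h i j k m p * (x $ i * v $ j * (z $ l * w $ k)))"
    by (rule sum.cong[OF refl], rule sum.cong[OF refl], rule sum.swap)
  also have "\<dots> = (\<Sum>\<^sub>U i j l m k. h p $ l $ m * riem13 h i j k m p * (x $ i * v $ j * (z $ l * w $ k)))"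
    by (rule sum.cong[OF refl], rule sum.swap)
  also have "\<dots> = (\<Sum>\<^sub>U i j l k m. h p $ l $ m * riem13 h i j k m p * (x $ i * v $ j * (z $ l * w $ k)))"
    by (rule sum.cong[OF refl], rule sum.cong[OF refl], rule sum.cong[OF refl], rule sum.swap)
  also have "\<dots> = (\<Sum>\<^sub>U i j k l m. h p $ l $ m * riem13 h i j k m p * (x $ i * v $ j * (z $ l * w $ k)))"
    by (rule sum.cong[OF refl], rule sum.cong[OF refl], rule sum.swap)
  finally show ?thesis by (simp add: riem04_def sum_distrib_right)
qed

text \<open>The curvature operator evaluated on the simple 2-vector v \<and> w. The two summands
  coincide by pair symmetry of the curvature tensor, but the sum is enough for a sign and spares
  that symmetry.\<close>

lemma curv_op_nonneg_sectional:
  assumes p: "p \<in> \<Omega>" and c: "curv_op_nonneg h p"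
  shows "0 \<le> ip p (Rv h p v w w) v + ip p (Rv h p w v v) w"
proof -
  define \<omega> :: "real^'n^'n" where "\<omega> = (\<chi> i j. v $ i * w $ j - w $ i * v $ j)"
  have "transpose \<omega> = - \<omega>" by (simp add: vec_eq_iff transpose_def \<omega>_def)
  then have "0 \<le> (\<Sum>\<^sub>U i j k l. riem04 h i j k l p * \<omega> $ i $ j * \<omega> $ l $ k)"
    using c unfolding curv_op_nonneg_def by blast
  also have "\<dots> = (\<Sum>\<^sub>U i j k l. riem04 h i j k l p * (v $ i * w $ j * (v $ l * w $ k)) - riem04 h i j k l p * (v $ i * w $ j * (w $ l * v $ k))
      - riem04 h i j k l p * (w $ i * v $ j * (v $ l * w $ k)) + riem04 h i j k l p * (w $ i * v $ j * (w $ l * v $ k)))"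
    by (intro sum.cong refl) (simp add: \<omega>_def algebra_simps)
  also have "\<dots> = ip p (Rv h p v w w) v - ip p (Rv h p v w v) w - ip p (Rv h p w v w) v + ip p (Rv h p w v v) w"
    by (simp only: sum.distrib sum_subtractf riem04_quad[OF p])
  also have "\<dots> = 2 * (ip p (Rv h p v w w) v + ip p (Rv h p w v v) w)"
    using Rv_antisym[of p v w v] Rv_antisym[of p w v w] by (simp add: inner_diff_left)
  finally show ?thesis by simp
qed

text \<open>Orthogonal vectors of positive length are independent, and as many as the dimension they
  span. The remainder after subtracting all projections is orthogonal to the span, hence to itself,
  hence 0.\<close>

lemma frame_expand:
  assumes p: "p \<in> \<Omega>" and B: "finite B" "card B = CARD('n)"
    and orth: "\<And>a b. a \<in> B \<Longrightarrow> b \<in> B \<Longrightarrow> ip p (e a) (e b) = (if a = b then f a else 0)"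
    and f: "\<And>a. a \<in> B \<Longrightarrow> f a > 0"
  shows "v = (\<Sum>b\<in>B. (ip p v (e b) / f b) *\<^sub>R e b)"
proof -
  have inj: "inj_on e B"
    using orth f by (metis inj_onI less_irrefl)
  have ind: "independent (e ` B)"
  proof (rule ccontr)
    assume "\<not> ?thesis"
    then obtain U c where U: "finite U" "U \<subseteq> e ` B" "\<exists>v\<in>U. c v \<noteq> 0" "(\<Sum>v\<in>U. c v *\<^sub>R v) = 0"
      unfolding independent_explicit_finite_subsets by blast
    then obtain b where b: "b \<in> B" "e b \<in> U" "c (e b) \<noteq> 0" by auto
    have "0 = ip p (\<Sum>v\<in>U. c v *\<^sub>R v) (e b)" using U by simp
    also have "\<dots> = (\<Sum>v\<in>U. c v * ip p v (e b))" by (simp add: inner_sum_left)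
    also have "\<dots> = (\<Sum>v\<in>U. if v = e b then c v * f b else 0)"
    proof (rule sum.cong[OF refl])
      fix v assume "v \<in> U"
      then obtain a where "a \<in> B" "v = e a" using U by auto
      then show "c v * ip p v (e b) = (if v = e b then c v * f b else 0)"
        using orth b(1) inj by (auto simp: inj_on_def)
    qed
    also have "\<dots> = c (e b) * f b" using b U by simp
    finally show False using b f[of b] by simp
  qed
  have "span (e ` B) = UNIV"
  proof -
    have "card (e ` B) = DIM(real^'n)" using card_image[OF inj] B by simp
    then show ?thesis using card_eq_dim[OF subset_UNIV, of "e ` B"] ind B by auto
  qed
  define w where "w = v - (\<Sum>b\<in>B. (ip p v (e b) / f b) *\<^sub>R e b)"
  have 0: "ip p x w = 0" if "x \<in> e ` B" for x
  proof -
    obtain a where a: "a \<in> B" "x = e a" using \<open>x \<in> e ` B\<close> by blast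
    have "ip p w x = ip p v (e a) - (\<Sum>b\<in>B. ip p v (e b) / f b * ip p (e b) (e a))"
      by (simp add: w_def a inner_diff_left inner_sum_left)
    also have "(\<Sum>b\<in>B. ip p v (e b) / f b * ip p (e b) (e a)) = (\<Sum>b\<in>B. if b = a then ip p v (e a) else 0)"
    proof (intro sum.cong refl)
      fix b assume "b \<in> B"
      then show "ip p v (e b) / f b * ip p (e b) (e a) = (if b = a then ip p v (e a) else 0)"
        using orth[of b a] f[of b] a by auto
    qed
    also have "\<dots> = ip p v (e a)" using a B by simp
    finally show ?thesis using ip_commute[OF p, of w x] by simp
  qed
  have lin: "linear (\<lambda>x. ip p x w)" by (auto intro!: linearI simp: inner_add_left)
  have "w \<in> span (e ` B)" using \<open>span (e ` B) = UNIV\<close> by simp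
  then have "ip p w w = 0"
    using linear_eq_0_on_span[OF lin, of "e ` B" w] 0 by blast
  then have "w = 0" using pos_h[OF p, of w] by force
  then show ?thesis by (simp add: w_def)
qed

lemma frame_ip:
  assumes p: "p \<in> \<Omega>" and B: "finite B" "card B = CARD('n)"
    and orth: "\<And>a b. a \<in> B \<Longrightarrow> b \<in> B \<Longrightarrow> ip p (e a) (e b) = (if a = b then f a else 0)"
    and f: "\<And>a. a \<in> B \<Longrightarrow> f a > 0"
  shows "ip p v w = (\<Sum>b\<in>B. ip p v (e b) * ip p w (e b) / f b)"
proof -
  have "ip p v w = ip p (\<Sum>b\<in>B. (ip p v (e b) / f b) *\<^sub>R e b) w"
    using frame_expand[OF p B, of e f v] orth f by simp
  also have "\<dots> = (\<Sum>b\<in>B. ip p v (e b) * ip p (e b) w / f b)"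
    by (simp add: inner_sum_left)
  also have "\<dots> = (\<Sum>b\<in>B. ip p v (e b) * ip p w (e b) / f b)"
    using ip_commute[OF p, of w] by metis
  finally show ?thesis .
qed

text \<open>\<open>ricci\<close> is a trace over coordinate vectors, whereas curvatures are known on
  an orthogonal frame; expanding \<open>axis i 1\<close> in the frame converts one trace into the
  other.\<close>

lemma frame_trace:
  assumes p: "p \<in> \<Omega>" and B: "finite B" "card B = CARD('n)"
    and orth: "\<And>a b. a \<in> B \<Longrightarrow> b \<in> B \<Longrightarrow> ip p (e a) (e b) = (if a = b then f a else 0)"
    and f: "\<And>a. a \<in> B \<Longrightarrow> f a > 0" and L: "linear L"
  shows "(\<Sum>\<^sub>U i. L (axis i 1) $ i) = (\<Sum>b\<in>B. ip p (L (e b)) (e b) / f b)"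
proof -
  have ax: "axis i 1 = (\<Sum>b\<in>B. ((h p *v e b) $ i / f b) *\<^sub>R e b)" for i :: 'n
    using frame_expand[OF p B, of e f "axis i 1"] orth f by (simp add: inner_axis')
  have "L (axis i 1) $ i = (\<Sum>b\<in>B. (h p *v e b) $ i / f b * L (e b) $ i)" for i
    by (subst ax) (simp add: linear_sum[OF L] linear_scale[OF L])
  then have "(\<Sum>\<^sub>U i. L (axis i 1) $ i) = (\<Sum>b\<in>B. \<Sum>\<^sub>U i. (h p *v e b) $ i / f b * L (e b) $ i)"
    by (simp, subst sum.swap) simp
  also have "\<dots> = (\<Sum>b\<in>B. ip p (L (e b)) (e b) / f b)"
    by (simp add: inner_vec_def sum_divide_distrib mult.commute)
  finally show ?thesis .
qed

lemma frame_ricci: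
  assumes p: "p \<in> \<Omega>" and B: "finite B" "card B = CARD('n)"
    and orth: "\<And>a b. a \<in> B \<Longrightarrow> b \<in> B \<Longrightarrow> ip p (e a) (e b) = (if a = b then f a else 0)"
    and f: "\<And>a. a \<in> B \<Longrightarrow> f a > 0"
  shows "w \<bullet> (ricci h p *v w) = (\<Sum>b\<in>B. ip p (Rv h p (e b) w w) (e b) / f b)"
  unfolding ricci_quad[OF p]
  by (rule frame_trace[OF p B orth f, of "\<lambda>x. Rv h p x w w"])
     (auto intro!: linearI simp: Rv_add[OF p] Rv_scale[OF p])

end

text \<open>\<open>u\<close> will be the polar map at a fixed time, read in a chart. It is not an
  inverse chart: its domain has dimension \<open>CARD('n) + 2\<close>, and its differential kills
  the two radial directions. Hence a connection along a map rather than a change of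
  coordinates.\<close>

locale coord_map = coord_metric h \<Omega>
  for h :: "real^'n::finite \<Rightarrow> real^'n^'n" and \<Omega> +
  fixes u :: "'e::euclidean_space \<Rightarrow> real^'n" and N :: "'e set"
  assumes open_N: "open N" and Cinf_u: "Cinf u N" and u_\<Omega>: "q \<in> N \<Longrightarrow> u q \<in> \<Omega>"
begin

text \<open>The Levi-Civita connection pulled back along \<open>u\<close>. Beware that \<open>DD a b W\<close> below is only the
  coordinate derivative of \<open>D b W\<close> in direction \<open>a\<close>; its connection term is added separately.\<close>
definition D :: "'e \<Rightarrow> ('e \<Rightarrow> real^'n) \<Rightarrow> 'e \<Rightarrow> real^'n" where
  "D a W q = dird a W q + Gam h (u q) (dird a u q) (W q)"

lemma u_line: "q \<in> N \<Longrightarrow> ((\<lambda>s. u (q + s *\<^sub>R a)) has_vector_derivative dird a u q) (at 0)"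
  by (intro dird_line0 Cinf_differentiable[OF Cinf_u])

lemma ip_line:
  assumes q: "q \<in> N"
    and X: "((\<lambda>s. X (q + s *\<^sub>R a)) has_vector_derivative X') (at 0)"
    and Y: "((\<lambda>s. Y (q + s *\<^sub>R a)) has_vector_derivative Y') (at 0)"
  shows "((\<lambda>s. ip (u (q + s *\<^sub>R a)) (X (q + s *\<^sub>R a)) (Y (q + s *\<^sub>R a))) has_real_derivative
     ip (u q) (X' + Gam h (u q) (dird a u q) (X q)) (Y q) + ip (u q) (X q) (Y' + Gam h (u q) (dird a u q) (Y q))) (at 0)"
  using ip_derivative[OF u_line[OF q, of a] _ X Y] u_\<Omega>[OF q] by simp

lemma ip_line_D:
  assumes q: "q \<in> N" and X: "X differentiable (at q)" and Y: "Y differentiable (at q)"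
  shows "((\<lambda>s. ip (u (q + s *\<^sub>R a)) (X (q + s *\<^sub>R a)) (Y (q + s *\<^sub>R a))) has_real_derivative
     ip (u q) (D a X q) (Y q) + ip (u q) (X q) (D a Y q)) (at 0)"
  using ip_line[OF q dird_line0[OF X] dird_line0[OF Y], of a] by (simp add: D_def)

lemma D_commute:
  assumes q: "q \<in> N" and ab: "a \<in> Basis" "b \<in> Basis"
  shows "D a (dird b u) q = D b (dird a u) q"
  using dird_commute[OF open_N q Cinf_u ab] Gam_commute[OF u_\<Omega>[OF q]] by (simp add: D_def)

definition DD :: "'e \<Rightarrow> 'e \<Rightarrow> ('e \<Rightarrow> real^'n) \<Rightarrow> 'e \<Rightarrow> real^'n" where
  "DD a b W q = dird a (dird b W) q + dGam h (u q) (dird a u q) (dird b u q) (W q)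
     + Gam h (u q) (dird a (dird b u) q) (W q) + Gam h (u q) (dird b u q) (dird a W q)"

lemma D_line:
  assumes q: "q \<in> N" and W: "Cinf W N" and ab: "a \<in> Basis" "b \<in> Basis"
  shows "((\<lambda>s. D b W (q + s *\<^sub>R a)) has_vector_derivative DD a b W q) (at 0)"
proof -
  have 1: "((\<lambda>s. dird b W (q + s *\<^sub>R a)) has_vector_derivative dird a (dird b W) q) (at 0)"
    by (intro dird_line0 Cinf_differentiable[OF Cinf_dird[OF W ab(2)]] q)
  have 2: "((\<lambda>s. dird b u (q + s *\<^sub>R a)) has_vector_derivative dird a (dird b u) q) (at 0)"
    by (intro dird_line0 Cinf_differentiable[OF Cinf_dird[OF Cinf_u ab(2)]] q)
  have 3: "((\<lambda>s. W (q + s *\<^sub>R a)) has_vector_derivative dird a W q) (at 0)"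
    by (intro dird_line0 Cinf_differentiable[OF W] q)
  have 4: "((\<lambda>s. Gam h (u (q + s *\<^sub>R a)) (dird b u (q + s *\<^sub>R a)) (W (q + s *\<^sub>R a))) has_vector_derivative
     dGam h (u q) (dird a u q) (dird b u q) (W q) + Gam h (u q) (dird a (dird b u) q) (W q) + Gam h (u q) (dird b u q) (dird a W q)) (at 0)"
    using Gam_derivative[OF u_line[OF q] _ 2 3] u_\<Omega>[OF q] by simp
  show ?thesis unfolding D_def DD_def
    using has_vector_derivative_add[OF 1 4] by (simp add: algebra_simps)
qed

text \<open>Mixed partial derivatives of \<open>u\<close> and of \<open>W\<close> commute, so
  antisymmetrisation leaves only \<open>Rv\<close>. The \<open>Gam\<close> terms outside
  \<open>DD\<close> complete it to the second covariant derivative.\<close>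

lemma curvature_commutator:
  assumes q: "q \<in> N" and W: "Cinf W N" and ab: "a \<in> Basis" "b \<in> Basis"
  shows "(DD a b W q + Gam h (u q) (dird a u q) (D b W q)) - (DD b a W q + Gam h (u q) (dird b u q) (D a W q))
     = Rv h (u q) (dird a u q) (dird b u q) (W q)"
  using dird_commute[OF open_N q Cinf_u ab] dird_commute[OF open_N q W ab]
  by (simp add: DD_def D_def Rv_def Gam_add)

text \<open>\<open>k1\<close> and \<open>k2\<close> are derivatives of scalars, which Koszul's
  formula makes explicit; the product rule trades them for second covariant derivatives. Thus the
  Christoffel symbols of the chart are never computed.\<close>

lemma sectional_formula:
  assumes q: "q \<in> N" and ab: "a \<in> Basis" "b \<in> Basis"
    and k1: "((\<lambda>s. ip (u (q + s *\<^sub>R a)) (D b (dird b u) (q + s *\<^sub>R a)) (dird a u (q + s *\<^sub>R a))) has_real_derivative k1) (at 0)"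
    and k2: "((\<lambda>s. ip (u (q + s *\<^sub>R b)) (D a (dird b u) (q + s *\<^sub>R b)) (dird a u (q + s *\<^sub>R b))) has_real_derivative k2) (at 0)"
  shows "ip (u q) (Rv h (u q) (dird a u q) (dird b u q) (dird b u q)) (dird a u q)
    = k1 - k2 - ip (u q) (D b (dird b u) q) (D a (dird a u) q) + ip (u q) (D a (dird b u) q) (D b (dird a u) q)"
proof -
  have ub: "Cinf (dird b u) N" and ua: "Cinf (dird a u) N" using Cinf_dird[OF Cinf_u] ab by blast+
  have la: "((\<lambda>s. dird a u (q + s *\<^sub>R c)) has_vector_derivative dird c (dird a u) q) (at 0)" for c
    by (intro dird_line0 Cinf_differentiable[OF ua] q)
  have 1: "k1 = ip (u q) (DD a b (dird b u) q + Gam h (u q) (dird a u q) (D b (dird b u) q)) (dird a u q)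
      + ip (u q) (D b (dird b u) q) (D a (dird a u) q)"
    using DERIV_unique[OF k1 ip_line[OF q D_line[OF q ub ab] la]] by (simp add: D_def)
  have 2: "k2 = ip (u q) (DD b a (dird b u) q + Gam h (u q) (dird b u q) (D a (dird b u) q)) (dird a u q)
      + ip (u q) (D a (dird b u) q) (D b (dird a u) q)"
    using DERIV_unique[OF k2 ip_line[OF q D_line[OF q ub ab(2,1)] la]] by (simp add: D_def)
  show ?thesis
    unfolding curvature_commutator[OF q ub ab, symmetric] inner_diff_left using 1 2 by simp
qed

text \<open>Three product rules, solved with the help of \<open>D_commute\<close>. There are no
  bracket terms because coordinate directions commute.\<close>

lemma koszul:
  assumes q: "q \<in> N" and abc: "a \<in> Basis" "b \<in> Basis" "c \<in> Basis"
    and 1: "((\<lambda>s. ip (u (q + s *\<^sub>R a)) (dird b u (q + s *\<^sub>R a)) (dird c u (q + s *\<^sub>R a))) has_real_derivative d1) (at 0)"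
    and 2: "((\<lambda>s. ip (u (q + s *\<^sub>R b)) (dird a u (q + s *\<^sub>R b)) (dird c u (q + s *\<^sub>R b))) has_real_derivative d2) (at 0)"
    and 3: "((\<lambda>s. ip (u (q + s *\<^sub>R c)) (dird a u (q + s *\<^sub>R c)) (dird b u (q + s *\<^sub>R c))) has_real_derivative d3) (at 0)"
  shows "ip (u q) (D a (dird b u) q) (dird c u q) = (d1 + d2 - d3) / 2"
proof -
  have diff: "dird b u differentiable (at q)" if "b \<in> Basis" for b
    using Cinf_differentiable[OF Cinf_dird[OF Cinf_u that] q] .
  note c = ip_commute[OF u_\<Omega>[OF q]]
  have "d1 = ip (u q) (D a (dird b u) q) (dird c u q) + ip (u q) (dird b u q) (D a (dird c u) q)"
    "d2 = ip (u q) (D b (dird a u) q) (dird c u q) + ip (u q) (dird a u q) (D b (dird c u) q)"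
    "d3 = ip (u q) (D c (dird a u) q) (dird b u q) + ip (u q) (dird a u q) (D c (dird b u) q)"
    using DERIV_unique[OF 1 ip_line_D[OF q diff[OF abc(2)] diff[OF abc(3)]]]
      DERIV_unique[OF 2 ip_line_D[OF q diff[OF abc(1)] diff[OF abc(3)]]]
      DERIV_unique[OF 3 ip_line_D[OF q diff[OF abc(1)] diff[OF abc(2)]]] by auto
  then show ?thesis
    using D_commute[OF q abc(1,2)] D_commute[OF q abc(1,3)] D_commute[OF q abc(2,3)]
      c[of "dird b u q" "D c (dird a u) q"] by simp
qed

end

section \<open>Doubly warped products\<close>

text \<open>The metric of the unit sphere pulled back under \<open>sgn\<close>, and its derivative in direction \<open>p\<close>.\<close>
definition sph :: "'v::real_inner \<Rightarrow> 'v \<Rightarrow> 'v \<Rightarrow> real" where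
  "sph x a b = (a \<bullet> b) / (x \<bullet> x) - (a \<bullet> x) * (b \<bullet> x) / (x \<bullet> x)\<^sup>2"

definition dsph :: "'v::real_inner \<Rightarrow> 'v \<Rightarrow> 'v \<Rightarrow> 'v \<Rightarrow> real" where
  "dsph x p a b = - 2 * (a \<bullet> b) * (x \<bullet> p) / (x \<bullet> x)\<^sup>2 - ((a \<bullet> p) * (b \<bullet> x) + (a \<bullet> x) * (b \<bullet> p)) / (x \<bullet> x)\<^sup>2
     + 4 * (a \<bullet> x) * (b \<bullet> x) * (x \<bullet> p) / (x \<bullet> x) ^ 3"

lemma sph_commute: "sph x b a = sph x a b" and dsph_commute: "dsph x p b a = dsph x p a b"
  by (simp_all add: sph_def dsph_def inner_commute[of b a] mult_ac add_ac)

lemma sph_line: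
  assumes "x \<noteq> 0"
  shows "((\<lambda>s. sph (x + s *\<^sub>R p) a b) has_real_derivative dsph x p a b) (at 0)"
proof -
  define d where "d s = x \<bullet> x + 2 * s * (x \<bullet> p) + s * s * (p \<bullet> p)" for s
  define m where "m s = (a \<bullet> x + s * (a \<bullet> p)) * (b \<bullet> x + s * (b \<bullet> p))" for s
  define r where "r = x \<bullet> x"
  have r: "r \<noteq> 0" using assms by (simp add: r_def)
  have d: "(d has_real_derivative 2 * (x \<bullet> p)) (at 0)" "d 0 = r"
    unfolding d_def r_def by (auto intro!: derivative_eq_intros)
  have m: "(m has_real_derivative (a \<bullet> p) * (b \<bullet> x) + (a \<bullet> x) * (b \<bullet> p)) (at 0)" "m 0 = (a \<bullet> x) * (b \<bullet> x)"
    unfolding m_def by (auto intro!: derivative_eq_intros)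
  have "((\<lambda>s. (a \<bullet> b) / d s - m s / (d s)\<^sup>2) has_real_derivative dsph x p a b) (at 0)"
    by (auto intro!: derivative_eq_intros d(1) m(1) simp: d(2) m(2) r dsph_def r_def[symmetric] field_simps power2_eq_square power3_eq_cube)
  then show ?thesis
    by (simp add: sph_def d_def m_def inner_add_left inner_add_right inner_commute algebra_simps)
qed

text \<open>One time slice near a point whose spherical parameters are the basis vectors
  \<open>axis i0 1\<close> and \<open>axis j0 1\<close>. There the sphere metric \<open>sph\<close>
  is 0 or 1 on the remaining basis directions and \<open>dsph\<close> vanishes on them; homogeneity
  of the spheres makes one such point per \<open>z\<close> sufficient.\<close>

locale warped = coord_map h \<Omega> u N
  for h :: "real^'n::finite \<Rightarrow> real^'n^'n" and \<Omega>
    and u :: "real \<times> (real^'k::finite) \<times> (real^'l::finite) \<Rightarrow> real^'n" and N +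
  fixes F F1 F2 G G1 G2 :: "real \<Rightarrow> real" and i0 :: 'k and j0 :: 'l and z0 :: real
  assumes N_nonzero: "(z, x, y) \<in> N \<Longrightarrow> x \<noteq> 0 \<and> y \<noteq> 0"
    and F: "(z, x, y) \<in> N \<Longrightarrow> F z > 0 \<and> (F has_real_derivative F1 z) (at z) \<and> (F1 has_real_derivative F2 z) (at z)"
    and G: "(z, x, y) \<in> N \<Longrightarrow> G z > 0 \<and> (G has_real_derivative G1 z) (at z) \<and> (G1 has_real_derivative G2 z) (at z)"
    and metric: "(z, x, y) \<in> N \<Longrightarrow>
      ip (u (z, x, y)) (dird (\<zeta>, a, b) u (z, x, y)) (dird (\<zeta>', a', b') u (z, x, y))
        = \<zeta> * \<zeta>' + (F z)\<^sup>2 * sph x a a' + (G z)\<^sup>2 * sph y b b'"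
    and q0: "(z0, axis i0 1, axis j0 1) \<in> N"
    and dim: "CARD('n) = CARD('k) + CARD('l) - 1"
begin

section \<open>Frame, connection coefficients and sectional curvatures of the warped product\<close>

definition q0 :: "real \<times> (real^'k) \<times> (real^'l)" where "q0 = (z0, axis i0 1, axis j0 1)"
definition Z :: "real \<times> (real^'k) \<times> (real^'l)" where "Z = (1, 0, 0)"
definition X :: "'k \<Rightarrow> real \<times> (real^'k) \<times> (real^'l)" where "X i = (0, axis i 1, 0)"
definition Y :: "'l \<Rightarrow> real \<times> (real^'k) \<times> (real^'l)" where "Y j = (0, 0, axis j 1)"

text \<open>The radial directions \<open>axis i0 1\<close> and \<open>axis j0 1\<close>, in which \<open>u\<close> is constant, are left out.\<close>
definition B where "B = insert Z (X ` (- {i0}) \<union> Y ` (- {j0}))"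

fun Hm where "Hm (z, x, y) (\<zeta>, a, b) (\<zeta>', a', b') = \<zeta> * \<zeta>' + (F z)\<^sup>2 * sph x a a' + (G z)\<^sup>2 * sph y b b'"

fun dHm where "dHm (z, x, y) (\<gamma>, p, r) (\<zeta>, a, b) (\<zeta>', a', b') =
   \<gamma> * (2 * F z * F1 z * sph x a a' + 2 * G z * G1 z * sph y b b') + (F z)\<^sup>2 * dsph x p a a' + (G z)\<^sup>2 * dsph y r b b'"

lemma metric_Hm: "q \<in> N \<Longrightarrow> ip (u q) (dird v u q) (dird w u q) = Hm q v w"
  by (cases q; cases v; cases w) (simp add: metric)

lemma Hm_line:
  assumes "q \<in> N"
  shows "((\<lambda>s. Hm (q + s *\<^sub>R c) v w) has_real_derivative dHm q c v w) (at 0)"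
proof -
  obtain z x y \<gamma> p r \<zeta> a b \<zeta>' a' b' where e: "q = (z, x, y)" "c = (\<gamma>, p, r)" "v = (\<zeta>, a, b)" "w = (\<zeta>', a', b')"
    by (metis prod.collapse)
  have q: "(z, x, y) \<in> N" using assms e by simp
  have f: "((\<lambda>s. F (z + s * \<gamma>)) has_real_derivative F1 z * \<gamma>) (at 0)"
    by (rule DERIV_chain2[where f = F]) (use F[OF q] in \<open>auto intro!: derivative_eq_intros\<close>)
  have g: "((\<lambda>s. G (z + s * \<gamma>)) has_real_derivative G1 z * \<gamma>) (at 0)"
    by (rule DERIV_chain2[where f = G]) (use G[OF q] in \<open>auto intro!: derivative_eq_intros\<close>)
  have sx: "((\<lambda>s. sph (x + s *\<^sub>R p) a a') has_real_derivative dsph x p a a') (at 0)"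
    and sy: "((\<lambda>s. sph (y + s *\<^sub>R r) b b') has_real_derivative dsph y r b b') (at 0)"
    using sph_line N_nonzero[OF q] by blast+
  have "((\<lambda>s. \<zeta> * \<zeta>' + (F (z + s * \<gamma>))\<^sup>2 * sph (x + s *\<^sub>R p) a a' + (G (z + s * \<gamma>))\<^sup>2 * sph (y + s *\<^sub>R r) b b')
      has_real_derivative dHm q c v w) (at 0)"
    unfolding e by (rule derivative_eq_intros f g sx sy refl | simp add: algebra_simps)+
  then show ?thesis unfolding e by simp
qed

lemma line_in_N:
  assumes "q \<in> N" shows "eventually (\<lambda>s. q + s *\<^sub>R c \<in> N) (nhds (0::real))"
proof -
  have "((\<lambda>s. q + s *\<^sub>R c) \<longlongrightarrow> q + 0 *\<^sub>R c) (nhds (0::real))"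
    by (intro tendsto_intros filterlim_ident)
  then have "((\<lambda>s. q + s *\<^sub>R c) \<longlongrightarrow> q) (nhds (0::real))" by simp
  from topological_tendstoD[OF this open_N assms] show ?thesis .
qed

lemma DERIV_cong_N:
  assumes "q \<in> N" "\<And>s. q + s *\<^sub>R c \<in> N \<Longrightarrow> f s = g s"
  shows "(f has_real_derivative d) (at 0) \<longleftrightarrow> (g has_real_derivative d) (at 0)"
  by (rule DERIV_cong_ev[OF refl _ refl]) (use eventually_mono[OF line_in_N[OF assms(1)] assms(2)] in auto)

lemma metric_line:
  assumes q: "q \<in> N"
  shows "((\<lambda>s. ip (u (q + s *\<^sub>R c)) (dird v u (q + s *\<^sub>R c)) (dird w u (q + s *\<^sub>R c))) has_real_derivative dHm q c v w) (at 0)"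
  by (subst DERIV_cong_N[OF q, of c _ "\<lambda>s. Hm (q + s *\<^sub>R c) v w"]) (auto simp: metric_Hm Hm_line q)

lemma dHm_commute: "dHm q c w v = dHm q c v w"
proof (cases q; cases c; cases v; cases w)
  fix z x y \<gamma> p r \<zeta> a b \<zeta>' a' b' assume e: "q = (z, x, y)" "c = (\<gamma>, p, r)" "v = (\<zeta>, a, b)" "w = (\<zeta>', a', b')"
  show ?thesis unfolding e by (simp add: sph_commute[of _ a'] sph_commute[of _ b'] dsph_commute[of _ _ a'] dsph_commute[of _ _ b'])
qed

text \<open>Right-hand side of Koszul's formula: the Christoffel symbols of the first kind of the
  warped product in the coordinates \<open>(z, x, y)\<close>.\<close>

definition K where "K q a b c = (dHm q a b c + dHm q b a c - dHm q c a b) / 2"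

lemma ip_D_K:
  assumes "q \<in> N" "a \<in> Basis" "b \<in> Basis" "c \<in> Basis"
  shows "ip (u q) (D a (dird b u) q) (dird c u q) = K q a b c"
  unfolding K_def by (rule koszul) (auto intro!: metric_line assms)

lemma Basis_B: "b \<in> B \<Longrightarrow> b \<in> Basis"
  by (auto simp: B_def Z_def X_def Y_def Basis_prod_def axis_in_Basis_iff image_iff zero_prod_def)

lemma B_distinct [simp]: "X i \<noteq> Z" "Z \<noteq> X i" "Y j \<noteq> Z" "Z \<noteq> Y j" "X i \<noteq> Y j" "Y j \<noteq> X i"
  "X i = X i' \<longleftrightarrow> i = i'" "Y j = Y j' \<longleftrightarrow> j = j'"
  by (auto simp: Z_def X_def Y_def axis_eq_axis axis_eq_0_iff)

lemma B_sum: "(\<Sum>b\<in>B. g b) = g Z + (\<Sum>i\<in>-{i0}. g (X i)) + (\<Sum>j\<in>-{j0}. g (Y j))"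
proof -
  have "inj_on X (-{i0})" "inj_on Y (-{j0})" by (auto simp: inj_on_def)
  moreover have "X ` (- {i0}) \<inter> Y ` (- {j0}) = {}" "Z \<notin> X ` (- {i0}) \<union> Y ` (- {j0})" by (auto dest: sym)
  ultimately show ?thesis
    by (simp add: B_def sum.union_disjoint sum.reindex add.assoc)
qed

lemma finite_B: "finite B" by (simp add: B_def)

lemma card_B: "card B = CARD('n)"
proof -
  have "card B = (\<Sum>b\<in>B. 1)" by simp
  also have "\<dots> = 1 + card (- {i0}) + card (- {j0})" unfolding B_sum by simp
  also have "\<dots> = CARD('n)"
    using dim card_gt_0_iff[of "UNIV :: 'k set"] card_gt_0_iff[of "UNIV :: 'l set"] by (simp add: Compl_eq_Diff_UNIV card_Diff_singleton)
  finally show ?thesis .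
qed

lemma q0_N: "q0 \<in> N" using q0 by (simp add: q0_def)

lemmas F0 = F[OF q0] and G0 = G[OF q0]

text \<open>Squared lengths of the frame vectors at \<open>q0\<close>.\<close>

definition wf where "wf b = (if b = Z then 1 else if b \<in> range X then (F z0)\<^sup>2 else (G z0)\<^sup>2)"

lemma wf_simps [simp]: "wf Z = 1" "wf (X i) = (F z0)\<^sup>2" "wf (Y j) = (G z0)\<^sup>2"
  by (auto simp: wf_def)

lemma B_cases:
  assumes "b \<in> B" obtains "b = Z" | i where "b = X i" "i \<noteq> i0" | j where "b = Y j" "j \<noteq> j0"
  using assms by (auto simp: B_def)

lemma wf_pos: "b \<in> B \<Longrightarrow> wf b > 0"
  using F0 G0 by (elim B_cases) auto

lemma sph_0 [simp]: "sph x 0 b = 0" "sph x a 0 = 0" "dsph x 0 a b = 0" "dsph x p 0 b = 0" "dsph x p a 0 = 0"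
  by (auto simp: sph_def dsph_def)

lemma sph_axis [simp]: "i \<noteq> k \<Longrightarrow> i' \<noteq> k \<Longrightarrow> sph (axis k (1::real)) (axis i 1) (axis i' 1) = (if i = i' then 1 else 0)"
  by (simp add: sph_def inner_axis_axis)

lemma dsph_axis [simp]: "m \<noteq> k \<Longrightarrow> i \<noteq> k \<Longrightarrow> i' \<noteq> k \<Longrightarrow> dsph (axis k (1::real)) (axis m 1) (axis i 1) (axis i' 1) = 0"
  by (simp add: dsph_def inner_axis_axis)

lemma orth: "a \<in> B \<Longrightarrow> b \<in> B \<Longrightarrow> ip (u q0) (dird a u q0) (dird b u q0) = (if a = b then wf a else 0)"
  unfolding metric_Hm[OF q0_N]
  by (elim B_cases; simp; simp add: q0_def Z_def X_def Y_def)

lemma frame_ip_B: "ip (u q0) v w = (\<Sum>b\<in>B. ip (u q0) v (dird b u q0) * ip (u q0) w (dird b u q0) / wf b)"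
  by (rule frame_ip[OF u_\<Omega>[OF q0_N] finite_B card_B]) (auto simp: orth wf_pos)

lemma frame_ricci_B: "w \<bullet> (ricci h (u q0) *v w) = (\<Sum>b\<in>B. ip (u q0) (Rv h (u q0) (dird b u q0) w w) (dird b u q0) / wf b)"
  by (rule frame_ricci[OF u_\<Omega>[OF q0_N] finite_B card_B]) (auto simp: orth wf_pos)

text \<open>At \<open>q0\<close> the connection of the round spheres drops out, since
  \<open>dsph\<close> vanishes there on the frame; only terms with a z-derivative of a radius
  survive. The derivatives of the sphere terms do not vanish and come back in
  \<open>sec_YY\<close>.\<close>

lemma K_table:
  assumes "c \<in> B"
  shows "K q0 Z Z c = 0"
   "i \<noteq> i0 \<Longrightarrow> K q0 Z (X i) c = (if c = X i then F z0 * F1 z0 else 0)"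
   "i \<noteq> i0 \<Longrightarrow> K q0 (X i) Z c = (if c = X i then F z0 * F1 z0 else 0)"
   "j \<noteq> j0 \<Longrightarrow> K q0 Z (Y j) c = (if c = Y j then G z0 * G1 z0 else 0)"
   "j \<noteq> j0 \<Longrightarrow> K q0 (Y j) Z c = (if c = Y j then G z0 * G1 z0 else 0)"
   "i \<noteq> i0 \<Longrightarrow> K q0 (X i) (X i) c = (if c = Z then - F z0 * F1 z0 else 0)"
   "j \<noteq> j0 \<Longrightarrow> K q0 (Y j) (Y j) c = (if c = Z then - G z0 * G1 z0 else 0)"
   "i \<noteq> i0 \<Longrightarrow> j \<noteq> j0 \<Longrightarrow> K q0 (X i) (Y j) c = 0"
   "j \<noteq> j0 \<Longrightarrow> j' \<noteq> j0 \<Longrightarrow> j \<noteq> j' \<Longrightarrow> K q0 (Y j) (Y j') c = 0"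
  using assms
  by (elim B_cases; simp; simp add: K_def q0_def Z_def X_def Y_def)+

text \<open>Sectional curvature before division by the squared lengths of the two orthogonal frame
  vectors.\<close>

definition sec where "sec a b = ip (u q0) (Rv h (u q0) (dird a u q0) (dird b u q0) (dird b u q0)) (dird a u q0)"

text \<open>In \<open>sectional_formula\<close> the products of two covariant derivatives are
  expanded in the frame at \<open>q0\<close>, so that values and first derivatives of
  \<open>K\<close> determine the curvature.\<close>

lemma sec_formula:
  assumes ab: "a \<in> B" "b \<in> B"
    and k1: "((\<lambda>s. K (q0 + s *\<^sub>R a) b b a) has_real_derivative k1) (at 0)"
    and k2: "((\<lambda>s. K (q0 + s *\<^sub>R b) a b a) has_real_derivative k2) (at 0)"
  shows "sec a b = k1 - k2 - (\<Sum>c\<in>B. K q0 b b c * K q0 a a c / wf c) + (\<Sum>c\<in>B. K q0 a b c * K q0 a b c / wf c)"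
proof -
  have k1': "((\<lambda>s. ip (u (q0 + s *\<^sub>R a)) (D b (dird b u) (q0 + s *\<^sub>R a)) (dird a u (q0 + s *\<^sub>R a))) has_real_derivative k1) (at 0)"
    by (subst DERIV_cong_N[OF q0_N, of a _ "\<lambda>s. K (q0 + s *\<^sub>R a) b b a"]) (auto simp: ip_D_K Basis_B ab k1)
  have k2': "((\<lambda>s. ip (u (q0 + s *\<^sub>R b)) (D a (dird b u) (q0 + s *\<^sub>R b)) (dird a u (q0 + s *\<^sub>R b))) has_real_derivative k2) (at 0)"
    by (subst DERIV_cong_N[OF q0_N, of b _ "\<lambda>s. K (q0 + s *\<^sub>R b) a b a"]) (auto simp: ip_D_K Basis_B ab k2)
  have "ip (u q0) (D b (dird b u) q0) (D a (dird a u) q0) = (\<Sum>c\<in>B. K q0 b b c * K q0 a a c / wf c)"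
    by (rule trans[OF frame_ip_B sum.cong[OF refl]]) (simp add: ip_D_K q0_N Basis_B ab)
  moreover have "ip (u q0) (D a (dird b u) q0) (D b (dird a u) q0) = (\<Sum>c\<in>B. K q0 a b c * K q0 a b c / wf c)"
    unfolding D_commute[OF q0_N Basis_B[OF ab(2)] Basis_B[OF ab(1)]]
    by (rule trans[OF frame_ip_B sum.cong[OF refl]]) (simp add: ip_D_K q0_N Basis_B ab)
  ultimately show ?thesis
    unfolding sec_def sectional_formula[OF q0_N Basis_B[OF ab(1)] Basis_B[OF ab(2)] k1' k2'] by simp
qed

lemma Z_B: "Z \<in> B" and X_B: "i \<noteq> i0 \<Longrightarrow> X i \<in> B" and Y_B: "j \<noteq> j0 \<Longrightarrow> Y j \<in> B"
  by (auto simp: B_def)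

lemma near_z0: "eventually (\<lambda>s. (z0 + s, axis i0 1, axis j0 1) \<in> N) (nhds 0)"
  using line_in_N[OF q0_N, of Z] by (simp add: q0_def Z_def)

lemma F_line: "((\<lambda>s. F (z0 + s)) has_real_derivative F1 z0) (at 0)" "((\<lambda>s. F1 (z0 + s)) has_real_derivative F2 z0) (at 0)"
  and G_line: "((\<lambda>s. G (z0 + s)) has_real_derivative G1 z0) (at 0)" "((\<lambda>s. G1 (z0 + s)) has_real_derivative G2 z0) (at 0)"
  using F0 G0 DERIV_shift[of _ _ 0 z0] by (auto simp: add.commute)

lemma sec_radial:
  assumes b: "b \<in> B" and wfb: "wf b = (f 0)\<^sup>2"
    and f: "f 0 > 0" "(f has_real_derivative f1 0) (at 0)" "(f1 has_real_derivative f2) (at 0)"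
    and KZ: "\<And>s. K (q0 + s *\<^sub>R Z) b b Z = - (f s * f1 s)" "\<And>s. K (q0 + s *\<^sub>R Z) b Z b = f s * f1 s"
    and Kb: "\<And>s. K (q0 + s *\<^sub>R b) Z b Z = 0" "\<And>s. K (q0 + s *\<^sub>R b) Z Z b = 0"
    and K0: "\<And>c. c \<in> B \<Longrightarrow> K q0 Z b c = (if c = b then f 0 * f1 0 else 0)"
  shows "sec Z b = - f 0 * f2" "sec b Z = - f 0 * f2"
proof -
  have d: "((\<lambda>s. f s * f1 s) has_real_derivative f1 0 * f1 0 + f 0 * f2) (at 0)"
    using DERIV_mult[OF f(2,3)] by (simp add: add.commute mult.commute)
  have Kbz: "K q0 b Z c = K q0 Z b c" for c by (simp add: K_def dHm_commute[of q0 c Z])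
  have S: "(\<Sum>c\<in>B. K q0 Z b c * K q0 Z b c / wf c) = f1 0 * f1 0"
  proof -
    have "(\<Sum>c\<in>B. K q0 Z b c * K q0 Z b c / wf c) = (\<Sum>c\<in>B. if c = b then (f 0 * f1 0) * (f 0 * f1 0) / wf c else 0)"
      by (intro sum.cong) (auto simp: K0)
    then show ?thesis using f(1) by (simp add: finite_B b wfb power2_eq_square)
  qed
  have 0: "(\<Sum>c\<in>B. K q0 b b c * K q0 Z Z c / wf c) = 0" "(\<Sum>c\<in>B. K q0 Z Z c * K q0 b b c / wf c) = 0"
    by (intro sum.neutral, simp add: K_table)+
  have "((\<lambda>s. K (q0 + s *\<^sub>R Z) b b Z) has_real_derivative - (f1 0 * f1 0 + f 0 * f2)) (at 0)"
    "((\<lambda>s. K (q0 + s *\<^sub>R b) Z b Z) has_real_derivative 0) (at 0)"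
    unfolding KZ Kb by (intro DERIV_minus d DERIV_const)+
  from sec_formula[OF Z_B b this] show "sec Z b = - f 0 * f2" unfolding 0 S by simp
  have "((\<lambda>s. K (q0 + s *\<^sub>R b) Z Z b) has_real_derivative 0) (at 0)"
    "((\<lambda>s. K (q0 + s *\<^sub>R Z) b Z b) has_real_derivative f1 0 * f1 0 + f 0 * f2) (at 0)"
    unfolding KZ Kb by (intro d DERIV_const)+
  from sec_formula[OF b Z_B this] show "sec b Z = - f 0 * f2" unfolding 0 Kbz S by simp
qed

lemma sec_ZX: assumes "i \<noteq> i0" shows "sec Z (X i) = - F z0 * F2 z0" "sec (X i) Z = - F z0 * F2 z0"
proof -
  note r = sec_radial[OF X_B[OF assms], of "\<lambda>s. F (z0 + s)" "\<lambda>s. F1 (z0 + s)" "F2 z0"]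
  have K: "K (q0 + s *\<^sub>R Z) (X i) (X i) Z = - (F (z0 + s) * F1 (z0 + s))" "K (q0 + s *\<^sub>R Z) (X i) Z (X i) = F (z0 + s) * F1 (z0 + s)"
    "K (q0 + s *\<^sub>R X i) Z (X i) Z = 0" "K (q0 + s *\<^sub>R X i) Z Z (X i) = 0" for s
    using assms by (simp_all add: K_def q0_def Z_def X_def)
  show "sec Z (X i) = - F z0 * F2 z0" "sec (X i) Z = - F z0 * F2 z0"
    using r[OF _ _ _ _ K] F0 F_line K_table(2)[OF _ assms] by simp_all
qed

lemma sec_ZY: assumes "j \<noteq> j0" shows "sec Z (Y j) = - G z0 * G2 z0" "sec (Y j) Z = - G z0 * G2 z0"
proof -
  note r = sec_radial[OF Y_B[OF assms], of "\<lambda>s. G (z0 + s)" "\<lambda>s. G1 (z0 + s)" "G2 z0"]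
  have K: "K (q0 + s *\<^sub>R Z) (Y j) (Y j) Z = - (G (z0 + s) * G1 (z0 + s))" "K (q0 + s *\<^sub>R Z) (Y j) Z (Y j) = G (z0 + s) * G1 (z0 + s)"
    "K (q0 + s *\<^sub>R Y j) Z (Y j) Z = 0" "K (q0 + s *\<^sub>R Y j) Z Z (Y j) = 0" for s
    using assms by (simp_all add: K_def q0_def Z_def Y_def)
  show "sec Z (Y j) = - G z0 * G2 z0" "sec (Y j) Z = - G z0 * G2 z0"
    using r[OF _ _ _ _ K] G0 G_line K_table(4)[OF _ assms] by simp_all
qed

text \<open>Gauss equation for the slices of constant z: the product of two spheres is flat in mixed
  planes, and the second fundamental forms of its factors contribute the product of
  \<open>F * F1\<close> and \<open>G * G1\<close>.\<close>

lemma sec_XY: assumes "i \<noteq> i0" "j \<noteq> j0" shows "sec (X i) (Y j) = - F z0 * F1 z0 * G z0 * G1 z0"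
proof -
  have k1: "((\<lambda>s. K (q0 + s *\<^sub>R X i) (Y j) (Y j) (X i)) has_real_derivative 0) (at 0)"
    using assms by (simp add: K_def q0_def Y_def X_def)
  have k2: "((\<lambda>s. K (q0 + s *\<^sub>R Y j) (X i) (Y j) (X i)) has_real_derivative 0) (at 0)"
    using assms by (simp add: K_def q0_def Y_def X_def)
  have 1: "(\<Sum>c\<in>B. K q0 (X i) (Y j) c * K q0 (X i) (Y j) c / wf c) = 0"
    by (intro sum.neutral) (simp add: K_table assms)
  have "(\<Sum>c\<in>B. K q0 (Y j) (Y j) c * K q0 (X i) (X i) c / wf c) = (\<Sum>c\<in>B. if c = Z then F z0 * F1 z0 * (G z0 * G1 z0) / wf c else 0)"
    by (intro sum.cong) (auto simp: K_table assms)
  also have "\<dots> = F z0 * F1 z0 * G z0 * G1 z0" by (simp add: finite_B Z_B)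
  finally show ?thesis
    unfolding sec_formula[OF X_B[OF assms(1)] Y_B[OF assms(2)] k1 k2] 1 by simp
qed

lemma sec_YY: assumes "j' \<noteq> j0" "j \<noteq> j0" "j' \<noteq> j" shows "sec (Y j') (Y j) = (G z0)\<^sup>2 * (1 - (G1 z0)\<^sup>2)"
proof -
  have k1: "((\<lambda>s. K (q0 + s *\<^sub>R Y j') (Y j) (Y j) (Y j')) has_real_derivative 0) (at 0)"
    using assms by (simp add: K_def q0_def Y_def dsph_def inner_add_left inner_add_right inner_axis_axis)
  \<comment> \<open>The base point leaves the unit sphere, with squared norm
    \<open>1 + s * s\<close>. The derivative at 0 is the intrinsic curvature of the sphere factor;
    the term with \<open>G1\<close> is the extrinsic part.\<close>
  have "K (q0 + s *\<^sub>R Y j) (Y j') (Y j) (Y j') = - (G z0)\<^sup>2 * s / (1 + s * s)\<^sup>2" for s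
    using assms by (simp add: K_def q0_def Y_def dsph_def inner_add_left inner_add_right inner_axis_axis)
  moreover have "((\<lambda>s. - (G z0)\<^sup>2 * s / (1 + s * s)\<^sup>2) has_real_derivative - (G z0)\<^sup>2) (at 0)"
    by (auto intro!: derivative_eq_intros)
  ultimately have k2: "((\<lambda>s. K (q0 + s *\<^sub>R Y j) (Y j') (Y j) (Y j')) has_real_derivative - (G z0)\<^sup>2) (at 0)"
    by simp
  have 1: "(\<Sum>c\<in>B. K q0 (Y j') (Y j) c * K q0 (Y j') (Y j) c / wf c) = 0"
    by (intro sum.neutral) (simp add: K_table assms)
  have "(\<Sum>c\<in>B. K q0 (Y j) (Y j) c * K q0 (Y j') (Y j') c / wf c) = (\<Sum>c\<in>B. if c = Z then G z0 * G1 z0 * (G z0 * G1 z0) / wf c else 0)"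
    by (intro sum.cong) (auto simp: K_table assms)
  also have "\<dots> = (G z0)\<^sup>2 * (G1 z0)\<^sup>2" by (simp add: finite_B Z_B power2_eq_square)
  finally show ?thesis
    unfolding sec_formula[OF Y_B[OF assms(1)] Y_B[OF assms(2)] k1 k2] 1 by (simp add: algebra_simps)
qed

section \<open>Ricci curvature and concavity of the radii\<close>

lemma sec_self: "sec a a = 0"
  by (simp add: sec_def Rv_def)

lemma ricci_Z:
  "dird Z u q0 \<bullet> (ricci h (u q0) *v dird Z u q0)
     = - (real CARD('k) - 1) * F2 z0 / F z0 - (real CARD('l) - 1) * G2 z0 / G z0"
proof -
  have pos: "F z0 > 0" "G z0 > 0" using F0 G0 by auto
  have "dird Z u q0 \<bullet> (ricci h (u q0) *v dird Z u q0) = (\<Sum>b\<in>B. sec b Z / wf b)"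
    unfolding sec_def by (rule frame_ricci_B)
  also have "\<dots> = (\<Sum>i\<in>-{i0}. - F2 z0 / F z0) + (\<Sum>j\<in>-{j0}. - G2 z0 / G z0)"
    unfolding B_sum using pos by (simp add: sec_self sec_ZX sec_ZY power2_eq_square)
  also have "\<dots> = - (real CARD('k) - 1) * F2 z0 / F z0 - (real CARD('l) - 1) * G2 z0 / G z0"
    by (simp add: Compl_eq_Diff_UNIV card_Diff_singleton of_nat_diff algebra_simps diff_divide_distrib add_divide_distrib)
  finally show ?thesis .
qed

lemma ricci_Y:
  assumes j: "j \<noteq> j0"
  shows "dird (Y j) u q0 \<bullet> (ricci h (u q0) *v dird (Y j) u q0)
     = - G z0 * G2 z0 - (real CARD('k) - 1) * F1 z0 * G1 z0 * G z0 / F z0 + (real CARD('l) - 2) * (1 - (G1 z0)\<^sup>2)"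
proof -
  have pos: "F z0 > 0" "G z0 > 0" using F0 G0 by auto
  have cl: "2 \<le> CARD('l)" using card_mono[of UNIV "{j, j0}"] j by simp
  have "dird (Y j) u q0 \<bullet> (ricci h (u q0) *v dird (Y j) u q0) = (\<Sum>b\<in>B. sec b (Y j) / wf b)"
    unfolding sec_def by (rule frame_ricci_B)
  also have "\<dots> = - G z0 * G2 z0 + (\<Sum>i\<in>-{i0}. - F1 z0 * G1 z0 * G z0 / F z0) + (\<Sum>j'\<in>-{j0}. if j' = j then 0 else 1 - (G1 z0)\<^sup>2)"
  proof -
    have "(\<Sum>j'\<in>-{j0}. sec (Y j') (Y j) / wf (Y j')) = (\<Sum>j'\<in>-{j0}. if j' = j then 0 else 1 - (G1 z0)\<^sup>2)"
      using pos j by (intro sum.cong) (auto simp: sec_self sec_YY)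
    then show ?thesis unfolding B_sum using pos j by (simp add: sec_ZY sec_XY power2_eq_square)
  qed
  also have "(\<Sum>j'\<in>-{j0}. if j' = j then 0 else 1 - (G1 z0)\<^sup>2) = (\<Sum>j'\<in>-{j0}-{j}. 1 - (G1 z0)\<^sup>2)"
    by (rule sum.mono_neutral_cong_right) auto
  also have "\<dots> = (real CARD('l) - 2) * (1 - (G1 z0)\<^sup>2)"
    using j cl by (simp add: Compl_eq_Diff_UNIV card_Diff_singleton of_nat_diff)
  finally show ?thesis
    by (simp add: Compl_eq_Diff_UNIV card_Diff_singleton of_nat_diff algebra_simps)
qed

text \<open>Planes containing the z-direction have sectional curvature \<open>- F2 z0 / F z0\<close>
  or \<open>- G2 z0 / G z0\<close>.\<close>

lemma concave:
  assumes c: "curv_op_nonneg h (u q0)" and ex: "\<exists>i. i \<noteq> i0" "\<exists>j. j \<noteq> j0"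
  shows "F2 z0 \<le> 0" "G2 z0 \<le> 0"
proof -
  obtain i j where ij: "i \<noteq> i0" "j \<noteq> j0" using ex by auto
  have s: "0 \<le> sec a b + sec b a" for a b
    unfolding sec_def by (rule curv_op_nonneg_sectional[OF u_\<Omega>[OF q0_N] c])
  have "0 \<le> - (2 * F z0) * F2 z0" "0 \<le> - (2 * G z0) * G2 z0"
    using s[of Z "X i"] s[of Z "Y j"] ij by (simp_all add: sec_ZX sec_ZY)
  then show "F2 z0 \<le> 0" "G2 z0 \<le> 0"
    using F0 G0 by (simp_all add: mult_le_0_iff)
qed

end

section \<open>Velocity fields, charts and isometries\<close>

context coord_map
begin

text \<open>\<open>gd\<close> is the change of the metric at a fixed point of the chart. The
  transport part of the derivative of \<open>M\<close> is what completes the coordinate derivative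
  of \<open>W\<close> to the covariant one, giving the Lie derivative of the metric along
  \<open>W\<close>.\<close>

lemma metric_time_derivative:
  assumes q: "q \<in> N"
    and A: "(A has_vector_derivative dird a W q) (at t within S)" "A t = dird a u q"
    and M: "(M has_vector_derivative gd + dird (W q) h (u q)) (at t within S)" "M t = h (u q)"
  shows "((\<lambda>s. A s \<bullet> (M s *v A s)) has_real_derivative
     2 * ip (u q) (D a W q) (dird a u q) + dird a u q \<bullet> (gd *v dird a u q)) (at t within S)"
proof -
  note p = u_\<Omega>[OF q]
  have "dird a u q \<bullet> (dird (W q) h (u q) *v dird a u q) = 2 * ip (u q) (Gam h (u q) (dird a u q) (W q)) (dird a u q)"
    using ip_Gam_compat[OF p, of "W q" "dird a u q" "dird a u q"] Gam_commute[OF p, of "W q"]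
      ip_commute[OF p, of "dird a u q" "Gam h (u q) (dird a u q) (W q)"] by simp
  then show ?thesis
    using has_vector_derivative_quad[OF A(1) A(1) M(1)] ip_commute[OF p, of "dird a u q" "dird a W q"]
    by (simp add: A(2) M(2) D_def matrix_vector_mult_add_rdistrib inner_add_right inner_add_left algebra_simps)
qed

end

context warped
begin

text \<open>The z-lines are geodesics, so \<open>D Z (dird Z u)\<close> is 0 at \<open>q0\<close>
  and the product rule loses one term.\<close>

lemma velocity_Z_derivative:
  assumes W: "W differentiable (at q0)"
  shows "((\<lambda>s. ip (u (z0 + s, axis i0 1, axis j0 1)) (W (z0 + s, axis i0 1, axis j0 1)) (dird Z u (z0 + s, axis i0 1, axis j0 1)))
     has_real_derivative ip (u q0) (D Z W q0) (dird Z u q0)) (at 0)"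
proof -
  have Zb: "Z \<in> Basis" using Basis_B Z_B by blast
  have d: "dird Z u differentiable (at q0)"
    using Cinf_differentiable[OF Cinf_dird[OF Cinf_u Zb] q0_N] .
  have "ip (u q0) (W q0) (D Z (dird Z u) q0) = 0"
    by (subst frame_ip_B) (simp add: ip_D_K q0_N Zb Basis_B K_table)
  then show ?thesis
    using ip_line_D[OF q0_N W d, of Z] by (simp add: q0_def Z_def)
qed

text \<open>Differentiating the orthogonality along \<open>Y j\<close> moves the derivative from
  \<open>W\<close> onto \<open>dird (Y j) u\<close>, whose covariant derivative points in direction
  \<open>Z\<close> with coefficient \<open>- G z0 * G1 z0\<close>.\<close>

lemma velocity_Y:
  assumes W: "W differentiable (at q0)" and j: "j \<noteq> j0"
    and orth: "\<And>s. q0 + s *\<^sub>R Y j \<in> N \<Longrightarrow> ip (u (q0 + s *\<^sub>R Y j)) (W (q0 + s *\<^sub>R Y j)) (dird (Y j) u (q0 + s *\<^sub>R Y j)) = 0"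
  shows "ip (u q0) (D (Y j) W q0) (dird (Y j) u q0) = G z0 * G1 z0 * ip (u q0) (W q0) (dird Z u q0)"
proof -
  have Yb: "Y j \<in> Basis" using Basis_B Y_B j by blast
  have d: "dird (Y j) u differentiable (at q0)"
    using Cinf_differentiable[OF Cinf_dird[OF Cinf_u Yb] q0_N] .
  have "ip (u q0) (W q0) (D (Y j) (dird (Y j) u) q0) =
      (\<Sum>c\<in>B. if c = Z then ip (u q0) (W q0) (dird c u q0) * (- G z0 * G1 z0) / wf c else 0)"
    by (subst frame_ip_B, intro sum.cong refl) (simp add: ip_D_K q0_N Yb Basis_B K_table j)
  also have "\<dots> = - G z0 * G1 z0 * ip (u q0) (W q0) (dird Z u q0)"
    by (simp add: finite_B Z_B)
  finally have 1: "ip (u q0) (W q0) (D (Y j) (dird (Y j) u) q0) = - G z0 * G1 z0 * ip (u q0) (W q0) (dird Z u q0)" .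
  have "((\<lambda>s. 0) has_real_derivative ip (u q0) (D (Y j) W q0) (dird (Y j) u q0) + ip (u q0) (W q0) (D (Y j) (dird (Y j) u) q0)) (at 0)"
    using ip_line_D[OF q0_N W d, of "Y j"] by (subst (asm) DERIV_cong_N[OF q0_N, of "Y j" _ "\<lambda>s. 0"]) (auto simp: orth)
  then have "ip (u q0) (D (Y j) W q0) (dird (Y j) u q0) + ip (u q0) (W q0) (D (Y j) (dird (Y j) u) q0) = 0"
    using DERIV_unique DERIV_const by blast
  then show ?thesis using 1 by simp
qed

end

section \<open>Pullbacks in a fixed chart, the retraction \<open>sgn\<close>, and rotations\<close>

lemma chart_open_image:
  assumes c: "is_chart c" and V: "open V" "V \<subseteq> fst c"
  shows "open (snd c ` V)"
proof -
  have hom: "homeomorphism (fst c) (chart_image c) (snd c) (chart_inv c)" "open (chart_image c)"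
    using c by (auto simp: is_chart_def)
  have "snd c ` V = chart_image c \<inter> chart_inv c -` V"
    using hom(1) V(2) unfolding homeomorphism_def chart_image_def by (force simp: image_iff)
  then show ?thesis
    using hom V(1) unfolding homeomorphism_def by (auto intro!: continuous_open_preimage)
qed

lemma chart_inv_left: "is_chart c \<Longrightarrow> p \<in> fst c \<Longrightarrow> chart_inv c (snd c p) = p"
  by (auto simp: is_chart_def homeomorphism_def)

lemma smooth_on_differentiable:
  assumes "smooth_on f S" "open T" "T \<subseteq> S" "x \<in> T"
  shows "f differentiable (at x)"
proof -
  obtain U g where U: "open U" "S \<subseteq> U" "Cinf g U" "\<forall>x\<in>S. g x = f x"
    using assms(1) unfolding smooth_on_iff by blast
  show ?thesis
    by (rule differentiable_cong_open[OF assms(2,4), of g]) (use U assms Cinf_differentiable[OF U(3)] in auto)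
qed

lemma chart_at_works:
  assumes "smooth_structure A"
  shows "chart_at A p \<in> A" "p \<in> fst (chart_at A p)"
proof -
  have "\<exists>c. c \<in> A \<and> p \<in> fst c" using assms unfolding smooth_structure_def by blast
  then have "chart_at A p \<in> A \<and> p \<in> fst (chart_at A p)"
    unfolding chart_at_def by (rule someI_ex)
  then show "chart_at A p \<in> A" "p \<in> fst (chart_at A p)" by auto
qed

text \<open>\<open>pullback\<close> uses a chart chosen anew at every point, which is useless for
  differentiation. The transformation law of the metric permits any one chart of the atlas
  instead.\<close>

lemma pullback_chart:
  fixes A :: "('a::{t2_space,second_countable_topology}, 'n::finite) chart set" and f :: "'e::euclidean_space \<Rightarrow> 'a"
  assumes A: "smooth_structure A" and h: "riemannian_metric A h" and c: "c \<in> A"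
    and f: "isCont f q" "f q \<in> fst c" and diff: "(snd c \<circ> f) differentiable (at q)"
  shows "pullback A h f q v w = dird v (snd c \<circ> f) q \<bullet> (h c (snd c (f q)) *v dird w (snd c \<circ> f) q)"
proof -
  define d where "d = chart_at A (f q)"
  have d: "d \<in> A" "f q \<in> fst d" unfolding d_def using chart_at_works[OF A] by auto
  have ch: "is_chart c" "is_chart d" using A c d by (auto simp: smooth_structure_def)
  have opn: "open (fst c \<inter> fst d)" using ch by (auto simp: is_chart_def)
  define V where "V = snd c ` (fst c \<inter> fst d)"
  have V: "open V" "snd c (f q) \<in> V" unfolding V_def using chart_open_image[OF ch(1) opn] f d by auto
  have "smooth_on (transition c d) V"
    using A c d unfolding smooth_structure_def compatible_def V_def by blast
  then have td: "transition c d differentiable (at (snd c (f q)))"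
    using smooth_on_differentiable[OF _ V(1) subset_refl V(2)] by blast
  obtain T where T: "open T" "q \<in> T" "\<And>y. y \<in> T \<Longrightarrow> f y \<in> fst c \<inter> fst d"
    using f d opn unfolding continuous_at_open by (metis IntI)
  define J where "J = matrix (frechet_derivative (transition c d) (at (snd c (f q))))"
  have J: "frechet_derivative (transition c d) (at (snd c (f q))) x = J *v x" for x
    unfolding J_def using linear_frechet_derivative[OF td] by (simp add: matrix_works)
  have D: "dird v (snd d \<circ> f) q = J *v dird v (snd c \<circ> f) q" for v
  proof -
    have "dird v (snd d \<circ> f) q = dird v (\<lambda>y. transition c d ((snd c \<circ> f) y)) q"
      by (rule dird_cong_open[OF T(1,2)]) (use T(3) chart_inv_left[OF ch(1)] in \<open>auto simp: transition_def\<close>)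
    also have "\<dots> = J *v dird v (snd c \<circ> f) q"
    proof -
      have "((transition c d) has_derivative (\<lambda>x. J *v x)) (at ((snd c \<circ> f) q))"
        using td J frechet_derivative_works[of "transition c d"] by (simp add: fun_eq_iff[symmetric]) (metis (no_types, lifting) ext)
      from has_derivative_compose[OF dird_has_derivative[OF diff] this] show ?thesis by (rule dird_eqI)
    qed
    finally show ?thesis .
  qed
  have hc: "h c (snd c (f q)) = transpose J ** h d (snd d (f q)) ** J"
    using h c d f unfolding riemannian_metric_def Let_def J_def by blast
  have "pullback A h f q v w = (J *v dird v (snd c \<circ> f) q) \<bullet> (h d (snd d (f q)) *v (J *v dird w (snd c \<circ> f) q))"
    unfolding pullback_def Let_def d_def[symmetric] by (simp add: D[unfolded dird_def] dird_def)
  also have "\<dots> = dird v (snd c \<circ> f) q \<bullet> (transpose J *v (h d (snd d (f q)) *v (J *v dird w (snd c \<circ> f) q)))"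
    by (metis dot_lmul_matrix transpose_matrix_vector transpose_transpose)
  finally show ?thesis by (simp add: hc matrix_vector_mul_assoc matrix_mul_assoc)
qed

lemma sgn_has_derivative:
  fixes x :: "'v::real_inner"
  assumes "x \<noteq> 0"
  shows "(sgn has_derivative (\<lambda>a. (1 / norm x) *\<^sub>R a - ((x \<bullet> a) / norm x ^ 3) *\<^sub>R x)) (at x)"
proof -
  have n: "(norm has_derivative (\<lambda>a. (x \<bullet> a) / norm x)) (at x)"
  proof -
    have "((\<lambda>x::'v. sqrt (x \<bullet> x)) has_derivative (\<lambda>a. (x \<bullet> a) / norm x)) (at x)"
      using assms by (auto intro!: derivative_eq_intros simp: norm_eq_sqrt_inner inner_commute divide_simps)
    then show ?thesis by (simp add: norm_eq_sqrt_inner[abs_def])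
  qed
  have "((\<lambda>x::'v. inverse (norm x) *\<^sub>R x) has_derivative (\<lambda>a. (1 / norm x) *\<^sub>R a - ((x \<bullet> a) / norm x ^ 3) *\<^sub>R x)) (at x)"
    using assms
    by (auto intro!: derivative_eq_intros n simp: fun_eq_iff field_simps power3_eq_cube inner_commute)
  then show ?thesis by (simp add: sgn_div_norm[abs_def])
qed

text \<open>Derivative of \<open>sgn\<close> at \<open>x\<close>: the part of
  \<open>a / norm x\<close> tangential to the sphere.\<close>

definition dsgn :: "'v::real_inner \<Rightarrow> 'v \<Rightarrow> 'v" where
  "dsgn x a = (1 / norm x) *\<^sub>R a - ((x \<bullet> a) / norm x ^ 3) *\<^sub>R x"

lemma dsgn_orth: "x \<noteq> 0 \<Longrightarrow> dsgn x a \<bullet> sgn x = 0"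
  by (simp add: dsgn_def sgn_div_norm inner_diff_left inner_diff_right inner_commute power3_eq_cube dot_square_norm power2_eq_square field_simps)

lemma dsgn_inner: "x \<noteq> 0 \<Longrightarrow> dsgn x a \<bullet> dsgn x b = sph x a b"
  by (simp add: dsgn_def sph_def inner_diff_left inner_diff_right inner_commute power3_eq_cube dot_square_norm power2_eq_square field_simps)

text \<open>A rotation by \<open>\<pi>\<close>; being the square of a quarter turn it has determinant 1.\<close>
lemma half_turn:
  assumes "j \<noteq> j0" "j' \<noteq> j" "j' \<noteq> j0"
  shows "\<exists>S\<in>(SO :: (real^'l::finite^'l) set). \<exists>\<kappa>. S *v (axis j0 1 + s *\<^sub>R axis j 1) = axis j0 1 + s *\<^sub>R axis j 1 \<and>
     S *v axis j 1 = - axis j 1 + \<kappa> *\<^sub>R (axis j0 1 + s *\<^sub>R axis j 1)"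
proof -
  define y b c :: "real^'l" where "y = axis j0 1 + s *\<^sub>R axis j 1" and "b = axis j 1" and "c = axis j' 1"
  \<comment> \<open>\<tau> is a unit vector orthogonal to \<open>y\<close> in the plane of
    \<open>axis j0 1\<close> and \<open>axis j 1\<close>. The map \<open>R\<close> below is the
    quarter turn taking \<tau> to \<open>c\<close> and \<open>c\<close> to - \<tau>; it fixes
    \<open>y\<close>, and its square reverses \<tau> and \<open>c\<close>.\<close>
  define \<tau> where "\<tau> = (1 / sqrt (1 + s\<^sup>2)) *\<^sub>R (b - s *\<^sub>R axis j0 1)"
  define R where "R v = v - (v \<bullet> \<tau>) *\<^sub>R \<tau> - (v \<bullet> c) *\<^sub>R c + (v \<bullet> \<tau>) *\<^sub>R c - (v \<bullet> c) *\<^sub>R \<tau>" for v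
  have s: "1 + s\<^sup>2 > 0" by (simp add: add_pos_nonneg)
  have tt: "\<tau> \<bullet> \<tau> = 1"
    using s assms by (simp add: \<tau>_def b_def inner_diff_left inner_diff_right inner_axis_axis power2_eq_square[symmetric] field_simps)
  have tc: "\<tau> \<bullet> c = 0" "c \<bullet> \<tau> = 0" and cc: "c \<bullet> c = 1"
    using assms by (simp_all add: \<tau>_def b_def c_def inner_diff_left inner_diff_right inner_axis_axis)
  have yt: "y \<bullet> \<tau> = 0" "y \<bullet> c = 0" "b \<bullet> c = 0"
    using assms by (simp_all add: y_def \<tau>_def b_def c_def inner_diff_right inner_add_left inner_axis_axis)
  have lin: "linear R" by (rule linearI) (simp_all add: R_def inner_add_left algebra_simps)
  have "orthogonal_transformation R"
    unfolding orthogonal_transformation_def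
    by (auto simp: lin) (simp add: R_def inner_diff_left inner_diff_right inner_add_left inner_add_right tt tc cc inner_commute algebra_simps)
  then have oR: "orthogonal_matrix (matrix R)"
    using orthogonal_transformation_matrix by blast
  have Rv: "matrix R *v v = R v" for v using lin by (simp add: matrix_works)
  define S where "S = matrix R ** matrix R"
  have "S \<in> SO"
    using det_orthogonal_matrix[OF oR] orthogonal_matrix_mul[OF oR oR] by (auto simp: SO_def S_def det_mul)
  moreover have SR: "S *v v = v - (2 * (v \<bullet> \<tau>)) *\<^sub>R \<tau> - (2 * (v \<bullet> c)) *\<^sub>R c" for v
  proof -
    have "R v \<bullet> \<tau> = - (v \<bullet> c)" "R v \<bullet> c = v \<bullet> \<tau>"
      by (simp_all add: R_def inner_diff_left inner_add_left tt tc cc)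
    then have "R (R v) = R v + (v \<bullet> c) *\<^sub>R \<tau> - (v \<bullet> \<tau>) *\<^sub>R c - (v \<bullet> c) *\<^sub>R c - (v \<bullet> \<tau>) *\<^sub>R \<tau>"
      unfolding R_def[of "R v"] by simp
    then show ?thesis
      unfolding S_def matrix_vector_mul_assoc[symmetric] Rv by (simp add: R_def vec_eq_iff algebra_simps)
  qed
  moreover have "S *v y = y" by (simp add: SR yt)
  moreover have "S *v b = - b + (2 * s / (1 + s\<^sup>2)) *\<^sub>R y"
  proof -
    have bt: "b \<bullet> \<tau> = 1 / sqrt (1 + s\<^sup>2)"
      using assms by (simp add: \<tau>_def b_def inner_diff_right inner_axis_axis)
    have "(2 * (b \<bullet> \<tau>)) *\<^sub>R \<tau> = (2 / (1 + s\<^sup>2)) *\<^sub>R (b - s *\<^sub>R axis j0 1)"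
      unfolding bt using s by (simp add: \<tau>_def)
    moreover have "b - (2 / (1 + s\<^sup>2)) *\<^sub>R (b - s *\<^sub>R axis j0 1) = - b + (2 * s / (1 + s\<^sup>2)) *\<^sub>R y"
      using s by (simp add: y_def vec_eq_iff b_def[symmetric] divide_simps) (simp add: algebra_simps power2_eq_square)
    ultimately show ?thesis by (simp add: SR yt)
  qed
  ultimately show ?thesis unfolding y_def b_def by blast
qed

section \<open>The flow in polar coordinates\<close>

text \<open>Makes derivatives within \<open>{..b}\<close> unique up to and including the final time,
  where they are one-sided.\<close>

lemma at_within_Iic_neq_bot:
  assumes "T \<le> (b::real)" shows "at T within {..b} \<noteq> bot"
proof -
  have "at T within {..<T} \<le> at T within {..b}" using assms by (intro at_le) auto
  then show ?thesis using trivial_limit_at_left_real[of T] bot_unique by metis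
qed

lemma dird_slice_snd:
  assumes "f differentiable (at (t, q))"
  shows "dird v (\<lambda>q. f (t, q)) q = dird (0, v) f (t, q)"
proof -
  have "((\<lambda>q. (t, q)) has_derivative (\<lambda>v. (0, v))) (at q)"
    by (auto intro!: derivative_eq_intros)
  from has_derivative_compose[OF this dird_has_derivative[OF assms]] show ?thesis by (rule dird_eqI)
qed

lemma has_vector_derivative_slice_fst:
  assumes "f differentiable (at (t, q))"
  shows "((\<lambda>s. f (s, q)) has_vector_derivative dird (1, 0) f (t, q)) (at t within S)"
  using dird_line[of f "(0, q)" t "(1, 0)" S] assms by (simp add: zero_prod_def)

lemma has_vector_derivative_slice_snd:
  fixes f :: "'e::euclidean_space \<times> real \<Rightarrow> 'b::real_normed_vector"
  assumes "f differentiable (at (q, t))"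
  shows "((\<lambda>s. f (q, s)) has_vector_derivative dird (0, 1) f (q, t)) (at t within S)"
  using dird_line[of f "(q, 0)" t "(0, 1)" S] assms by (simp add: zero_prod_def)

lemma Cinf_slice_snd:
  fixes f :: "'d::euclidean_space \<times> 'e::euclidean_space \<Rightarrow> 'b::real_normed_vector"
  assumes "open U" "Cinf f U"
  shows "Cinf (\<lambda>q. f (t, q)) {q. (t, q) \<in> U}" "open {q. (t, q) \<in> U}"
  using Cinf_affine(1,3)[OF assms, where L = "\<lambda>q. (0, q)" and c = "(t, 0)"]
  by (auto simp: Basis_prod_def linear_iff)

lemma SO_norm: "S \<in> SO \<Longrightarrow> norm (S *v v) = norm v"
  using orthogonal_transformation_norm[of "(*v) S" v]
  by (simp add: SO_def orthogonal_transformation_matrix)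

lemma SO_sgn: "S \<in> SO \<Longrightarrow> sgn (S *v v) = S *v sgn v"
  by (simp add: sgn_div_norm SO_norm matrix_vector_mult_scaleR)

lemma sgn_sgn_vector: "sgn (sgn x) = sgn (x :: 'v::real_normed_vector)"
  by (cases "x = 0") (simp_all add: sgn_div_norm[of "sgn x"] norm_sgn)

lemma Basis_prodI: "(1::real, 0::'b::euclidean_space) \<in> Basis" "(0::'b, 1::real) \<in> Basis"
    "b \<in> Basis \<Longrightarrow> (0::'c::euclidean_space, b) \<in> Basis"
  by (auto simp: Basis_prod_def image_iff)

lemma dist_Pair_le: "dist (a, b) (c, d) \<le> dist a c + dist b d"
  using dist_Pair_Pair[of a b c d] real_sqrt_sum_squares_triangle_ineq[of "dist a c" 0 0 "dist b d"] by simp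

lemma isCont_locally_bounded:
  fixes f :: "real \<times> real \<Rightarrow> real"
  assumes "isCont f (z0, t0)"
  shows "\<exists>\<epsilon>>0. \<exists>C. \<forall>z t. \<bar>t - t0\<bar> < \<epsilon> \<longrightarrow> \<bar>z - z0\<bar> < \<epsilon> \<longrightarrow> \<bar>f (z, t)\<bar> \<le> C"
proof -
  obtain d where d: "d > 0" "\<And>p. dist p (z0, t0) < d \<Longrightarrow> dist (f p) (f (z0, t0)) < 1"
    using assms unfolding continuous_at_eps_delta by (metis zero_less_one)
  have "\<bar>f (z, t)\<bar> \<le> \<bar>f (z0, t0)\<bar> + 1" if "\<bar>t - t0\<bar> < d/2" "\<bar>z - z0\<bar> < d/2" for z t
    using d(2)[of "(z, t)"] dist_Pair_le[of z t z0 t0] that by (auto simp: dist_real_def)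
  then show ?thesis using d(1) by (intro exI[of _ "d/2"]) auto
qed

lemma ex_not_in:
  fixes S :: "'i::finite set"
  assumes "card S < CARD('i)" shows "\<exists>x. x \<notin> S"
  using assms by (metis UNIV_eq_I less_irrefl)

lemma mat_1_SO: "mat 1 \<in> SO"
  by (simp add: SO_def orthogonal_matrix_id)

lemma open_punctured_slab: "open ({a<..<b::real} \<times> (- {0::'v::{t1_space,zero}}) \<times> (- {0::'w::{t1_space,zero}}))"
  by (intro open_Times open_greaterThanLessThan open_Compl closed_singleton)

text \<open>\<open>Fx\<close> and \<open>Gx\<close> are smooth extensions of the profile functions
  to one open set \<open>UF\<close>; they carry meaning only for nonpositive times and inside the
  interval. The locale collects interior information; the singular orbits are added later.\<close>

locale oval =
  fixes A :: "('a::{t2_space,second_countable_topology}, 'n::finite) chart set"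
    and g :: "('a, 'n) flow"
    and \<rho> :: "real^'k::finite^'k \<Rightarrow> real^'l::finite^'l \<Rightarrow> 'a \<Rightarrow> 'a"
    and zmax :: "real \<Rightarrow> real" and F G :: "real \<Rightarrow> real \<Rightarrow> real"
    and P :: "real \<Rightarrow> real \<Rightarrow> real^'k \<Rightarrow> real^'l \<Rightarrow> 'a"
    and Fx Gx :: "real \<times> real \<Rightarrow> real" and UF :: "(real \<times> real) set"
  assumes rf: "ancient_ricci_flow A g" and sym: "so_symmetric A g \<rho>"
    and pol: "polar_coordinates A g \<rho> zmax F G P"
    and curv: "t \<le> 0 \<Longrightarrow> at_point A (g t) curv_op_nonneg p"
    and zmax: "continuous_on {..0} zmax"
    and pos: "t \<le> 0 \<Longrightarrow> 0 < z \<Longrightarrow> z < zmax t \<Longrightarrow> F z t > 0 \<and> G z t > 0"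
    and ext: "open UF" "Cinf Fx UF" "Cinf Gx UF"
      "t \<le> 0 \<Longrightarrow> 0 < z \<Longrightarrow> z < zmax t \<Longrightarrow> (z, t) \<in> UF \<and> Fx (z, t) = F z t \<and> Gx (z, t) = G z t"
    and dims: "CARD('n) = CARD('k) + CARD('l) - 1" "2 \<le> CARD('k)" "3 \<le> CARD('l)"
begin

fun pmap where "pmap t (z, x, y) = P t z (sgn x) (sgn y)"

definition slab :: "real \<Rightarrow> (real \<times> (real^'k) \<times> (real^'l)) set" where
  "slab t = {(z, x, y). 0 < z \<and> z < zmax t \<and> x \<noteq> 0 \<and> y \<noteq> 0}"

definition Nc :: "('a, 'n) chart \<Rightarrow> real \<Rightarrow> (real \<times> (real^'k) \<times> (real^'l)) set" where
  "Nc c t = slab t \<inter> pmap t -` fst c"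

lemma smooth_structure_A: "smooth_structure A" using rf by (simp add: ancient_ricci_flow_def)

lemma riemannian_g: "t \<le> 0 \<Longrightarrow> riemannian_metric A (g t)" using rf by (simp add: ancient_ricci_flow_def)

lemma chart: "c \<in> A \<Longrightarrow> is_chart c" using smooth_structure_A by (simp add: smooth_structure_def)

lemma smooth_P: "smooth_into A (\<lambda>(t, q). pmap t q) ({(t, q). t \<le> 0 \<and> q \<in> slab t})"
proof -
  have "(\<lambda>(t, q). pmap t q) = (\<lambda>(t, z, x, y). P t z (sgn x) (sgn y))" by auto
  moreover have "{(t, q). t \<le> 0 \<and> q \<in> slab t} = {(t, z, x, y). t \<le> 0 \<and> 0 < z \<and> z < zmax t \<and> x \<noteq> 0 \<and> y \<noteq> 0}"
    by (auto simp: slab_def)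
  ultimately show ?thesis using pol unfolding polar_coordinates_def by simp
qed

lemmas pol' = pol[unfolded polar_coordinates_def, THEN conjunct2, THEN spec, THEN mp]

lemma pol_pullback:
  assumes "t \<le> 0" "z \<in> {0<..<zmax t}" "x \<in> sphere 0 1" "y \<in> sphere 0 1"
    "a \<bullet> x = 0" "a' \<bullet> x = 0" "b \<bullet> y = 0" "b' \<bullet> y = 0"
  shows "pullback A (g t) (pmap t) (z, x, y) (\<zeta>, a, b) (\<zeta>', a', b') = \<zeta> * \<zeta>' + (F z t)\<^sup>2 * (a \<bullet> a') + (G z t)\<^sup>2 * (b \<bullet> b')"
proof -
  have eq: "(\<lambda>(z, x, y). P t z (sgn x) (sgn y)) = pmap t" by auto
  show ?thesis
    using pol'[OF assms(1), THEN conjunct2, THEN conjunct2, THEN conjunct1, rule_format, OF assms(2-4)] assms(5-)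
    unfolding eq by blast
qed

lemma pol_equivariant:
  assumes "t \<le> 0" "z \<in> {0..zmax t}" "x \<in> sphere 0 1" "y \<in> sphere 0 1" "R \<in> SO" "S \<in> SO"
  shows "\<rho> R S (P t z x y) = P t z (R *v x) (S *v y)"
  using pol'[OF assms(1), THEN conjunct2, THEN conjunct1, rule_format, OF assms(2-)] .

lemma open_slab: "open (slab t)"
proof -
  have "slab t = {0<..<zmax t} \<times> (- {0}) \<times> (- {0})" by (auto simp: slab_def)
  then show ?thesis by (simp only: open_punctured_slab)
qed

lemma continuous_pmap: "t \<le> 0 \<Longrightarrow> continuous_on (slab t) (pmap t)"
proof -
  assume t: "t \<le> 0"
  have 1: "continuous_on ((\<lambda>q. (t, q)) ` slab t) (\<lambda>(t, q). pmap t q)"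
    using smooth_P t unfolding smooth_into_def by (auto intro: continuous_on_subset)
  have 2: "continuous_on (slab t) (\<lambda>q. (t, q))" by (intro continuous_intros)
  show ?thesis using continuous_on_compose[OF 2 1] by (simp add: o_def)
qed

lemma isCont_pmap: "t \<le> 0 \<Longrightarrow> q \<in> slab t \<Longrightarrow> isCont (pmap t) q"
  using continuous_pmap open_slab continuous_on_eq_continuous_at by blast

lemma open_Nc: "c \<in> A \<Longrightarrow> t \<le> 0 \<Longrightarrow> open (Nc c t)"
  unfolding Nc_def using chart
  by (intro continuous_open_preimage continuous_pmap open_slab) (auto simp: is_chart_def)

text \<open>Time derivatives at fixed parameters require that these stay in the moving domain
  \<open>Nc c t\<close> for nearby times; the neighbourhood found here is uniform in
  \<open>t\<close>.\<close>

lemma near_Nc: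
  assumes c: "c \<in> A" and t0: "t0 \<le> 0" and q0: "q0 \<in> Nc c t0"
  shows "\<exists>\<epsilon>>0. \<forall>t\<le>0. \<bar>t - t0\<bar> < \<epsilon> \<longrightarrow> (\<forall>q. dist q q0 < \<epsilon> \<longrightarrow> q \<in> Nc c t)"
proof -
  define S where "S = {(t, q). t \<le> 0 \<and> q \<in> slab t}"
  have "continuous_on S (\<lambda>(t, q). pmap t q)" using smooth_P by (simp add: S_def smooth_into_def)
  moreover have "open (fst c)" using chart[OF c] by (simp add: is_chart_def)
  ultimately obtain T where T: "open T" "T \<inter> S = (\<lambda>(t, q). pmap t q) -` fst c \<inter> S"
    unfolding continuous_on_open_invariant by metis
  have "(t0, q0) \<in> T" using T(2) q0 t0 by (auto simp: S_def Nc_def)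
  then obtain e1 where e1: "e1 > 0" "ball (t0, q0) e1 \<subseteq> T" using T(1) openE by blast
  obtain z0 x0 y0 where q0': "q0 = (z0, x0, y0)" by (cases q0)
  then have z0: "0 < z0" "z0 < zmax t0" using q0 by (auto simp: Nc_def slab_def)
  \<comment> \<open>A level strictly above \<open>z0\<close> that stays below \<open>zmax t\<close>
    for \<open>t\<close> near \<open>t0\<close>, by continuity of \<open>zmax\<close>.\<close>
  define m where "m = (z0 + zmax t0) / 2"
  have m: "z0 < m" "m < zmax t0" using z0 by (auto simp: m_def)
  obtain e2 where e2: "e2 > 0" "\<And>t. t \<le> 0 \<Longrightarrow> \<bar>t - t0\<bar> < e2 \<Longrightarrow> m < zmax t"
  proof -
    obtain d where "d > 0" "\<forall>t\<in>{..0}. dist t t0 < d \<longrightarrow> dist (zmax t) (zmax t0) < zmax t0 - m"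
      using zmax m t0 unfolding continuous_on_iff by (metis atMost_iff diff_gt_0_iff_gt)
    then show ?thesis using that[of d] by (auto simp: dist_real_def abs_less_iff)
  qed
  define V :: "(real \<times> (real^'k) \<times> (real^'l)) set" where "V = {0<..<m} \<times> (- {0}) \<times> (- {0})"
  have "open V" "q0 \<in> V" using q0 z0 m open_punctured_slab by (auto simp: V_def q0' Nc_def slab_def)
  then obtain e3 where e3: "e3 > 0" "ball q0 e3 \<subseteq> V" using openE by blast
  define e where "e = min (e1/2) (min e2 e3)"
  have "q \<in> Nc c t" if t: "t \<le> 0" "\<bar>t - t0\<bar> < e" "dist q q0 < e" for t q
  proof -
    have "q \<in> V" using e3 that by (auto simp: e_def dist_commute)
    then have "q \<in> slab t" using e2(2)[of t] that by (auto simp: V_def slab_def e_def)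
    moreover have "dist (t, q) (t0, q0) < e1"
      using dist_Pair_le[of t q t0 q0] that by (auto simp: e_def dist_real_def)
    then have "(t, q) \<in> T" using e1 by (auto simp: dist_commute)
    ultimately have "(t, q) \<in> T \<inter> S" using t by (auto simp: S_def)
    then have "pmap t q \<in> fst c" using T(2) by auto
    then show ?thesis using \<open>q \<in> slab t\<close> by (simp add: Nc_def)
  qed
  moreover have "e > 0" using e1 e2 e3 by (simp add: e_def)
  ultimately show ?thesis by blast
qed

lemma coord_metric_chart:
  assumes "c \<in> A" "t \<le> 0" shows "coord_metric (g t c) (chart_image c)"
proof
  show op: "open (chart_image c)" using chart[OF assms(1)] by (simp add: is_chart_def)
  obtain O1 h where "open O1" "chart_image c \<subseteq> O1" "Cinf h O1" "\<forall>x\<in>chart_image c. h x = g t c x"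
    using riemannian_g[OF assms(2)] assms(1) unfolding riemannian_metric_def smooth_on_iff by meson
  then show "Cinf (g t c) (chart_image c)"
    using Cinf_cong[OF op, of h] Cinf_subset by blast
qed (use riemannian_g[OF assms(2)] assms(1) in \<open>auto simp: riemannian_metric_def\<close>)

abbreviation "Fz \<equiv> dird (1, 0) Fx"
abbreviation "Fzz \<equiv> dird (1, 0) Fz"
abbreviation "Gz \<equiv> dird (1, 0) Gx"
abbreviation "Gzz \<equiv> dird (1, 0) Gz"
abbreviation "Gt \<equiv> dird (0, 1) Gx"

lemma dz: "(z, t) \<in> UF \<Longrightarrow> ((\<lambda>z. Fx (z, t)) has_real_derivative Fz (z, t)) (at z within S)"
  "(z, t) \<in> UF \<Longrightarrow> ((\<lambda>z. Gx (z, t)) has_real_derivative Gz (z, t)) (at z within S)"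
  "(z, t) \<in> UF \<Longrightarrow> ((\<lambda>z. Fz (z, t)) has_real_derivative Fzz (z, t)) (at z within S)"
  "(z, t) \<in> UF \<Longrightarrow> ((\<lambda>z. Gz (z, t)) has_real_derivative Gzz (z, t)) (at z within S)"
  unfolding has_real_derivative_iff_has_vector_derivative
  by (intro has_vector_derivative_slice_fst Cinf_differentiable[of _ UF] Cinf_dird ext; simp add: Basis_prodI)+

end

text \<open>\<open>v\<close> and \<open>gx\<close> extend the polar map and the metric, both read in
  the fixed chart \<open>c\<close>, to open sets of space-time. This makes Schwarz's theorem in time
  and space available at time 0 too.\<close>

locale oval_chart = oval A g \<rho> zmax F G P Fx Gx UF
  for A :: "('a::{t2_space,second_countable_topology}, 'n::finite) chart set"
    and g \<rho> zmax F G and P :: "real \<Rightarrow> real \<Rightarrow> real^'k::finite \<Rightarrow> real^'l::finite \<Rightarrow> 'a" and Fx Gx UF +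
  fixes c :: "('a, 'n) chart" and U :: "(real \<times> real \<times> (real^'k) \<times> (real^'l)) set" and v
    and O1 :: "(real \<times> (real^'n)) set" and gx and i0 :: 'k and j0 :: 'l
  assumes c: "c \<in> A" and U: "open U" "Cinf v U"
    and v: "t \<le> 0 \<Longrightarrow> q \<in> Nc c t \<Longrightarrow> (t, q) \<in> U \<and> v (t, q) = snd c (pmap t q)"
    and O1: "open O1" "Cinf gx O1"
    and gx: "t \<le> 0 \<Longrightarrow> x \<in> chart_image c \<Longrightarrow> (t, x) \<in> O1 \<and> gx (t, x) = g t c x"
begin

lemma v_diff: "t \<le> 0 \<Longrightarrow> q \<in> Nc c t \<Longrightarrow> v differentiable (at (t, q))"
  using v U Cinf_differentiable by blast

lemma Cinf_v: "t \<le> 0 \<Longrightarrow> Cinf (\<lambda>q. v (t, q)) (Nc c t)"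
  using Cinf_subset[OF Cinf_slice_snd(1)[OF U, of t]] v by blast

lemma v_slice: "t \<le> 0 \<Longrightarrow> q \<in> Nc c t \<Longrightarrow> dird a (\<lambda>q. v (t, q)) q = dird (0, a) v (t, q)"
  by (rule dird_slice_snd[OF v_diff])

lemma metric_unit:
  assumes t: "t \<le> 0" and q: "(z, x, y) \<in> Nc c t" and n: "norm x = 1" "norm y = 1"
    and orth: "a \<bullet> x = 0" "a' \<bullet> x = 0" "b \<bullet> y = 0" "b' \<bullet> y = 0"
  shows "dird (\<zeta>, a, b) (\<lambda>q. v (t, q)) (z, x, y) \<bullet> (g t c (v (t, z, x, y)) *v dird (\<zeta>', a', b') (\<lambda>q. v (t, q)) (z, x, y))
    = \<zeta> * \<zeta>' + (F z t)\<^sup>2 * (a \<bullet> a') + (G z t)\<^sup>2 * (b \<bullet> b')"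
proof -
  have z: "z \<in> {0<..<zmax t}" and inc: "pmap t (z, x, y) \<in> fst c" and sl: "(z, x, y) \<in> slab t"
    using q by (auto simp: Nc_def slab_def)
  have e: "v (t, q) = (snd c \<circ> pmap t) q" if "q \<in> Nc c t" for q using v[OF t that] by simp
  have diff: "(snd c \<circ> pmap t) differentiable (at (z, x, y))"
    by (rule differentiable_cong_open[OF open_Nc[OF c t] q, of "\<lambda>q. v (t, q)"])
       (use e Cinf_differentiable[OF Cinf_v[OF t] q] in auto)
  have "pullback A (g t) (pmap t) (z, x, y) (\<zeta>, a, b) (\<zeta>', a', b') = \<zeta> * \<zeta>' + (F z t)\<^sup>2 * (a \<bullet> a') + (G z t)\<^sup>2 * (b \<bullet> b')"
    using pol_pullback[OF t z, of x y a a' b b' \<zeta> \<zeta>'] n orth by simp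
  moreover have "dird w (\<lambda>q. v (t, q)) (z, x, y) = dird w (snd c \<circ> pmap t) (z, x, y)" for w
    using e by (intro dird_cong_open[OF open_Nc[OF c t] q]) auto
  ultimately show ?thesis
    using pullback_chart[OF smooth_structure_A riemannian_g[OF t] c isCont_pmap[OF t sl] inc diff] v[OF t q] by simp
qed

text \<open>The polar form is given at unit vectors and tangential directions only. Since
  \<open>pmap\<close> factors through \<open>sgn\<close>, the chain rule replaces \<open>a\<close>
  by \<open>dsgn x a\<close>, and inner products of these are \<open>sph\<close>.\<close>

lemma metric_Nc:
  assumes t: "t \<le> 0" and q: "(z, x, y) \<in> Nc c t"
  shows "dird (\<zeta>, a, b) (\<lambda>q. v (t, q)) (z, x, y) \<bullet> (g t c (v (t, z, x, y)) *v dird (\<zeta>', a', b') (\<lambda>q. v (t, q)) (z, x, y))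
    = \<zeta> * \<zeta>' + (F z t)\<^sup>2 * sph x a a' + (G z t)\<^sup>2 * sph y b b'"
proof -
  define \<sigma> :: "real \<times> (real^'k) \<times> (real^'l) \<Rightarrow> real \<times> (real^'k) \<times> (real^'l)" where "\<sigma> = (\<lambda>q. (fst q, sgn (fst (snd q)), sgn (snd (snd q))))"
  have xy: "x \<noteq> 0" "y \<noteq> 0" using q by (auto simp: Nc_def slab_def)
  have \<sigma>N: "\<sigma> q \<in> Nc c t \<and> v (t, \<sigma> q) = v (t, q)" if "q \<in> Nc c t" for q
  proof -
    have eq: "pmap t (\<sigma> q) = pmap t q" by (cases q) (simp add: \<sigma>_def sgn_sgn_vector)
    then have 1: "\<sigma> q \<in> Nc c t" using that by (auto simp: Nc_def slab_def \<sigma>_def sgn_zero_iff)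
    moreover note eq
    ultimately show ?thesis using v[OF t that] v[OF t 1] by simp
  qed
  have \<sigma>q: "\<sigma> (z, x, y) = (z, sgn x, sgn y)" by (simp add: \<sigma>_def)
  have sx: "((\<lambda>q::real \<times> (real^'k) \<times> (real^'l). sgn (fst (snd q))) has_derivative (\<lambda>w. dsgn x (fst (snd w)))) (at (z, x, y))"
    by (rule has_derivative_compose[of "\<lambda>q. fst (snd q)" "\<lambda>q. fst (snd q)" _ _ sgn "dsgn x"])
       (use sgn_has_derivative[OF xy(1)] in \<open>auto intro!: derivative_eq_intros simp: dsgn_def[abs_def]\<close>)
  have sy: "((\<lambda>q::real \<times> (real^'k) \<times> (real^'l). sgn (snd (snd q))) has_derivative (\<lambda>w. dsgn y (snd (snd w)))) (at (z, x, y))"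
    by (rule has_derivative_compose[of "\<lambda>q. snd (snd q)" "\<lambda>q. snd (snd q)" _ _ sgn "dsgn y"])
       (use sgn_has_derivative[OF xy(2)] in \<open>auto intro!: derivative_eq_intros simp: dsgn_def[abs_def]\<close>)
  have d\<sigma>: "(\<sigma> has_derivative (\<lambda>w. (fst w, dsgn x (fst (snd w)), dsgn y (snd (snd w))))) (at (z, x, y))"
    unfolding \<sigma>_def by (intro has_derivative_Pair sx sy) (auto intro!: derivative_eq_intros)
  have D: "dird w (\<lambda>q. v (t, q)) (z, x, y) = dird (fst w, dsgn x (fst (snd w)), dsgn y (snd (snd w))) (\<lambda>q. v (t, q)) (z, sgn x, sgn y)" for w
  proof -
    have "(\<lambda>q. v (t, q)) differentiable (at (\<sigma> (z, x, y)))"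
      using Cinf_differentiable[OF Cinf_v[OF t]] \<sigma>N[OF q] by blast
    from has_derivative_compose[OF d\<sigma> dird_has_derivative[OF this]]
    have "dird w (\<lambda>q. v (t, \<sigma> q)) (z, x, y) = dird (fst w, dsgn x (fst (snd w)), dsgn y (snd (snd w))) (\<lambda>q. v (t, q)) (\<sigma> (z, x, y))"
      by (rule dird_eqI)
    moreover have "dird w (\<lambda>q. v (t, \<sigma> q)) (z, x, y) = dird w (\<lambda>q. v (t, q)) (z, x, y)"
      using \<sigma>N by (intro dird_cong_open[OF open_Nc[OF c t] q]) auto
    ultimately show ?thesis by (simp add: \<sigma>q)
  qed
  show ?thesis
    unfolding D using metric_unit[OF t, of z "sgn x" "sgn y"] \<sigma>N[OF q] xy
    by (simp add: \<sigma>q norm_sgn dsgn_orth dsgn_inner)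
qed

lemma warped_chart:
  assumes t: "t \<le> 0" and q: "(z, axis i0 1, axis j0 1) \<in> Nc c t"
  shows "warped (g t c) (chart_image c) (\<lambda>q. v (t, q)) (Nc c t)
     (\<lambda>z. Fx (z, t)) (\<lambda>z. Fz (z, t)) (\<lambda>z. Fzz (z, t))
     (\<lambda>z. Gx (z, t)) (\<lambda>z. Gz (z, t)) (\<lambda>z. Gzz (z, t)) i0 j0 z"
proof -
  interpret coord_metric "g t c" "chart_image c" by (rule coord_metric_chart[OF c t])
  show ?thesis
  proof
    show "open (Nc c t)" by (rule open_Nc[OF c t])
    show "Cinf (\<lambda>q. v (t, q)) (Nc c t)" by (rule Cinf_v[OF t])
    show "v (t, q) \<in> chart_image c" if "q \<in> Nc c t" for q
      using v[OF t that] that by (auto simp: chart_image_def Nc_def)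
    fix z x y assume N: "(z, x, y) \<in> Nc c t"
    then have z: "0 < z" "z < zmax t" by (auto simp: Nc_def slab_def)
    show "x \<noteq> 0 \<and> y \<noteq> 0" using N by (auto simp: Nc_def slab_def)
    show "0 < Fx (z, t) \<and> ((\<lambda>z. Fx (z, t)) has_real_derivative Fz (z, t)) (at z) \<and>
       ((\<lambda>z. Fz (z, t)) has_real_derivative Fzz (z, t)) (at z)"
      using dz ext(4)[OF t z] pos[OF t z] by simp
    show "0 < Gx (z, t) \<and> ((\<lambda>z. Gx (z, t)) has_real_derivative Gz (z, t)) (at z) \<and>
       ((\<lambda>z. Gz (z, t)) has_real_derivative Gzz (z, t)) (at z)"
      using dz ext(4)[OF t z] pos[OF t z] by simp
    show "dird (\<zeta>, a, b) (\<lambda>q. v (t, q)) (z, x, y) \<bullet> (g t c (v (t, z, x, y)) *v dird (\<zeta>', a', b') (\<lambda>q. v (t, q)) (z, x, y))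
      = \<zeta> * \<zeta>' + (Fx (z, t))\<^sup>2 * sph x a a' + (Gx (z, t))\<^sup>2 * sph y b b'" for \<zeta> a b \<zeta>' a' b'
      using metric_Nc[OF t N] ext(4)[OF t z] by simp
  qed (use q dims in auto)
qed

text \<open>Velocity, in the chart, of the point with fixed parameters \<open>q\<close>.\<close>

definition W where "W t q = dird (1, 0) v (t, q)"

lemma time_derivative_v: "t \<le> 0 \<Longrightarrow> q \<in> Nc c t \<Longrightarrow> ((\<lambda>s. v (s, q)) has_vector_derivative W t q) (at t within S)"
  unfolding W_def by (intro has_vector_derivative_slice_fst v_diff)

lemma W_diff: "t \<le> 0 \<Longrightarrow> q \<in> Nc c t \<Longrightarrow> W t differentiable (at q)"
proof -
  assume t: "t \<le> 0" and q: "q \<in> Nc c t"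
  have "Cinf (dird (1, 0) v) U" by (intro Cinf_dird U Basis_prodI)
  from Cinf_slice_snd(1)[OF U(1) this, of t] show ?thesis
    unfolding W_def[abs_def] using v[OF t q] Cinf_differentiable by blast
qed

lemma time_derivative_dird:
  assumes t: "t \<le> 0" and q: "q \<in> Nc c t" and a: "a \<in> Basis"
  shows "((\<lambda>s. dird (0, a) v (s, q)) has_vector_derivative dird a (W t) q) (at t within S)"
proof -
  have B: "(1::real, 0::real \<times> (real^'k) \<times> (real^'l)) \<in> Basis" "(0::real, a) \<in> Basis" using a by (auto intro: Basis_prodI)
  have tq: "(t, q) \<in> U" using v[OF t q] by simp
  have "((\<lambda>s. dird (0, a) v (s, q)) has_vector_derivative dird (1, 0) (dird (0, a) v) (t, q)) (at t within S)"
    by (intro has_vector_derivative_slice_fst Cinf_differentiable[OF Cinf_dird[OF U(2) B(2)] tq])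
  also have "dird (1, 0) (dird (0, a) v) (t, q) = dird (0, a) (dird (1, 0) v) (t, q)"
    by (rule dird_commute[OF U(1) tq U(2) B])
  also have "\<dots> = dird a (W t) q"
    unfolding W_def[abs_def]
    by (rule dird_slice_snd[symmetric], rule Cinf_differentiable[OF Cinf_dird[OF U(2) B(1)] tq])
  finally show ?thesis .
qed

text \<open>The total derivative splits into change of the metric at a fixed point and transport by
  \<open>W\<close>. At time 0 the Ricci flow equation is one-sided, but it still determines the time
  derivative of the extension \<open>gx\<close>.\<close>

lemma time_derivative_g:
  assumes t: "t \<le> 0" and q: "q \<in> Nc c t"
  shows "((\<lambda>s. gx (s, v (s, q))) has_vector_derivative (- 2) *\<^sub>R ricci (g t c) (v (t, q)) + dird (W t q) (g t c) (v (t, q))) (at t within {..0})"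
proof -
  define p where "p = v (t, q)"
  have p: "p \<in> chart_image c" using v[OF t q] q by (auto simp: chart_image_def Nc_def p_def)
  have gd: "gx differentiable (at (t, p))" using gx[OF t p] O1 Cinf_differentiable by blast
  have lin: "linear (\<lambda>v. dird v gx (t, p))" unfolding dird_def using linear_frechet_derivative[OF gd] by simp
  have op: "open (chart_image c)" using chart[OF c] by (simp add: is_chart_def)
  have 1: "((\<lambda>s. (s, v (s, q))) has_derivative (\<lambda>r. r *\<^sub>R (1, W t q))) (at t within {..0})"
    using has_derivative_Pair[OF has_derivative_ident time_derivative_v[OF t q, unfolded has_vector_derivative_def]] by simp
  have "((\<lambda>s. gx (s, v (s, q))) has_derivative (\<lambda>r. dird (r *\<^sub>R (1, W t q)) gx (t, p))) (at t within {..0})"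
    using has_derivative_compose[OF 1 dird_has_derivative[OF gd[unfolded p_def]]] by (simp add: p_def)
  then have "((\<lambda>s. gx (s, v (s, q))) has_vector_derivative dird (1, W t q) gx (t, p)) (at t within {..0})"
    unfolding has_vector_derivative_def linear_scale[OF lin] .
  moreover have "dird (1, W t q) gx (t, p) = dird (1, 0) gx (t, p) + dird (0, W t q) gx (t, p)"
    using linear_add[OF lin, of "(1, 0)" "(0, W t q)"] by simp
  moreover have "dird (0, W t q) gx (t, p) = dird (W t q) (g t c) p"
    unfolding dird_slice_snd[OF gd, symmetric] using gx[OF t] by (intro dird_cong_open[OF op p]) auto
  moreover have "dird (1, 0) gx (t, p) = (- 2) *\<^sub>R ricci (g t c) p"
  proof (rule vector_derivative_unique_within[OF at_within_Iic_neq_bot[OF t]])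
    have "((\<lambda>s. gx (s, p)) has_vector_derivative dird (1, 0) gx (t, p)) (at t within {..0})"
      by (rule has_vector_derivative_slice_fst[OF gd])
    then show "((\<lambda>s. g s c p) has_vector_derivative dird (1, 0) gx (t, p)) (at t within {..0})"
      by (rule has_vector_derivative_transform[rotated 2]) (use t gx[OF _ p] in auto)
    show "((\<lambda>s. g s c p) has_vector_derivative (- 2) *\<^sub>R ricci (g t c) p) (at t within {..0})"
      using rf t c p unfolding ancient_ricci_flow_def by blast
  qed
  ultimately show ?thesis by (simp add: p_def)
qed

end

section \<open>Evolution equations for the profile functions in one chart\<close>

context oval_chart
begin

abbreviation base :: "real \<Rightarrow> real \<times> (real^'k) \<times> (real^'l)" where
  "base z \<equiv> (z, axis i0 1, axis j0 1)"

lemma near_Nc_time: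
  assumes "t \<le> 0" "q \<in> Nc c t"
  obtains \<epsilon> where "\<epsilon> > 0" "\<And>s. s \<le> 0 \<Longrightarrow> dist s t < \<epsilon> \<Longrightarrow> q \<in> Nc c s"
  using near_Nc[OF c assms] by (metis dist_real_def dist_self)

text \<open>The half turn induces an isometry that fixes the point and the velocity but reverses the
  direction \<open>axis j 1\<close> up to a radial part.\<close>
lemma velocity_orth:
  assumes t: "t \<le> 0" and j: "j \<noteq> j0" and q: "q \<in> Nc c t"
    and qe: "q = (z, x, axis j0 1 + s *\<^sub>R axis j 1)"
  shows "W t q \<bullet> (g t c (v (t, q)) *v dird (0, 0, axis j 1) (\<lambda>q. v (t, q)) q) = 0"
proof -
  define b y :: "real^'l" where "b = axis j 1" and "y = axis j0 1 + s *\<^sub>R axis j 1"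
  \<comment> \<open>A third index provides the second direction that a half turn of determinant 1
    has to reverse.\<close>
  have "card {j, j0} < CARD('l)" using dims(3) by (simp add: card_insert_if)
  then obtain j' where "j' \<noteq> j" "j' \<noteq> j0" using ex_not_in by blast
  then obtain S \<kappa> where S: "S \<in> SO" "S *v y = y" "S *v b = - b + \<kappa> *\<^sub>R y"
    using half_turn[OF j, of _ s] unfolding b_def y_def by blast
  define \<phi> where "\<phi> = \<rho> (mat 1) S"
  have \<phi>: "\<phi> (pmap r (z', x', y')) = pmap r (z', x', S *v y')" if "r \<le> 0" "(z', x', y') \<in> slab r" for r z' x' y'
    using pol_equivariant[OF that(1), of z' "sgn x'" "sgn y'" "mat 1" S] that(2) S(1)
    by (simp add: \<phi>_def mat_1_SO SO_sgn slab_def norm_sgn)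
  have qslab: "q \<in> slab r" "pmap r q \<in> fst c" if "q \<in> Nc c r" for q r using that by (auto simp: Nc_def)
  have \<phi>q: "\<phi> (pmap r q) = pmap r q" if "r \<le> 0" "q \<in> Nc c r" for r
    using \<phi>[OF that(1)] qslab(1)[OF that(2)] S(2) unfolding qe y_def[symmetric] by simp
  have inv: "chart_inv c (snd c p) = p" if "p \<in> fst c" for p using chart_inv_left[OF chart[OF c] that] .
  have vinv: "chart_inv c (v (r, q')) = pmap r q'" if "r \<le> 0" "q' \<in> Nc c r" for r q'
    using inv qslab(2)[OF that(2)] v[OF that] by simp
  define X where "X = v (t, q)"
  have X: "X \<in> chart_image c" "X = snd c (pmap t q)" using v[OF t q] qslab[OF q] by (auto simp: X_def chart_image_def)
  have symS: "diffeo A \<phi>" "pulls_back A \<phi> (g t) (g t)"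
    using sym S(1) mat_1_SO t unfolding so_symmetric_def \<phi>_def by blast+
  have sm: "smooth_into A (\<phi> \<circ> chart_inv c) (chart_image c)"
    using symS(1) c unfolding diffeo_def smooth_map_def by blast
  have opc: "open (chart_image c)" "open (fst c)" using chart[OF c] by (auto simp: is_chart_def)
  have cont: "continuous_on (chart_image c) (\<phi> \<circ> chart_inv c)" using sm by (simp add: smooth_into_def)
  define E where "E = chart_image c \<inter> (\<phi> \<circ> chart_inv c) -` fst c"
  have fX: "(\<phi> \<circ> chart_inv c) X = pmap t q" using vinv[OF t q] \<phi>q[OF t q] by (simp add: X_def)
  have E: "open E" "X \<in> E" using continuous_open_preimage[OF cont opc] X fX qslab[OF q] by (auto simp: E_def)
  \<comment> \<open>The isometry in the chart \<open>c\<close>, near the point \<open>X\<close> that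
    it fixes.\<close>
  define \<psi> where "\<psi> = snd c \<circ> (\<phi> \<circ> chart_inv c)"
  have "smooth_on \<psi> E" using sm c unfolding smooth_into_def \<psi>_def E_def by blast
  then have \<psi>d: "\<psi> differentiable (at X)" using smooth_on_differentiable[OF _ E(1) subset_refl E(2)] by blast
  have \<psi>v: "\<psi> (v (r, q')) = snd c (\<phi> (pmap r q'))" if "r \<le> 0" "q' \<in> Nc c r" for r q'
    using vinv[OF that] by (simp add: \<psi>_def)
  have pb: "dird a \<psi> X \<bullet> (g t c X *v dird w \<psi> X) = a \<bullet> (g t c X *v w)" for a w
  proof -
    have "isCont (\<phi> \<circ> chart_inv c) X" using cont opc X continuous_on_eq_continuous_at by blast
    from pullback_chart[OF smooth_structure_A riemannian_g[OF t] c this] have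
      "pullback A (g t) (\<phi> \<circ> chart_inv c) X a w = dird a \<psi> X \<bullet> (g t c (snd c (pmap t q)) *v dird w \<psi> X)"
      using qslab(2)[OF q] \<psi>d unfolding fX \<psi>_def by simp
    moreover have "pullback A (g t) (\<phi> \<circ> chart_inv c) X a w = a \<bullet> (g t c X *v w)"
      using symS(2) c X(1) unfolding pulls_back_def by blast
    ultimately show ?thesis using X(2) by simp
  qed
  \<comment> \<open>The isometry fixes the point with parameters \<open>q\<close> at every nearby
    time, not only at \<open>t\<close>; differentiating the fixed path shows that its differential
    fixes the velocity.\<close>
  have 1: "dird (W t q) \<psi> X = W t q"
  proof (rule vector_derivative_unique_within[OF at_within_Iic_neq_bot[OF t]])
    have "((\<lambda>r. \<psi> (v (r, q))) has_derivative (\<lambda>r. dird (r *\<^sub>R W t q) \<psi> X)) (at t within {..0})"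
      using has_derivative_compose[OF time_derivative_v[OF t q, unfolded has_vector_derivative_def] dird_has_derivative[OF \<psi>d[unfolded X_def]]]
      by (simp add: X_def)
    moreover have "dird (r *\<^sub>R W t q) \<psi> X = r *\<^sub>R dird (W t q) \<psi> X" for r
      using linear_frechet_derivative[OF \<psi>d] by (simp add: dird_def linear_scale)
    ultimately show "((\<lambda>r. \<psi> (v (r, q))) has_vector_derivative dird (W t q) \<psi> X) (at t within {..0})"
      unfolding has_vector_derivative_def by simp
    obtain \<epsilon> where e: "\<epsilon> > 0" "\<And>s. s \<le> 0 \<Longrightarrow> dist s t < \<epsilon> \<Longrightarrow> q \<in> Nc c s"
      using near_Nc_time[OF t q] by blast
    show "((\<lambda>r. \<psi> (v (r, q))) has_vector_derivative W t q) (at t within {..0})"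
    proof (rule has_vector_derivative_transform_within[OF time_derivative_v[OF t q] e(1)])
      fix r assume "r \<in> {..0}" "dist r t < \<epsilon>"
      then have r: "r \<le> 0" "q \<in> Nc c r" using e by auto
      show "v (r, q) = \<psi> (v (r, q))" using \<psi>v[OF r] \<phi>q[OF r] v[OF r] by simp
    qed (use t in auto)
  qed
  have Nop: "open (Nc c t)" by (rule open_Nc[OF c t])
  have ud: "(\<lambda>q. v (t, q)) differentiable (at q)" using Cinf_differentiable[OF Cinf_v[OF t] q] .
  have lin: "linear (\<lambda>a. dird a (\<lambda>q. v (t, q)) q)" using linear_frechet_derivative[OF ud] by (simp add: dird_def)
  define Db where "Db = dird (0, 0, b) (\<lambda>q. v (t, q)) q"
  \<comment> \<open>\<open>sgn\<close> is constant on rays, so the multiple of \<open>y\<close> in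
    \<open>S *v b\<close> is invisible to \<open>v\<close>.\<close>
  have radial: "dird (0, 0, y) (\<lambda>q. v (t, q)) q = 0"
  proof -
    have "((\<lambda>r. v (t, q + r *\<^sub>R (0, 0, y))) has_vector_derivative dird (0, 0, y) (\<lambda>q. v (t, q)) q) (at 0)"
      using dird_line0[OF ud, of "(0, 0, y)" UNIV] by simp
    moreover have "((\<lambda>r. v (t, q + r *\<^sub>R (0, 0, y))) has_vector_derivative 0) (at 0)"
    proof (rule has_vector_derivative_transform_within_open[of "\<lambda>r. v (t, q)" 0 0 "{-1<..}"])
      fix r :: real assume r: "r \<in> {-1<..}"
      have "q + r *\<^sub>R (0, 0, y) = (z, x, (1 + r) *\<^sub>R y)" by (simp add: qe y_def algebra_simps)
      moreover have "pmap t (z, x, (1 + r) *\<^sub>R y) = pmap t q" using r by (simp add: qe y_def[symmetric] sgn_scaleR)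
      moreover have "(z, x, (1 + r) *\<^sub>R y) \<in> Nc c t"
        using q r calculation(2) by (auto simp: Nc_def slab_def qe y_def[symmetric])
      ultimately show "v (t, q) = v (t, q + r *\<^sub>R (0, 0, y))" using v[OF t] q by metis
    qed auto
    ultimately show ?thesis using vector_derivative_unique_at by blast
  qed
  have SDb: "dird (0, 0, S *v b) (\<lambda>q. v (t, q)) q = - Db"
  proof -
    have "(0, 0, S *v b) = (- 1) *\<^sub>R (0, 0, b) + \<kappa> *\<^sub>R (0::real, 0::real^'k, y)" by (simp add: S)
    then show ?thesis
      unfolding Db_def using linear_add[OF lin] linear_scale[OF lin] radial by (metis add.right_neutral scaleR_minus1_left scaleR_zero_right)
  qed
  \<comment> \<open>In parameters the isometry acts by \<open>S\<close>, so its differential takes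
    the image of \<open>b\<close> to that of \<open>S *v b\<close>.\<close>
  have 2: "dird Db \<psi> X = - Db"
  proof -
    have l: "((\<lambda>r. v (t, q + r *\<^sub>R (0, 0, a))) has_vector_derivative dird (0, 0, a) (\<lambda>q. v (t, q)) q) (at 0)" for a
      using dird_line0[OF ud, of "(0, 0, a)" UNIV] by simp
    have "((\<lambda>r. \<psi> (v (t, q + r *\<^sub>R (0, 0, b)))) has_derivative (\<lambda>r. dird (r *\<^sub>R Db) \<psi> X)) (at 0)"
    proof -
      have "q + 0 *\<^sub>R (0, 0, b) = q" by (simp only: scaleR_zero_left add_0_right)
      then have dX: "(\<psi> has_derivative (\<lambda>a. dird a \<psi> X)) (at (v (t, q + 0 *\<^sub>R (0, 0, b))))"
        using dird_has_derivative[OF \<psi>d] by (simp only: X_def)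
      show ?thesis
        using has_derivative_compose[OF l[of b, unfolded has_vector_derivative_def] dX] by (simp only: Db_def)
    qed
    moreover have "dird (r *\<^sub>R Db) \<psi> X = r *\<^sub>R dird Db \<psi> X" for r
      using linear_frechet_derivative[OF \<psi>d] by (simp add: dird_def linear_scale)
    ultimately have d1: "((\<lambda>r. \<psi> (v (t, q + r *\<^sub>R (0, 0, b)))) has_vector_derivative dird Db \<psi> X) (at 0)"
      unfolding has_vector_derivative_def by simp
    have line: "eventually (\<lambda>r. q + r *\<^sub>R (0, 0, a) \<in> Nc c t) (nhds (0::real))" for a
    proof -
      have "((\<lambda>r. q + r *\<^sub>R (0, 0, a)) \<longlongrightarrow> q + 0 *\<^sub>R (0, 0, a)) (nhds (0::real))"
        by (intro tendsto_intros filterlim_ident)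
      then have "((\<lambda>r. q + r *\<^sub>R (0, 0, a)) \<longlongrightarrow> q) (nhds (0::real))" by (simp add: zero_prod_def[symmetric])
      from topological_tendstoD[OF this Nop q] show ?thesis .
    qed
    have step: "\<psi> (v (t, q + r *\<^sub>R (0, 0, b))) = v (t, q + r *\<^sub>R (0, 0, S *v b))"
      if r: "q + r *\<^sub>R (0, 0, b) \<in> Nc c t" "q + r *\<^sub>R (0, 0, S *v b) \<in> Nc c t" for r
    proof -
      have e: "q + r *\<^sub>R (0, 0, a) = (z, x, y + r *\<^sub>R a)" for a by (simp add: qe y_def)
      have "S *v (y + r *\<^sub>R b) = y + r *\<^sub>R (S *v b)"
        by (simp add: matrix_vector_right_distrib matrix_vector_mult_scaleR S(2))
      then show ?thesis using \<psi>v[OF t r(1)] v[OF t r(2)] \<phi>[OF t qslab(1)[OF r(1)[unfolded e]]]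
        unfolding e by simp
    qed
    have "eventually (\<lambda>r. \<psi> (v (t, q + r *\<^sub>R (0, 0, b))) = v (t, q + r *\<^sub>R (0, 0, S *v b))) (nhds 0)"
      using line[of b] line[of "S *v b"] by eventually_elim (rule step)
    then obtain O' where O': "open O'" "0 \<in> O'" "\<And>r. r \<in> O' \<Longrightarrow> v (t, q + r *\<^sub>R (0, 0, S *v b)) = \<psi> (v (t, q + r *\<^sub>R (0, 0, b)))"
      unfolding eventually_nhds by (metis (no_types))
    have "((\<lambda>r. \<psi> (v (t, q + r *\<^sub>R (0, 0, b)))) has_vector_derivative - Db) (at 0)"
      by (rule has_vector_derivative_transform_within_open[OF l[of "S *v b", unfolded SDb] O'(1,2)]) (rule O'(3))
    then show ?thesis using d1 vector_derivative_unique_at by blast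
  qed
  \<comment> \<open>The differential preserves inner products, fixes \<open>W t q\<close> and
    reverses \<open>Db\<close>.\<close>
  have "W t q \<bullet> (g t c X *v Db) = - (W t q \<bullet> (g t c X *v Db))"
    using pb[of "W t q" Db] unfolding 1 2
    by (simp add: linear_neg[OF matrix_vector_mul_linear])
  then show ?thesis by (simp add: X_def Db_def b_def)
qed

text \<open>The squared length of one coordinate direction is differentiated in two ways: as the
  known function \<open>f\<close>, and through motion of the point together with the Ricci
  flow.\<close>

lemma time_derivative_metric:
  assumes t: "t \<le> 0" and q: "q \<in> Nc c t" and a: "a \<in> Basis"
    and f: "(f has_real_derivative f') (at t within {..0})"
    and eq: "\<And>s. s \<le> 0 \<Longrightarrow> q \<in> Nc c s \<Longrightarrow>
      dird a (\<lambda>q. v (s, q)) q \<bullet> (g s c (v (s, q)) *v dird a (\<lambda>q. v (s, q)) q) = f s"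
    and cm: "coord_map (g t c) (chart_image c) (\<lambda>q. v (t, q)) (Nc c t)"
  shows "f' = 2 * (coord_map.D (g t c) (\<lambda>q. v (t, q)) a (W t) q \<bullet> (g t c (v (t, q)) *v dird a (\<lambda>q. v (t, q)) q))
     - 2 * (dird a (\<lambda>q. v (t, q)) q \<bullet> (ricci (g t c) (v (t, q)) *v dird a (\<lambda>q. v (t, q)) q))"
proof -
  interpret cm: coord_map "g t c" "chart_image c" "\<lambda>q. v (t, q)" "Nc c t" by (rule cm)
  obtain \<epsilon> where e: "\<epsilon> > 0" "\<And>s. s \<le> 0 \<Longrightarrow> dist s t < \<epsilon> \<Longrightarrow> q \<in> Nc c s"
    using near_Nc_time[OF t q] by blast
  have gxv: "gx (s, v (s, q)) = g s c (v (s, q))" if "s \<le> 0" "q \<in> Nc c s" for s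
    using gx[OF that(1)] v[OF that] that(2) by (auto simp: Nc_def chart_image_def)
  have "((\<lambda>s. dird (0, a) v (s, q) \<bullet> (gx (s, v (s, q)) *v dird (0, a) v (s, q))) has_real_derivative
     2 * (cm.D a (W t) q \<bullet> (g t c (v (t, q)) *v dird a (\<lambda>q. v (t, q)) q)) +
     dird a (\<lambda>q. v (t, q)) q \<bullet> (((- 2) *\<^sub>R ricci (g t c) (v (t, q))) *v dird a (\<lambda>q. v (t, q)) q)) (at t within {..0})"
    by (rule cm.metric_time_derivative[OF q time_derivative_dird[OF t q a] v_slice[OF t q, symmetric] time_derivative_g[OF t q] gxv[OF t q]])
  then have "((\<lambda>s. f s) has_real_derivative
     2 * (cm.D a (W t) q \<bullet> (g t c (v (t, q)) *v dird a (\<lambda>q. v (t, q)) q)) +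
     dird a (\<lambda>q. v (t, q)) q \<bullet> (((- 2) *\<^sub>R ricci (g t c) (v (t, q))) *v dird a (\<lambda>q. v (t, q)) q)) (at t within {..0})"
  proof (rule has_field_derivative_transform_within[OF _ e(1)])
    fix s assume "s \<in> {..0}" "dist s t < \<epsilon>"
    then have s: "s \<le> 0" "q \<in> Nc c s" using e by auto
    show "dird (0, a) v (s, q) \<bullet> (gx (s, v (s, q)) *v dird (0, a) v (s, q)) = f s"
      using eq[OF s] gxv[OF s] v_slice[OF s] by simp
  qed (use t in auto)
  then have "f' = 2 * (cm.D a (W t) q \<bullet> (g t c (v (t, q)) *v dird a (\<lambda>q. v (t, q)) q)) +
     dird a (\<lambda>q. v (t, q)) q \<bullet> (((- 2) *\<^sub>R ricci (g t c) (v (t, q))) *v dird a (\<lambda>q. v (t, q)) q)"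
    using f vector_derivative_unique_within[OF at_within_Iic_neq_bot[OF t]]
    unfolding has_real_derivative_iff_has_vector_derivative by blast
  also have "((- 2) *\<^sub>R ricci (g t c) (v (t, q))) *v dird a (\<lambda>q. v (t, q)) q = (- 2) *\<^sub>R (ricci (g t c) (v (t, q)) *v dird a (\<lambda>q. v (t, q)) q)"
    by (rule scaleR_matrix_vector_assoc[symmetric])
  finally show ?thesis by simp
qed

text \<open>The z-component of the velocity, as the z-direction has length 1. It is written with the
  extensions \<open>v\<close> and \<open>gx\<close> so as to be continuous in a full
  neighbourhood.\<close>

definition \<zeta> :: "real \<Rightarrow> real \<Rightarrow> real" where
  "\<zeta> z t = dird (1, 0) v (t, base z) \<bullet>
     (gx (t, v (t, base z)) *v dird (0, 1, 0, 0) v (t, base z))"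

text \<open>Two instances of \<open>time_derivative_metric\<close>. Along \<open>Z\<close> the
  squared length is constantly 1, so the covariant derivative of the velocity balances the Ricci
  term; along \<open>Y j\<close> the squared length is that of the radius G.\<close>

lemma evolution:
  assumes t: "t \<le> 0" and q: "(base z) \<in> Nc c t"
  shows "((\<lambda>z. \<zeta> z t) has_real_derivative
      - (real CARD('k) - 1) * Fzz (z, t) / Fx (z, t)
      - (real CARD('l) - 1) * Gzz (z, t) / Gx (z, t)) (at z)" (is ?th1)
    and "Gt (z, t) = \<zeta> z t * Gz (z, t) + Gzz (z, t)
      + (real CARD('k) - 1) * Fz (z, t) * Gz (z, t) / Fx (z, t)
      - (real CARD('l) - 2) * (1 - (Gz (z, t))\<^sup>2) / Gx (z, t)" (is ?th2)
proof -
  interpret w: warped "g t c" "chart_image c" "\<lambda>q. v (t, q)" "Nc c t"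
     "\<lambda>z. Fx (z, t)" "\<lambda>z. Fz (z, t)" "\<lambda>z. Fzz (z, t)"
     "\<lambda>z. Gx (z, t)" "\<lambda>z. Gz (z, t)" "\<lambda>z. Gzz (z, t)" i0 j0 z
    by (rule warped_chart[OF t q])
  note q0N = w.q0_N
  have z: "0 < z" "z < zmax t" using q by (auto simp: Nc_def slab_def)
  have cm: "coord_map (g t c) (chart_image c) (\<lambda>q. v (t, q)) (Nc c t)" by unfold_locales
  have Zb: "w.Z \<in> Basis" using w.Basis_B w.Z_B by blast
  have gxv: "gx (s, v (s, q)) = g s c (v (s, q))" if "s \<le> 0" "q \<in> Nc c s" for s q
    using gx[OF that(1)] v[OF that] that(2) by (auto simp: Nc_def chart_image_def)
  have \<zeta>eq: "\<zeta> z' t = W t (base z') \<bullet> (g t c (v (t, base z')) *v dird w.Z (\<lambda>q. v (t, q)) (base z'))"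
    if "(base z') \<in> Nc c t" for z'
    using gxv[OF t that] v_slice[OF t that] by (simp add: \<zeta>_def W_def w.Z_def)
  have Wd: "W t differentiable (at w.q0)" by (rule W_diff[OF t q0N])
  have uZ: "dird w.Z (\<lambda>q. v (s, q)) w.q0 \<bullet> (g s c (v (s, w.q0)) *v dird w.Z (\<lambda>q. v (s, q)) w.q0) = 1"
    if "s \<le> 0" "w.q0 \<in> Nc c s" for s
    using metric_Nc[OF that[unfolded w.q0_def], of 1 0 0 1 0 0] by (simp add: w.q0_def w.Z_def sph_def)
  have E: "w.D w.Z (W t) w.q0 \<bullet> (g t c (v (t, w.q0)) *v dird w.Z (\<lambda>q. v (t, q)) w.q0) =
     dird w.Z (\<lambda>q. v (t, q)) w.q0 \<bullet> (ricci (g t c) (v (t, w.q0)) *v dird w.Z (\<lambda>q. v (t, q)) w.q0)"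
    using time_derivative_metric[OF t q0N Zb DERIV_const uZ cm] by simp
  have "((\<lambda>s. \<zeta> (z + s) t) has_real_derivative w.D w.Z (W t) w.q0 \<bullet> (g t c (v (t, w.q0)) *v dird w.Z (\<lambda>q. v (t, q)) w.q0)) (at 0)"
  proof (rule DERIV_cong_ev[OF refl _ refl, THEN iffD2, OF _ w.velocity_Z_derivative[OF Wd]])
    show "\<forall>\<^sub>F s in nhds 0. \<zeta> (z + s) t = W t (z + s, axis i0 1, axis j0 1) \<bullet>
        (g t c (v (t, z + s, axis i0 1, axis j0 1)) *v dird w.Z (\<lambda>q. v (t, q)) (z + s, axis i0 1, axis j0 1))"
      using w.near_z0 by eventually_elim (rule \<zeta>eq)
  qed
  then show ?th1
    using DERIV_shift[of "\<lambda>z. \<zeta> z t" _ 0 z] unfolding E w.ricci_Z by (simp add: add.commute)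
  obtain j where j: "j \<noteq> j0" using ex_not_in[of "{j0}"] dims by auto
  have Yb: "w.Y j \<in> Basis" using w.Basis_B w.Y_B j by blast
  have orth: "W t (w.q0 + s *\<^sub>R w.Y j) \<bullet> (g t c (v (t, w.q0 + s *\<^sub>R w.Y j)) *v dird (w.Y j) (\<lambda>q. v (t, q)) (w.q0 + s *\<^sub>R w.Y j)) = 0"
    if "w.q0 + s *\<^sub>R w.Y j \<in> Nc c t" for s
    using velocity_orth[OF t j that, of z "axis i0 1" s] by (simp add: w.q0_def w.Y_def)
  have uY: "dird (w.Y j) (\<lambda>q. v (s, q)) w.q0 \<bullet> (g s c (v (s, w.q0)) *v dird (w.Y j) (\<lambda>q. v (s, q)) w.q0) = (Gx (z, s))\<^sup>2"
    if "s \<le> 0" "w.q0 \<in> Nc c s" for s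
  proof -
    have "0 < z" "z < zmax s" using that by (auto simp: w.q0_def Nc_def slab_def)
    then show ?thesis
    using metric_Nc[OF that[unfolded w.q0_def], of 0 0 "axis j 1" 0 0 "axis j 1"] j ext(4)[OF that(1), of z]
    by (simp add: w.q0_def w.Y_def)
  qed
  have zU: "(z, t) \<in> UF" using ext(4)[OF t z] by blast
  have Gt: "((\<lambda>s. Gx (z, s)) has_real_derivative Gt (z, t)) (at t within {..0})"
    unfolding has_real_derivative_iff_has_vector_derivative
    by (intro has_vector_derivative_slice_snd Cinf_differentiable[OF ext(3) zU])
  have Gt2: "((\<lambda>s. (Gx (z, s))\<^sup>2) has_real_derivative 2 * Gx (z, t) * Gt (z, t)) (at t within {..0})"
    using DERIV_power[OF Gt, of 2] by (simp add: mult_ac)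
  have main: "2 * Gx (z, t) * Gt (z, t) = 2 * (Gx (z, t) * Gz (z, t) * \<zeta> z t)
     - 2 * (- Gx (z, t) * Gzz (z, t) - (real CARD('k) - 1) * Fz (z, t) * Gz (z, t) * Gx (z, t) / Fx (z, t)
       + (real CARD('l) - 2) * (1 - (Gz (z, t))\<^sup>2))"
    using time_derivative_metric[OF t q0N Yb Gt2 uY cm] w.velocity_Y[OF Wd j orth] w.ricci_Y[OF j] \<zeta>eq[OF q]
    by (simp add: w.q0_def)
  have "Gx (z, t) * Gt (z, t) = Gx (z, t) * (\<zeta> z t * Gz (z, t) + Gzz (z, t)
      + (real CARD('k) - 1) * Fz (z, t) * Gz (z, t) / Fx (z, t)
      - (real CARD('l) - 2) * (1 - (Gz (z, t))\<^sup>2) / Gx (z, t))"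
  proof -
    define p where "p = (real CARD('k) - 1) * Fz (z, t) * Gz (z, t) / Fx (z, t)"
    define r where "r = (real CARD('l) - 2) * (1 - (Gz (z, t))\<^sup>2) / Gx (z, t)"
    have "(real CARD('k) - 1) * Fz (z, t) * Gz (z, t) * Gx (z, t) / Fx (z, t) = Gx (z, t) * p"
      "(real CARD('l) - 2) * (1 - (Gz (z, t))\<^sup>2) = Gx (z, t) * r"
      using w.G0 by (auto simp: p_def r_def)
    with main have "2 * Gx (z, t) * Gt (z, t) = 2 * (Gx (z, t) * Gz (z, t) * \<zeta> z t)
      - 2 * (- Gx (z, t) * Gzz (z, t) - Gx (z, t) * p + Gx (z, t) * r)" by simp
    then show ?thesis unfolding p_def[symmetric] r_def[symmetric] by (simp add: algebra_simps)
  qed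
  then show ?th2 using w.G0 by (simp only: mult_cancel_left) auto
qed

lemma concave_chart:
  assumes t: "t \<le> 0" and q: "(base z) \<in> Nc c t" and cc: "curv_op_nonneg (g t c) (v (t, base z))"
  shows "Fzz (z, t) \<le> 0" "Gzz (z, t) \<le> 0"
proof -
  interpret w: warped "g t c" "chart_image c" "\<lambda>q. v (t, q)" "Nc c t"
     "\<lambda>z. Fx (z, t)" "\<lambda>z. Fz (z, t)" "\<lambda>z. Fzz (z, t)"
     "\<lambda>z. Gx (z, t)" "\<lambda>z. Gz (z, t)" "\<lambda>z. Gzz (z, t)" i0 j0 z
    by (rule warped_chart[OF t q])
  have ex: "\<exists>i. i \<noteq> i0" "\<exists>j. j \<noteq> j0"
    using ex_not_in[of "{i0}"] ex_not_in[of "{j0}"] dims by auto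
  show "Fzz (z, t) \<le> 0" "Gzz (z, t) \<le> 0"
    using w.concave[OF _ ex] cc by (auto simp: w.q0_def)
qed

text \<open>\<zeta> becomes part of the drift in the equation for G_z, for which the maximum
  principle needs a bound.\<close>

lemma \<zeta>_bounded:
  assumes t0: "t0 \<le> 0" and q: "(base z0) \<in> Nc c t0"
  shows "\<exists>\<epsilon>>0. \<exists>C. \<forall>z t. \<bar>t - t0\<bar> < \<epsilon> \<longrightarrow> \<bar>z - z0\<bar> < \<epsilon> \<longrightarrow> \<bar>\<zeta> z t\<bar> \<le> C"
proof -
  define J :: "real \<times> real \<Rightarrow> real \<times> real \<times> (real^'k) \<times> (real^'l)" where "J = (\<lambda>p. (snd p, fst p, axis i0 1, axis j0 1))"
  have J: "isCont J (z0, t0)" unfolding J_def by (intro continuous_intros)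
  have in1: "J (z0, t0) \<in> U" using v[OF t0 q] by (simp add: J_def)
  have vJ: "isCont f (J (z0, t0))" if "Cinf f U" for f :: "_ \<Rightarrow> real^'n"
    using Cinf_differentiable[OF that in1] differentiable_imp_continuous_within by blast
  have B: "(1::real, 0::real \<times> (real^'k) \<times> (real^'l)) \<in> Basis" "(0::real, 1::real, 0::real^'k, 0::real^'l) \<in> Basis"
  proof -
    show "(1::real, 0::real \<times> (real^'k) \<times> (real^'l)) \<in> Basis" by (rule Basis_prodI)
    have "(1::real, 0::(real^'k) \<times> (real^'l)) \<in> Basis" by (rule Basis_prodI)
    from Basis_prodI(3)[OF this] show "(0::real, 1::real, 0::real^'k, 0::real^'l) \<in> Basis" unfolding zero_prod_def .
  qed
  note c = isCont_o2[OF J vJ]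
  have c1: "isCont (\<lambda>p. v (J p)) (z0, t0)" "isCont (\<lambda>p. dird (1, 0) v (J p)) (z0, t0)" "isCont (\<lambda>p. dird (0, 1, 0, 0) v (J p)) (z0, t0)"
    using c[OF U(2)] c[OF Cinf_dird[OF U(2) B(1)]] c[OF Cinf_dird[OF U(2) B(2)]] by auto
  have "gx differentiable (at (t0, v (J (z0, t0))))"
    using gx[OF t0, of "v (J (z0, t0))"] v[OF t0 q] q O1 Cinf_differentiable[OF O1(2)] by (auto simp: J_def Nc_def chart_image_def)
  then have "isCont gx (t0, v (J (z0, t0)))" using differentiable_imp_continuous_within by blast
  moreover have "isCont (\<lambda>p. (snd p, v (J p))) (z0, t0)" using c1(1) by (intro continuous_intros)
  ultimately have c2: "isCont (\<lambda>p. gx (snd p, v (J p))) (z0, t0)"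
    using isCont_o2[where f = "\<lambda>p. (snd p, v (J p))" and g = gx and a = "(z0, t0)"] by simp
  have "(\<lambda>p. \<zeta> (fst p) (snd p)) = (\<lambda>p. dird (1, 0) v (J p) \<bullet> (gx (snd p, v (J p)) *v dird (0, 1, 0, 0) v (J p)))"
    by (simp add: \<zeta>_def J_def)
  then have "isCont (\<lambda>p. \<zeta> (fst p) (snd p)) (z0, t0)"
    using bounded_bilinear.isCont[OF bounded_bilinear_matrix_vector_mult c2 c1(3)] c1(2) by (simp add: continuous_inner)
  from isCont_locally_bounded[OF this] show ?thesis by simp
qed

end

section \<open>The strong maximum principle\<close>

lemma second_derivative_at_min:
  fixes f :: "real \<Rightarrow> real"
  assumes d: "d > 0" and f: "\<And>y. \<bar>y - x\<bar> < d \<Longrightarrow> (f has_real_derivative f1 y) (at y)"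
    and f1: "(f1 has_real_derivative f2) (at x)" and min: "\<And>y. \<bar>y - x\<bar> < d \<Longrightarrow> f x \<le> f y"
  shows "f1 x = 0" "f2 \<ge> 0"
proof -
  show 0: "f1 x = 0" using DERIV_local_min[OF f d] min d by (simp add: abs_minus_commute)
  show "f2 \<ge> 0"
  proof (rule ccontr)
    assume "\<not> ?thesis"
    then obtain e where e: "e > 0" "\<And>h. 0 < h \<Longrightarrow> h < e \<Longrightarrow> f1 (x + h) < f1 x"
      using DERIV_neg_dec_right[OF f1] by auto
    define h where "h = min e d / 2"
    have h: "0 < h" "h < e" "h < d" using e d by (auto simp: h_def)
    obtain y where "x < y" "y < x + h" "f (x + h) - f x = (x + h - x) * f1 y"
      using MVT2[of x "x + h" f f1] f h by auto
    moreover have "f1 y < 0" using e(2)[of "y - x"] 0 calculation h by simp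
    ultimately have "f (x + h) < f x" using h mult_pos_neg[of h "f1 y"] by simp
    then show False using min[of "x + h"] h by simp
  qed
qed

text \<open>The barrier is \<open>exp (\<alpha> (z - s t)) - 1\<close>, whose zero \<open>s t\<close> travels from \<open>z2\<close> to \<open>z1\<close>.\<close>
lemma strong_maximum_principle:
  fixes w w1 w2 wt :: "real \<Rightarrow> real \<Rightarrow> real"
  assumes z12: "z1 < z2" and \<tau>: "\<tau> > 0" and \<eta>: "\<eta> > 0" and B: "B \<ge> 0"
    and dw: "\<And>z t. z \<in> {z1..z2} \<Longrightarrow> t \<in> {T-\<tau>..T} \<Longrightarrow> ((\<lambda>z. w z t) has_real_derivative w1 z t) (at z)"
    and dw1: "\<And>z t. z \<in> {z1..z2} \<Longrightarrow> t \<in> {T-\<tau>..T} \<Longrightarrow> ((\<lambda>z. w1 z t) has_real_derivative w2 z t) (at z)"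
    and dwt: "\<And>z t. z \<in> {z1..z2} \<Longrightarrow> t \<in> {T-\<tau>..T} \<Longrightarrow> ((\<lambda>t. w z t) has_real_derivative wt z t) (at t within {..T})"
    and cont: "continuous_on ({z1..z2} \<times> {T-\<tau>..T}) (\<lambda>(z, t). w z t)"
    and eq: "\<And>z t. z \<in> {z1..z2} \<Longrightarrow> t \<in> {T-\<tau>..T} \<Longrightarrow> \<exists>b c. \<bar>b\<bar> \<le> B \<and> \<bar>c\<bar> \<le> B \<and> wt z t = w2 z t + b * w1 z t + c * w z t"
    and nonneg: "\<And>z t. z \<in> {z1..z2} \<Longrightarrow> t \<in> {T-\<tau>..T} \<Longrightarrow> w z t \<ge> 0"
    and right: "\<And>t. t \<in> {T-\<tau>..T} \<Longrightarrow> w z2 t \<ge> \<eta>"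
    and z: "z1 < z" "z \<le> z2"
  shows "w z T > 0"
proof -
  \<comment> \<open>The speed at which the zero \<open>s t\<close> crosses the whole interval in
    time \<tau>; it ends at \<open>z1\<close>, so that positivity is reached at every point beyond
    \<open>z1\<close>.\<close>
  define m where "m = (z2 - z1) / \<tau>"
  have m: "m > 0" using z12 \<tau> by (simp add: m_def)
  define s where "s t = z2 - m * (t - (T - \<tau>))" for t
  have sT: "s T = z1" "s (T - \<tau>) = z2" using \<tau> by (auto simp: s_def m_def)
  have s_ge: "z1 \<le> s t" "s t \<le> z2" if "t \<in> {T-\<tau>..T}" for t
  proof -
    have "m * (t - (T - \<tau>)) \<le> m * \<tau>" using m that by (intro mult_left_mono) auto
    then show "z1 \<le> s t" using \<tau> by (simp add: s_def m_def)
    show "s t \<le> z2" using m that by (simp add: s_def)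
  qed
  \<comment> \<open>Large enough for a strict subsolution: the second derivative must outweigh
    drift, potential and the motion of the zero. With this choice the expression in the next claim
    equals \<open>m + 1\<close>.\<close>
  define \<alpha> where "\<alpha> = B + m + 1"
  have \<alpha>: "\<alpha> > 0" "\<alpha> * \<alpha> - B * \<alpha> - B - \<alpha> * m > 0" using B m by (auto simp: \<alpha>_def algebra_simps)
  \<comment> \<open>Keeps the barrier at the right end \<open>z2\<close> below \<eta>.\<close>
  define \<epsilon> where "\<epsilon> = \<eta> / exp (\<alpha> * (z2 - z1))"
  have \<epsilon>: "\<epsilon> > 0" using \<eta> by (simp add: \<epsilon>_def)
  define E where "E z t = exp (\<alpha> * (z - s t))" for z t
  define \<psi> where "\<psi> z t = w z t - \<epsilon> * (E z t - 1)" for z t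
  \<comment> \<open>The exponential weight gives the zeroth order term a definite sign:
    \<open>B + 1 - c\<close> is positive whatever the sign of \<open>c\<close>.\<close>
  define \<Psi> where "\<Psi> z t = exp (- (B + 1) * t) * \<psi> z t" for z t
  \<comment> \<open>The region to the right of the moving zero. A negative minimum is excluded on
    its sides, by nonnegativity of \<open>w\<close> at the zero and by the bound at
    \<open>z2\<close>; at the initial time the region is the single point \<open>z2\<close>.\<close>
  define Dom where "Dom = {p \<in> {z1..z2} \<times> {T-\<tau>..T}. s (snd p) \<le> fst p}"
  have compD: "compact Dom"
  proof -
    have "Dom = ({z1..z2} \<times> {T-\<tau>..T}) \<inter> {p. s (snd p) \<le> fst p}" by (auto simp: Dom_def)
    moreover have "closed {p::real \<times> real. s (snd p) \<le> fst p}"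
      unfolding s_def by (intro closed_Collect_le continuous_intros)
    ultimately show ?thesis by (auto intro!: compact_Int_closed compact_Times)
  qed
  have cw: "continuous_on Dom (\<lambda>p. w (fst p) (snd p))"
    using continuous_on_subset[OF cont, of Dom] by (auto simp: Dom_def case_prod_beta')
  have contD: "continuous_on Dom (\<lambda>p. \<Psi> (fst p) (snd p))"
    unfolding \<Psi>_def \<psi>_def E_def s_def by (intro continuous_intros cw)
  have "(z, T) \<in> Dom" using z \<tau> sT by (auto simp: Dom_def)
  then obtain p where p: "p \<in> Dom" "\<And>q. q \<in> Dom \<Longrightarrow> \<Psi> (fst p) (snd p) \<le> \<Psi> (fst q) (snd q)"
    using continuous_attains_inf[OF compD _ contD] by blast
  obtain z0 t0 where p0: "p = (z0, t0)" by (cases p)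
  have z0: "z0 \<in> {z1..z2}" and t0: "t0 \<in> {T-\<tau>..T}" and s0: "s t0 \<le> z0" using p(1) by (auto simp: Dom_def p0)
  have min: "\<Psi> z0 t0 \<le> \<Psi> z t" if "z \<in> {z1..z2}" "t \<in> {T-\<tau>..T}" "s t \<le> z" for z t
    using p(2)[of "(z, t)"] that by (auto simp: Dom_def p0)
  have "\<psi> z0 t0 \<ge> 0"
  proof (rule ccontr)
    assume "\<not> ?thesis"
    then have neg: "\<psi> z0 t0 < 0" by simp
    have "z0 \<noteq> z2"
    proof
      assume e: "z0 = z2"
      have "E z2 t0 \<le> exp (\<alpha> * (z2 - z1))" using s_ge[OF t0] \<alpha> by (simp add: E_def)
      then have "\<epsilon> * E z2 t0 \<le> \<epsilon> * exp (\<alpha> * (z2 - z1))" using \<epsilon> by (intro mult_left_mono) auto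
      also have "\<dots> = \<eta>" by (simp add: \<epsilon>_def)
      finally have "\<epsilon> * (E z2 t0 - 1) \<le> \<eta>" using \<epsilon> by (simp add: algebra_simps)
      then show False using neg right[OF t0] by (simp add: \<psi>_def e)
    qed
    moreover have "z0 \<noteq> s t0"
      using neg nonneg[OF z0 t0] by (auto simp: \<psi>_def E_def)
    ultimately have zz: "s t0 < z0" "z0 < z2" using z0 s0 by auto
    have "t0 \<noteq> T - \<tau>" using zz sT by auto
    then have tt: "T - \<tau> < t0" "t0 \<le> T" using t0 by auto
    have dE: "((\<lambda>z. E z t) has_real_derivative \<alpha> * E z t) (at z)" for z t
      unfolding E_def by (auto intro!: derivative_eq_intros)
    have d\<psi>: "((\<lambda>z. \<psi> z t0) has_real_derivative w1 z t0 - \<epsilon> * (\<alpha> * E z t0)) (at z)" if "z \<in> {z1..z2}" for z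
      unfolding \<psi>_def by (auto intro!: derivative_eq_intros dE dw that t0)
    have d\<psi>1: "((\<lambda>z. w1 z t0 - \<epsilon> * (\<alpha> * E z t0)) has_real_derivative w2 z0 t0 - \<epsilon> * (\<alpha> * (\<alpha> * E z0 t0))) (at z0)"
      by (auto intro!: derivative_eq_intros dE dw1 z0 t0)
    define d where "d = min (z0 - s t0) (z2 - z0)"
    have d: "d > 0" using zz by (simp add: d_def)
    have near: "y \<in> {z1..z2} \<and> s t0 \<le> y" if "\<bar>y - z0\<bar> < d" for y
      using that s_ge[OF t0] by (auto simp: d_def abs_less_iff)
    have "\<psi> z0 t0 \<le> \<psi> y t0" if "\<bar>y - z0\<bar> < d" for y
      using min[of y t0] near[OF that] t0 by (simp add: \<Psi>_def)
    from second_derivative_at_min[OF d d\<psi> d\<psi>1 this]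
    have w1: "w1 z0 t0 = \<epsilon> * (\<alpha> * E z0 t0)" and w2: "w2 z0 t0 \<ge> \<epsilon> * (\<alpha> * (\<alpha> * E z0 t0))"
      using near by auto
    have dEt: "((\<lambda>t. E z0 t) has_real_derivative \<alpha> * m * E z0 t0) (at t0 within {..T})"
      unfolding E_def s_def by (auto intro!: derivative_eq_intros)
    have "((\<lambda>t. \<Psi> z0 t) has_real_derivative exp (- (B + 1) * t0) * ((wt z0 t0 - \<epsilon> * (\<alpha> * m * E z0 t0)) - (B + 1) * \<psi> z0 t0)) (at t0 within {..T})"
      unfolding \<Psi>_def \<psi>_def by (auto intro!: derivative_eq_intros dEt dwt z0 t0 simp: algebra_simps)
    note d\<Psi> = this
    have "(wt z0 t0 - \<epsilon> * (\<alpha> * m * E z0 t0)) - (B + 1) * \<psi> z0 t0 \<le> 0"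
    proof (rule ccontr)
      assume "\<not> ?thesis"
      then have "exp (- (B + 1) * t0) * ((wt z0 t0 - \<epsilon> * (\<alpha> * m * E z0 t0)) - (B + 1) * \<psi> z0 t0) > 0" by simp
      from has_real_derivative_pos_inc_left[OF d\<Psi> this]
      obtain e where e: "e > 0" "\<And>h. 0 < h \<Longrightarrow> t0 - h \<in> {..T} \<Longrightarrow> h < e \<Longrightarrow> \<Psi> z0 (t0 - h) < \<Psi> z0 t0" by blast
      \<comment> \<open>Going back by \<open>h\<close> moves the zero to the right by
        \<open>m * h\<close>, so \<open>h < r\<close> keeps \<open>z0\<close> inside the region and
        the minimum can be compared with an earlier time.\<close>
      define r where "r = (z0 - s t0) / m"
      define h where "h = min e (min (t0 - (T - \<tau>)) r) / 2"
      have "e > 0" "t0 - (T - \<tau>) > 0" "r > 0" using e tt zz m by (auto simp: r_def)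
      then have "0 < h" "h < e" "h < t0 - (T - \<tau>)" "h < r" by (auto simp: h_def min_def)
      then have h: "0 < h" "h < e" "h < t0 - (T - \<tau>)" "h < (z0 - s t0) / m" by (auto simp: r_def)
      have "s (t0 - h) = s t0 + m * h" by (simp add: s_def algebra_simps)
      also have "\<dots> \<le> z0" using h(4) m by (simp add: field_simps)
      finally have "\<Psi> z0 t0 \<le> \<Psi> z0 (t0 - h)" using min[OF z0, of "t0 - h"] h tt by auto
      then show False using e(2)[of h] h tt by auto
    qed
    moreover obtain b c where bc: "\<bar>b\<bar> \<le> B" "\<bar>c\<bar> \<le> B" "wt z0 t0 = w2 z0 t0 + b * w1 z0 t0 + c * w z0 t0"
      using eq[OF z0 t0] by blast
    have E1: "E z0 t0 \<ge> 1" using zz \<alpha> by (simp add: E_def)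
    have "b * w1 z0 t0 \<ge> - B * w1 z0 t0" using bc(1) w1 \<epsilon> \<alpha> E1 by (intro mult_right_mono) auto
    moreover have "c * (\<epsilon> * (E z0 t0 - 1)) \<ge> - B * (\<epsilon> * (E z0 t0 - 1))" using bc(2) \<epsilon> E1 by (intro mult_right_mono) auto
    moreover have "w z0 t0 = \<psi> z0 t0 + \<epsilon> * (E z0 t0 - 1)" by (simp add: \<psi>_def)
    ultimately have "c * \<psi> z0 t0 + (\<epsilon> * (\<alpha> * (\<alpha> * E z0 t0)) - B * (\<epsilon> * (\<alpha> * E z0 t0)) - B * (\<epsilon> * (E z0 t0 - 1)) - \<epsilon> * (\<alpha> * m * E z0 t0))
        \<le> (B + 1) * \<psi> z0 t0"
      using w1 w2 bc(3) by (simp add: algebra_simps)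
    moreover have "\<epsilon> * (\<alpha> * (\<alpha> * E z0 t0)) - B * (\<epsilon> * (\<alpha> * E z0 t0)) - B * (\<epsilon> * (E z0 t0 - 1)) - \<epsilon> * (\<alpha> * m * E z0 t0)
       = \<epsilon> * (E z0 t0 * (\<alpha> * \<alpha> - B * \<alpha> - B - \<alpha> * m)) + B * \<epsilon>"
      by (simp add: algebra_simps)
    moreover have "\<epsilon> * (E z0 t0 * (\<alpha> * \<alpha> - B * \<alpha> - B - \<alpha> * m)) + B * \<epsilon> > 0"
      using \<epsilon> E1 \<alpha> B by (intro add_pos_nonneg mult_pos_pos) auto
    \<comment> \<open>At the minimum the first derivative equals that of the barrier, the second is
      at least as large, and the time derivative of \<Psi> is nonpositive; the strict subsolution
      makes these incompatible with a negative value.\<close>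
    ultimately have "(B + 1 - c) * \<psi> z0 t0 > 0" by (simp add: algebra_simps)
    moreover have "B + 1 - c > 0" using bc(2) by simp
    ultimately show False using neg by (simp add: zero_less_mult_iff)
  qed
  then have "\<Psi> z0 t0 \<ge> 0" by (simp add: \<Psi>_def)
  then have "\<Psi> z T \<ge> 0" using min[of z T] z \<tau> sT by auto
  then have "\<psi> z T \<ge> 0" by (simp add: \<Psi>_def zero_le_mult_iff)
  moreover have "E z T > 1" using z sT \<alpha> by (simp add: E_def)
  then have "\<epsilon> * (E z T - 1) > 0" using \<epsilon> by simp
  ultimately show ?thesis by (simp add: \<psi>_def)
qed

section \<open>Concavity and evolution near every interior point, without a chart\<close>

context oval
begin

lemma oval_chart_exists:
  assumes c: "c \<in> A"
  shows "\<exists>U v O1 gx. oval_chart A g \<rho> zmax F G P Fx Gx UF c U v O1 gx"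
proof -
  have "smooth_on (snd c \<circ> (\<lambda>(t, q). pmap t q)) ({(t, q). t \<le> 0 \<and> q \<in> slab t} \<inter> (\<lambda>(t, q). pmap t q) -` fst c)"
    using smooth_P c unfolding smooth_into_def by blast
  then obtain U v where U: "open U" "{(t, q). t \<le> 0 \<and> q \<in> slab t} \<inter> (\<lambda>(t, q). pmap t q) -` fst c \<subseteq> U"
    "Cinf v U" "\<forall>x\<in>{(t, q). t \<le> 0 \<and> q \<in> slab t} \<inter> (\<lambda>(t, q). pmap t q) -` fst c. v x = (snd c \<circ> (\<lambda>(t, q). pmap t q)) x"
    unfolding smooth_on_iff by blast
  have "smooth_on (\<lambda>(t, x). g t c x) ({..0} \<times> chart_image c)"
    using rf c unfolding ancient_ricci_flow_def by blast
  then obtain O1 gx where O1: "open O1" "{..0} \<times> chart_image c \<subseteq> O1" "Cinf gx O1"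
    "\<forall>x\<in>{..0} \<times> chart_image c. gx x = (\<lambda>(t, x). g t c x) x"
    unfolding smooth_on_iff by blast
  have "oval_chart A g \<rho> zmax F G P Fx Gx UF c U v O1 gx"
  proof (unfold_locales)
    fix t :: real and q assume "t \<le> 0" "q \<in> Nc c t"
    then have "(t, q) \<in> {(t, q). t \<le> 0 \<and> q \<in> slab t} \<inter> (\<lambda>(t, q). pmap t q) -` fst c" by (auto simp: Nc_def)
    then show "(t, q) \<in> U \<and> v (t, q) = snd c (pmap t q)" using U by auto
  next
    fix t :: real and x assume "t \<le> 0" "x \<in> chart_image c"
    then show "(t, x) \<in> O1 \<and> gx (t, x) = g t c x" using O1 by auto
  qed (use c U O1 in auto)
  then show ?thesis by blast
qed

lemma chart_point:
  fixes i0 :: 'k and j0 :: 'l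
  assumes t: "t \<le> 0" and z: "0 < z" "z < zmax t"
  defines "c \<equiv> chart_at A (pmap t (z, axis i0 1, axis j0 1))"
  shows "c \<in> A" "(z, axis i0 1, axis j0 1) \<in> Nc c t"
  using chart_at_works[OF smooth_structure_A] z by (auto simp: c_def Nc_def slab_def axis_eq_0_iff)

lemma concave:
  assumes t: "t \<le> 0" and z: "0 < z" "z < zmax t"
  shows "Fzz (z, t) \<le> 0" "Gzz (z, t) \<le> 0"
proof -
  \<comment> \<open>Any indices will do; \<open>undefined\<close> merely names elements of the two
    index types.\<close>
  define i0 :: 'k and j0 :: 'l where "i0 = undefined" and "j0 = undefined"
  define c where "c = chart_at A (pmap t (z, axis i0 1, axis j0 1))"
  note cp = chart_point[OF t z, of i0 j0, folded c_def]
  obtain U v O1 gx where "oval_chart A g \<rho> zmax F G P Fx Gx UF c U v O1 gx"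
    using oval_chart_exists[OF cp(1)] by blast
  then interpret oc: oval_chart A g \<rho> zmax F G P Fx Gx UF c U v O1 gx i0 j0 .
  have "curv_op_nonneg (g t c) (v (t, z, axis i0 1, axis j0 1))"
    using curv[OF t, of "pmap t (z, axis i0 1, axis j0 1)"] oc.v[OF t cp(2)]
    unfolding at_point_def Let_def c_def[symmetric] by simp
  from oc.concave_chart[OF t cp(2) this]
  show "Fzz (z, t) \<le> 0" "Gzz (z, t) \<le> 0" by auto
qed

text \<open>\<zeta> is a parameter because each chart provides one near a single point. Nothing has
  to be glued, since \<zeta> is eliminated from every final equation.\<close>

definition flow_equations :: "(real \<Rightarrow> real \<Rightarrow> real) \<Rightarrow> real \<Rightarrow> real \<Rightarrow> real \<Rightarrow> bool" where
  "flow_equations \<zeta> C z t \<longleftrightarrow>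
     0 < z \<and> z < zmax t \<and> \<bar>\<zeta> z t\<bar> \<le> C \<and>
     ((\<lambda>z. \<zeta> z t) has_real_derivative
      - (real CARD('k) - 1) * Fzz (z, t) / Fx (z, t)
      - (real CARD('l) - 1) * Gzz (z, t) / Gx (z, t)) (at z) \<and>
     Gt (z, t) = \<zeta> z t * Gz (z, t) + Gzz (z, t)
      + (real CARD('k) - 1) * Fz (z, t) * Gz (z, t) / Fx (z, t)
      - (real CARD('l) - 2) * (1 - (Gz (z, t))\<^sup>2) / Gx (z, t)"

lemma local_evolution:
  assumes t0: "t0 \<le> 0" and z0: "0 < z0" "z0 < zmax t0"
  shows "\<exists>\<epsilon>>0. \<exists>\<zeta> C. \<forall>t\<le>0. \<forall>z. \<bar>t - t0\<bar> < \<epsilon> \<longrightarrow> \<bar>z - z0\<bar> < \<epsilon> \<longrightarrow>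
     flow_equations \<zeta> C z t"
proof -
  define i0 :: 'k and j0 :: 'l where "i0 = undefined" and "j0 = undefined"
  define c where "c = chart_at A (pmap t0 (z0, axis i0 1, axis j0 1))"
  note cp = chart_point[OF t0 z0, of i0 j0, folded c_def]
  obtain U v O1 gx where "oval_chart A g \<rho> zmax F G P Fx Gx UF c U v O1 gx"
    using oval_chart_exists[OF cp(1)] by blast
  then interpret oc: oval_chart A g \<rho> zmax F G P Fx Gx UF c U v O1 gx i0 j0 .
  obtain e1 C where e1: "e1 > 0" "\<And>z t. \<bar>t - t0\<bar> < e1 \<Longrightarrow> \<bar>z - z0\<bar> < e1 \<Longrightarrow> \<bar>oc.\<zeta> z t\<bar> \<le> C"
    using oc.\<zeta>_bounded[OF t0 cp(2)] by blast
  obtain e2 where e2: "e2 > 0" "\<And>t q. t \<le> 0 \<Longrightarrow> \<bar>t - t0\<bar> < e2 \<Longrightarrow> dist q (z0, axis i0 1, axis j0 1) < e2 \<Longrightarrow> q \<in> Nc c t"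
    using near_Nc[OF cp(1) t0 cp(2)] by blast
  have N: "(z, axis i0 1, axis j0 1) \<in> Nc c t" if "t \<le> 0" "\<bar>t - t0\<bar> < e2" "\<bar>z - z0\<bar> < e2" for z t
    using e2(2)[OF that(1,2), of "(z, axis i0 1, axis j0 1)"] that(3) by (simp add: dist_Pair_Pair dist_real_def)
  show ?thesis
  proof (rule exI[of _ "min e1 e2"], intro conjI exI[of _ oc.\<zeta>] exI[of _ C] allI impI)
    fix t z assume a: "t \<le> 0" "\<bar>t - t0\<bar> < min e1 e2" "\<bar>z - z0\<bar> < min e1 e2"
    then have n: "(z, axis i0 1, axis j0 1) \<in> Nc c t" using N by simp
    then have "0 < z" "z < zmax t" by (auto simp: Nc_def slab_def)
    moreover have "\<bar>oc.\<zeta> z t\<bar> \<le> C" using e1(2) a by simp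
    ultimately show "flow_equations oc.\<zeta> C z t"
      unfolding flow_equations_def using oc.evolution[OF a(1) n] by blast
  qed (use e1 e2 in auto)
qed

end

section \<open>Smooth functions of one variable\<close>

text \<open>A coinduction principle: in one variable \<open>iter_pd\<close> only iterates
  \<open>dird 1\<close>, so smoothness of \<open>f\<close> follows by placing it in a
  derivative-closed class of differentiable functions.\<close>

lemma Cinf_real_induct:
  fixes f :: "real \<Rightarrow> real"
  assumes "C f" "\<And>f x. C f \<Longrightarrow> x \<in> N \<Longrightarrow> f differentiable (at x)" "\<And>f. C f \<Longrightarrow> C (dird 1 f)"
  shows "Cinf f N"
proof -
  have "C f \<Longrightarrow> set bs \<subseteq> Basis \<Longrightarrow> x \<in> N \<Longrightarrow> iter_pd bs f differentiable (at x)" for bs x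
  proof (induction bs arbitrary: f rule: rev_induct)
    case (snoc b bs)
    then have "b = 1" by simp
    have "iter_pd (bs @ [b]) f = iter_pd bs (dird 1 f)" by (simp add: iter_pd_append dird_def \<open>b = 1\<close>)
    then show ?case using snoc.IH[OF assms(3)[OF snoc.prems(1)]] snoc.prems by simp
  qed (use assms(2) in auto)
  then show ?thesis using assms(1) unfolding Cinf_def by blast
qed

text \<open>Smoothness of all elements follows once the derivatives of the generators \<open>S\<close> stay in the ring.\<close>
inductive_set dring :: "real set \<Rightarrow> (real \<Rightarrow> real) set \<Rightarrow> (real \<Rightarrow> real) set" for N S where
  base: "f \<in> S \<Longrightarrow> f \<in> dring N S"
| add: "f \<in> dring N S \<Longrightarrow> g \<in> dring N S \<Longrightarrow> (\<And>x. x \<in> N \<Longrightarrow> h x = f x + g x) \<Longrightarrow> h \<in> dring N S"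
| mult: "f \<in> dring N S \<Longrightarrow> g \<in> dring N S \<Longrightarrow> (\<And>x. x \<in> N \<Longrightarrow> h x = f x * g x) \<Longrightarrow> h \<in> dring N S"

lemma Cinf_dring:
  assumes N: "open N" and S: "\<And>f x. f \<in> S \<Longrightarrow> x \<in> N \<Longrightarrow> f differentiable (at x)"
    "\<And>f. f \<in> S \<Longrightarrow> dird 1 f \<in> dring N S" and f: "f \<in> dring N S"
  shows "Cinf f N"
proof -
  have diff: "f differentiable (at x)" if "f \<in> dring N S" "x \<in> N" for f x
    using that
  proof (induction rule: dring.induct)
    case (add f g h)
    show ?case by (rule differentiable_cong_open[OF N add.prems, of "\<lambda>x. f x + g x"]) (use add in auto)
  next
    case (mult f g h)
    show ?case by (rule differentiable_cong_open[OF N mult.prems, of "\<lambda>x. f x * g x"]) (use mult in auto)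
  qed (rule S(1))
  have deriv: "dird 1 f \<in> dring N S" if "f \<in> dring N S" for f
    using that
  proof (induction rule: dring.induct)
    case (add f g h)
    show ?case
    proof (rule dring.add[OF add.IH])
      fix x assume x: "x \<in> N"
      have "dird 1 h x = dird 1 (\<lambda>x. f x + g x) x" using add.hyps(3) by (intro dird_cong_open[OF N x]) auto
      also have "\<dots> = dird 1 f x + dird 1 g x"
        by (rule dird_eqI[OF has_derivative_add]) (intro dird_has_derivative diff add.hyps x)+
      finally show "dird 1 h x = dird 1 f x + dird 1 g x" .
    qed
  next
    case (mult f g h)
    show ?case
    proof (rule dring.add[OF dring.mult[OF mult.hyps(1) mult.IH(2) refl] dring.mult[OF mult.IH(1) mult.hyps(2) refl]])
      fix x assume x: "x \<in> N"
      have "dird 1 h x = dird 1 (\<lambda>x. f x * g x) x" using mult.hyps(3) by (intro dird_cong_open[OF N x]) auto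
      also have "\<dots> = f x * dird 1 g x + dird 1 f x * g x"
        by (rule dird_eqI[OF has_derivative_mult]) (intro dird_has_derivative diff mult.hyps x)+
      finally show "dird 1 h x = f x * dird 1 g x + dird 1 f x * g x" .
    qed
  qed (rule S(2))
  show ?thesis
    by (rule Cinf_real_induct[of "\<lambda>f. f \<in> dring N S"]) (use f diff deriv in auto)
qed

text \<open>With the reciprocal \<open>inv\<close> as an extra generator, its derivative - H'
  (1/H)^2 is a polynomial in generators, so the ring is closed under differentiation.\<close>

lemma Cinf_log_derivative:
  fixes H :: "real \<Rightarrow> real"
  assumes N: "open N" and H: "Cinf H N" and nz: "\<And>x. x \<in> N \<Longrightarrow> H x \<noteq> 0"
  shows "Cinf (\<lambda>x. dird 1 H x / H x) N"
proof -
  define inv where "inv = (\<lambda>x. 1 / H x)"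
  define S where "S = {f. Cinf f N} \<union> {inv}"
  have di: "(inv has_derivative (\<lambda>v. - dird v H x * (inv x * inv x))) (at x)" if "x \<in> N" for x
    unfolding inv_def using nz[OF that] dird_has_derivative[OF Cinf_differentiable[OF H that]]
    by (auto intro!: derivative_eq_intros simp: field_simps power2_eq_square)
  have H1: "Cinf (dird 1 H) N" by (rule Cinf_dird[OF H]) simp
  have m1: "(\<lambda>x. - 1) \<in> dring N S"
  proof (rule dring.base)
    have "Cinf (\<lambda>x::real. c::real) N" for c
      by (rule Cinf_real_induct[of "\<lambda>f. \<exists>c. f = (\<lambda>x. c)"]) (auto simp: dird_def)
    then show "(\<lambda>x. - 1) \<in> S" by (simp add: S_def)
  qed
  have i: "inv \<in> dring N S" and h: "dird 1 H \<in> dring N S" using H1 by (auto simp: S_def intro: dring.base)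
  show ?thesis
  proof (rule Cinf_dring[OF N, of S])
    show "f differentiable at x" if "f \<in> S" "x \<in> N" for f x
      using that di Cinf_differentiable by (auto simp: S_def differentiable_def)
    show "dird 1 f \<in> dring N S" if "f \<in> S" for f
    proof (cases "f = inv")
      case True
      show ?thesis unfolding True
        by (rule dring.mult[OF dring.mult[OF m1 h refl] dring.mult[OF i i refl]])
           (use dird_eqI[OF di] in auto)
    next
      case False
      then have "Cinf (dird 1 f) N" using that by (auto simp: S_def intro!: Cinf_dird)
      then show ?thesis by (auto simp: S_def intro: dring.base)
    qed
    show "(\<lambda>x. dird 1 H x / H x) \<in> dring N S"
      by (rule dring.mult[OF h i]) (simp add: inv_def)
  qed
qed

lemma dird_real: "f differentiable (at x) \<Longrightarrow> (f has_real_derivative dird 1 f x) (at x within S)" for f :: "real \<Rightarrow> real"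
  using dird_line[of f 0 x 1 S] by (simp add: has_real_derivative_iff_has_vector_derivative)

lemma dird_real_eqI: "(f has_real_derivative d) (at x) \<Longrightarrow> dird 1 f x = d" for f :: "real \<Rightarrow> real"
  by (simp add: has_field_derivative_def dird_eqI[where f' = "(*) d"])

text \<open>Hadamard's lemma: the quotient is the integral of f'(s z) over s in [0, 1]. Each
  differentiation in z produces a factor s, so the derivative-closed class consists of the functions
  \<open>I n f\<close> with f smooth.\<close>

lemma hadamard_quotient:
  fixes f :: "real \<Rightarrow> real"
  assumes r: "r > 0" and f: "Cinf f {-r<..<r}" and f0: "f 0 = 0"
  obtains H where "Cinf H {-r<..<r}" "\<And>z. z \<in> {-r<..<r} \<Longrightarrow> f z = z * H z" "H 0 = dird 1 f 0"
proof -
  define N where "N = {-r<..<r}"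
  define I where "I n f z = integral {0..1} (\<lambda>s. s ^ n * f (s * z))" for n :: nat and f :: "real \<Rightarrow> real" and z
  have sz: "s * z \<in> N" if "s \<in> {0..1}" "z \<in> N" for s z
  proof -
    have "\<bar>s * z\<bar> \<le> 1 * \<bar>z\<bar>" unfolding abs_mult using that by (intro mult_right_mono) auto
    then show ?thesis using that by (auto simp: N_def abs_less_iff)
  qed
  have cont: "continuous_on (N \<times> {0..1}) (\<lambda>(z, s). s ^ n * f (s * z))" if "Cinf f N" for f n
  proof -
    have "continuous_on (N \<times> {0..1}) (\<lambda>p. f (snd p * fst p))"
      by (rule continuous_on_compose2[OF Cinf_continuous_on[OF that]]) (use sz in \<open>auto intro!: continuous_intros\<close>)
    then show ?thesis unfolding case_prod_beta' by (intro continuous_intros)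
  qed
  have cont1: "continuous_on {0..1} (\<lambda>s. s ^ n * f (s * z))" if "Cinf f N" "z \<in> N" for f n z
  proof -
    have "continuous_on {0..1} (\<lambda>s. f (s * z))"
      by (rule continuous_on_compose2[OF Cinf_continuous_on[OF that(1)]]) (use sz that in \<open>auto intro!: continuous_intros\<close>)
    then show ?thesis by (intro continuous_intros)
  qed
  have dI: "(I n f has_real_derivative I (Suc n) (dird 1 f) z) (at z)" if F: "Cinf f N" and z: "z \<in> N" for f n z
  proof -
    have F1: "Cinf (dird 1 f) N" by (rule Cinf_dird[OF F]) simp
    have "((\<lambda>z. integral (cbox 0 1) (\<lambda>s. s ^ n * f (s * z))) has_field_derivative
        integral (cbox 0 1) (\<lambda>s. s ^ Suc n * dird 1 f (s * z))) (at z within N)"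
    proof (rule leibniz_rule_field_derivative)
      fix x t :: real assume x: "x \<in> N" "t \<in> cbox 0 1"
      have "(f has_real_derivative dird 1 f (t * x)) (at (t * x))"
        using dird_real[OF Cinf_differentiable[OF F sz]] x by simp
      then have "((\<lambda>x. f (t * x)) has_real_derivative dird 1 f (t * x) * t) (at x within N)"
        by (rule DERIV_chain2[where f = f]) (auto intro!: derivative_eq_intros)
      then show "((\<lambda>x. t ^ n * f (t * x)) has_real_derivative t ^ Suc n * dird 1 f (t * x)) (at x within N)"
        by (auto intro!: derivative_eq_intros)
    next
      show "(\<lambda>s. s ^ n * f (s * x)) integrable_on cbox 0 1" if "x \<in> N" for x
        using integrable_continuous_real[OF cont1[OF F that]] by simp
      show "continuous_on (N \<times> cbox 0 1) (\<lambda>(x, t). t ^ Suc n * dird 1 f (t * x))"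
        using cont[OF F1, of "Suc n"] by simp
    qed (use z in \<open>auto simp: N_def\<close>)
    moreover have "at z within N = at z" using z by (intro at_within_open) (auto simp: N_def)
    ultimately show ?thesis unfolding I_def[abs_def] by simp
  qed
  have CI: "Cinf (I 0 (dird 1 f)) N"
  proof (rule Cinf_real_induct[of "\<lambda>h. \<exists>n f. Cinf f N \<and> (\<forall>x\<in>N. h x = I n f x)"])
    have "Cinf (dird 1 f) N" by (rule Cinf_dird) (use f in \<open>simp_all add: N_def\<close>)
    then show "\<exists>n fa. Cinf fa N \<and> (\<forall>x\<in>N. I 0 (dird 1 f) x = I n fa x)" by blast
  next
    fix h x assume h: "\<exists>n f. Cinf f N \<and> (\<forall>x\<in>N. h x = I n f x)" and x: "x \<in> N"
    then obtain n f where nf: "Cinf f N" "\<forall>x\<in>N. h x = I n f x" by blast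
    show "h differentiable at x"
      by (rule differentiable_cong_open[of N x "I n f"])
         (use nf x dI[OF nf(1) x] in \<open>auto simp: N_def real_differentiable_def\<close>)
  next
    fix h assume h: "\<exists>n f. Cinf f N \<and> (\<forall>x\<in>N. h x = I n f x)"
    then obtain n f where nf: "Cinf f N" "\<forall>x\<in>N. h x = I n f x" by blast
    have "dird 1 h x = I (Suc n) (dird 1 f) x" if x: "x \<in> N" for x
    proof -
      have "dird 1 h x = dird 1 (I n f) x" by (rule dird_cong_open[of N]) (use nf x in \<open>auto simp: N_def\<close>)
      then show ?thesis using dird_real_eqI[OF dI[OF nf(1) x]] by simp
    qed
    moreover have "Cinf (dird 1 f) N" by (rule Cinf_dird[OF nf(1)]) simp
    ultimately show "\<exists>n f. Cinf f N \<and> (\<forall>x\<in>N. dird 1 h x = I n f x)" by blast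
  qed
  have eq: "f z = z * I 0 (dird 1 f) z" if z: "z \<in> N" for z
  proof -
    have "((\<lambda>s. dird 1 f (s * z) * z) has_integral f (1 * z) - f (0 * z)) {0..1}"
    proof (rule fundamental_theorem_of_calculus)
      fix s :: real assume s: "s \<in> {0..1}"
      have "(f has_real_derivative dird 1 f (s * z)) (at (s * z))"
        using dird_real[OF Cinf_differentiable[OF f]] sz[OF s z] by (simp add: N_def)
      then show "((\<lambda>s. f (s * z)) has_vector_derivative dird 1 f (s * z) * z) (at s within {0..1})"
        unfolding has_real_derivative_iff_has_vector_derivative[symmetric]
        by (rule DERIV_chain2[where f = f]) (auto intro!: derivative_eq_intros)
    qed simp
    then have "((\<lambda>s. dird 1 f (s * z) * z) has_integral f z) {0..1}" using f0 by simp
    then have "integral {0..1} (\<lambda>s. dird 1 f (s * z) * z) = f z" by (rule integral_unique)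
    then show ?thesis by (simp add: I_def mult.commute)
  qed
  show ?thesis
    by (rule that[of "I 0 (dird 1 f)"]) (use CI eq in \<open>auto simp: N_def I_def\<close>)
qed

text \<open>The data at the two singular orbits. They anchor the monotone slopes F_z and G_z and
  normalise the formula at z = 0; \<open>odd\<close> supplies smoothness of F / z there.\<close>

locale oval_profile = oval A g \<rho> zmax F G P Fx Gx UF
  for A :: "('a::{t2_space,second_countable_topology}, 'n::finite) chart set"
    and g \<rho> zmax F G and P :: "real \<Rightarrow> real \<Rightarrow> real^'k::finite \<Rightarrow> real^'l::finite \<Rightarrow> 'a" and Fx Gx UF +
  assumes closed_ext: "t \<le> 0 \<Longrightarrow> 0 \<le> z \<Longrightarrow> z \<le> zmax t \<Longrightarrow> (z, t) \<in> UF \<and> Fx (z, t) = F z t \<and> Gx (z, t) = G z t"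
    and zpos: "t \<le> 0 \<Longrightarrow> zmax t > 0"
    and bdry: "t \<le> 0 \<Longrightarrow> F 0 t = 0 \<and> G (zmax t) t = 0 \<and> F (zmax t) t > 0"
    and bdry1: "t \<le> 0 \<Longrightarrow> Fz (0, t) = 1 \<and> Gz (0, t) = 0 \<and>
       Fz (zmax t, t) = 0 \<and> Gz (zmax t, t) = - 1"
    and odd: "t \<le> 0 \<Longrightarrow> smooth_on (\<lambda>z. sgn z * F \<bar>z\<bar> t) {- zmax t<..<zmax t}"
begin

lemma Fz_Gz_antimono:
  assumes t: "t \<le> 0" and z: "0 \<le> z" "z \<le> z'" "z' \<le> zmax t"
  shows "Fz (z', t) \<le> Fz (z, t)" "Gz (z', t) \<le> Gz (z, t)"
proof -
  have U: "(y, t) \<in> UF" if "y \<in> {z..z'}" for y using closed_ext[OF t] that z by auto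
  have d: "((\<lambda>z. Fz (z, t)) has_real_derivative Fzz (x, t)) (at x)" "((\<lambda>z. Gz (z, t)) has_real_derivative Gzz (x, t)) (at x)"
      "Fzz (x, t) \<le> 0" "Gzz (x, t) \<le> 0" if "z < x" "x < z'" for x
    using dz(3,4)[OF U, of x UNIV] concave[OF t, of x] that z by auto
  show "Fz (z', t) \<le> Fz (z, t)"
    by (rule DERIV_nonpos_imp_decreasing_open[OF z(2) _ DERIV_continuous_on[OF dz(3)[OF U]]]) (use d(1,3) in blast)
  show "Gz (z', t) \<le> Gz (z, t)"
    by (rule DERIV_nonpos_imp_decreasing_open[OF z(2) _ DERIV_continuous_on[OF dz(4)[OF U]]]) (use d(2,4) in blast)
qed

lemma Fz_nonneg: "t \<le> 0 \<Longrightarrow> 0 \<le> z \<Longrightarrow> z \<le> zmax t \<Longrightarrow> Fz (z, t) \<ge> 0"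
  using Fz_Gz_antimono(1)[of t z "zmax t"] bdry1[of t] by simp

lemma Gz_nonpos: "t \<le> 0 \<Longrightarrow> 0 \<le> z \<Longrightarrow> z \<le> zmax t \<Longrightarrow> Gz (z, t) \<le> 0"
  using Fz_Gz_antimono(2)[of t 0 z] bdry1[of t] by simp

text \<open>The z-derivative of the equation for G_t. The second derivative of F occurs in \<zeta>_z
  and in the derivative of F_z / F with opposite signs and cancels; the rest is linear in G_zz and
  G_z.\<close>

lemma Gz_equation:
  assumes t0: "t0 \<le> 0" and z0: "0 < z0" "z0 < zmax t0"
  shows "\<exists>\<epsilon>>0. \<exists>C. \<forall>t\<le>0. \<forall>z. \<bar>t - t0\<bar> < \<epsilon> \<longrightarrow> \<bar>z - z0\<bar> < \<epsilon> \<longrightarrow>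
    (\<exists>b c. \<bar>b\<bar> \<le> C \<and> \<bar>c\<bar> \<le> C \<and> dird (0, 1) (Gz) (z, t)
       = dird (1, 0) (Gzz) (z, t) + b * Gzz (z, t) + c * Gz (z, t))"
proof -
  define K L where "K = real CARD('k) - 1" and "L = real CARD('l) - 1"
  \<comment> \<open>The last summand stems from the G_zz term of \<zeta>_z and is counted as drift;
    \<zeta> itself is added to \<open>b\<close> below.\<close>
  define b where "b p = K * Fz p / Fx p + 2 * (L - 1) * Gz p / Gx p - L * Gz p / Gx p" for p
  define c where "c p = - K * (Fz p)\<^sup>2 / (Fx p)\<^sup>2 + (L - 1) * (1 - (Gz p)\<^sup>2) / (Gx p)\<^sup>2" for p
  have B: "(1::real, 0::real) \<in> Basis" "(0::real, 1::real) \<in> Basis" by (auto intro: Basis_prodI)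
  have C1: "Cinf Fz UF" "Cinf Gz UF" by (intro Cinf_dird ext B)+
  have C2: "Cinf Gzz UF" by (intro Cinf_dird C1 B)
  have in0: "(z0, t0) \<in> UF" "Fx (z0, t0) > 0" "Gx (z0, t0) > 0" using ext(4)[OF t0 z0] pos[OF t0 z0] by auto
  have ic: "isCont f (z0, t0)" if "Cinf f UF" for f :: "real \<times> real \<Rightarrow> real"
    using Cinf_differentiable[OF that in0(1)] differentiable_imp_continuous_within by blast
  have "isCont b (z0, t0)" "isCont c (z0, t0)"
    unfolding b_def c_def using in0(2,3)
    by (auto intro!: continuous_intros ic[OF ext(2)] ic[OF ext(3)] ic[OF C1(1)] ic[OF C1(2)])
  then obtain e1 Cb e2 Cc where e12: "e1 > 0" "e2 > 0"
    "\<And>z t. \<bar>t - t0\<bar> < e1 \<Longrightarrow> \<bar>z - z0\<bar> < e1 \<Longrightarrow> \<bar>b (z, t)\<bar> \<le> Cb"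
    "\<And>z t. \<bar>t - t0\<bar> < e2 \<Longrightarrow> \<bar>z - z0\<bar> < e2 \<Longrightarrow> \<bar>c (z, t)\<bar> \<le> Cc"
    using isCont_locally_bounded[where f = b] isCont_locally_bounded[where f = c] by metis
  have L2: "real CARD('l) - 2 = L - 1" by (simp add: L_def)
  obtain e3 \<zeta> C where e3: "e3 > 0" and ev0: "\<And>t z. t \<le> 0 \<Longrightarrow> \<bar>t - t0\<bar> < e3 \<Longrightarrow> \<bar>z - z0\<bar> < e3 \<Longrightarrow> flow_equations \<zeta> C z t"
    using local_evolution[OF t0 z0] by blast
  note ev = ev0[unfolded flow_equations_def L2, folded K_def L_def]
  show ?thesis
  proof (rule exI[of _ "min e1 (min e2 e3)"], rule conjI, use e12 e3 in simp,
      rule exI[of _ "C + Cb + Cc"], rule allI, rule impI, rule allI, rule impI, rule impI)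
    fix t z assume a: "t \<le> 0" "\<bar>t - t0\<bar> < min e1 (min e2 e3)" "\<bar>z - z0\<bar> < min e1 (min e2 e3)"
    have bd: "\<bar>b (z, t)\<bar> \<le> Cb" "\<bar>c (z, t)\<bar> \<le> Cc" using e12 a by auto
    have evz: "0 < z" "z < zmax t" "\<bar>\<zeta> z t\<bar> \<le> C"
      and d\<zeta>: "((\<lambda>z. \<zeta> z t) has_real_derivative - K * Fzz (z, t) / Fx (z, t) - L * Gzz (z, t) / Gx (z, t)) (at z)"
      using ev[of t z] a by auto
    have U: "(z, t) \<in> UF" and ps: "Fx (z, t) > 0" "Gx (z, t) > 0" using ext(4)[OF a(1) evz(1,2)] pos[OF a(1) evz(1,2)] by auto
    have dF: "((\<lambda>z. Fx (z, t)) has_real_derivative Fz (z, t)) (at z)" "((\<lambda>z. Fz (z, t)) has_real_derivative Fzz (z, t)) (at z)"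
      and dG: "((\<lambda>z. Gx (z, t)) has_real_derivative Gz (z, t)) (at z)" "((\<lambda>z. Gz (z, t)) has_real_derivative Gzz (z, t)) (at z)"
      using dz[OF U] by auto
    have dG2: "((\<lambda>z. Gzz (z, t)) has_real_derivative dird (1, 0) Gzz (z, t)) (at z)"
      unfolding has_real_derivative_iff_has_vector_derivative
      by (rule has_vector_derivative_slice_fst[OF Cinf_differentiable[OF C2 U]])
    define R where "R z = \<zeta> z t * Gz (z, t) + Gzz (z, t) + K * Fz (z, t) * Gz (z, t) / Fx (z, t)
      - (L - 1) * (1 - (Gz (z, t))\<^sup>2) / Gx (z, t)" for z
    have "(R has_real_derivative (- K * Fzz (z, t) / Fx (z, t) - L * Gzz (z, t) / Gx (z, t)) * Gz (z, t) + \<zeta> z t * Gzz (z, t) + dird (1, 0) Gzz (z, t)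
       + ((K * Fzz (z, t) * Gz (z, t) + K * Fz (z, t) * Gzz (z, t)) * Fx (z, t) - K * Fz (z, t) * Gz (z, t) * Fz (z, t)) / (Fx (z, t))\<^sup>2
       - ((L - 1) * (- 2 * Gz (z, t) * Gzz (z, t)) * Gx (z, t) - (L - 1) * (1 - (Gz (z, t))\<^sup>2) * Gz (z, t)) / (Gx (z, t))\<^sup>2) (at z)"
      unfolding R_def using ps
      by (auto intro!: derivative_eq_intros dF dG dG2 d\<zeta> simp: power2_eq_square) (simp add: algebra_simps)
    moreover have "((\<lambda>z. Gt (z, t)) has_real_derivative dird (1, 0) (Gt) (z, t)) (at z)"
      unfolding has_real_derivative_iff_has_vector_derivative
      by (rule has_vector_derivative_slice_fst[OF Cinf_differentiable[OF Cinf_dird[OF ext(3) B(2)] U]])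
    then have "(R has_real_derivative dird (1, 0) (Gt) (z, t)) (at z)"
    proof (rule has_field_derivative_transform_within_open[of _ _ _ "ball z0 e3"])
      show "Gt (y, t) = R y" if "y \<in> ball z0 e3" for y
        using ev[of t y] that a by (simp add: R_def dist_real_def abs_minus_commute)
    qed (use a in \<open>auto simp: dist_real_def abs_minus_commute\<close>)
    ultimately have "dird (1, 0) (Gt) (z, t) = (- K * Fzz (z, t) / Fx (z, t) - L * Gzz (z, t) / Gx (z, t)) * Gz (z, t) + \<zeta> z t * Gzz (z, t) + dird (1, 0) Gzz (z, t)
       + ((K * Fzz (z, t) * Gz (z, t) + K * Fz (z, t) * Gzz (z, t)) * Fx (z, t) - K * Fz (z, t) * Gz (z, t) * Fz (z, t)) / (Fx (z, t))\<^sup>2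
       - ((L - 1) * (- 2 * Gz (z, t) * Gzz (z, t)) * Gx (z, t) - (L - 1) * (1 - (Gz (z, t))\<^sup>2) * Gz (z, t)) / (Gx (z, t))\<^sup>2"
      using DERIV_unique by blast
    also have "\<dots> = dird (1, 0) Gzz (z, t) + (\<zeta> z t + b (z, t)) * Gzz (z, t) + c (z, t) * Gz (z, t)"
      using ps by (simp add: b_def c_def divide_simps power2_eq_square) (simp add: algebra_simps)
    finally have "dird (0, 1) Gz (z, t) = dird (1, 0) Gzz (z, t) + (\<zeta> z t + b (z, t)) * Gzz (z, t) + c (z, t) * Gz (z, t)"
      using dird_commute[OF ext(1) U ext(3) B(2,1)] by simp
    then show "\<exists>b c. \<bar>b\<bar> \<le> C + Cb + Cc \<and> \<bar>c\<bar> \<le> C + Cb + Cc \<and> dird (0, 1) (Gz) (z, t)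
       = dird (1, 0) (Gzz) (z, t) + b * Gzz (z, t) + c * Gz (z, t)"
      using bd evz(3)
      by (intro exI[of _ "\<zeta> z t + b (z, t)"] exI[of _ "c (z, t)"]) auto
  qed
qed

end

section \<open>The representation formula\<close>

context oval_profile
begin

text \<open>At \<open>zmax t0\<close> the slope is - 1, so it is strictly negative at some
  \<open>z2\<close> shortly before and for a short period of time. The strong maximum principle for
  - G_z spreads this to \<open>z0\<close>.\<close>

lemma Gz_neg:
  assumes t0: "t0 \<le> 0" and z0: "0 < z0" "z0 < zmax t0"
  shows "Gz (z0, t0) < 0"
proof -
  have B: "(1::real, 0::real) \<in> Basis" by (rule Basis_prodI)
  have C1: "Cinf Gz UF" by (intro Cinf_dird ext B)
  have ic: "isCont Gz p" if "p \<in> UF" for p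
    using Cinf_differentiable[OF C1 that] differentiable_imp_continuous_within by blast
  have near: "\<exists>d>0. \<forall>p. dist p q < d \<longrightarrow> Gz p < Gz q + e" if q: "q \<in> UF" and e: "e > 0" for q e
  proof -
    obtain d where d: "d > 0" "\<forall>p. dist p q < d \<longrightarrow> dist (Gz p) (Gz q) < e"
      using ic[OF q] e unfolding continuous_at_eps_delta by blast
    have "Gz p < Gz q + e" if "dist p q < d" for p
      using d(2)[rule_format, OF that] by (simp add: dist_real_def)
    then show ?thesis using d(1) by blast
  qed
  have UFc: "(z, t) \<in> UF" if "t \<le> 0" "0 \<le> z" "z \<le> zmax t" for z t using closed_ext that by blast
  obtain d1 where d1: "d1 > 0" "\<And>p. dist p (zmax t0, t0) < d1 \<Longrightarrow> Gz p < - 1 + 1/2"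
    using near[OF UFc[OF t0], of "zmax t0" "1/2"] zpos[OF t0] bdry1[OF t0] by auto
  \<comment> \<open>Beyond \<open>z0\<close>, inside the interval, and close enough to its end for
    the slope to be below - 1/2.\<close>
  define z2 where "z2 = max ((z0 + zmax t0) / 2) (zmax t0 - d1 / 2)"
  have z2: "z0 < z2" "z2 < zmax t0" "zmax t0 - z2 < d1" using z0 d1(1) by (auto simp: z2_def max_def field_simps)
  have Gz2: "Gz (z2, t0) < - 1/2" using d1(2)[of "(z2, t0)"] z2 by (simp add: dist_Pair_Pair dist_real_def)
  have z2U: "(z2, t0) \<in> UF" using UFc[OF t0, of z2] z2 z0 by simp
  obtain d2 where d2: "d2 > 0" "\<And>p. dist p (z2, t0) < d2 \<Longrightarrow> Gz p < Gz (z2, t0) + 1/4"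
    using near[OF z2U, of "1/4"] by auto
  obtain d3 where d3: "d3 > 0" "\<And>t. t \<le> 0 \<Longrightarrow> \<bar>t - t0\<bar> < d3 \<Longrightarrow> z2 < zmax t"
  proof -
    have "zmax t0 - z2 > 0" using z2 by simp
    then obtain d where "d > 0" "\<forall>t\<in>{..0}. dist t t0 < d \<longrightarrow> dist (zmax t) (zmax t0) < zmax t0 - z2"
      using zmax t0 unfolding continuous_on_iff by (metis atMost_iff)
    then show ?thesis using that[of d] by (auto simp: dist_real_def abs_less_iff)
  qed
  \<comment> \<open>Short enough that the slope at \<open>z2\<close> stays below - 1/4 and that
    \<open>z2\<close> stays below \<open>zmax t\<close>.\<close>
  define \<tau> where "\<tau> = min d2 d3 / 2"
  have \<tau>: "\<tau> > 0" "\<tau> < d2" "\<tau> < d3" using d2 d3 by (auto simp: \<tau>_def)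
  \<comment> \<open>The maximum principle is strict only to the right of \<open>z1\<close>, so
    \<open>z1\<close> must lie below \<open>z0\<close>, yet away from the singular orbit.\<close>
  define z1 where "z1 = z0 / 2"
  define R where "R = {z1..z2} \<times> {t0-\<tau>..t0}"
  have R: "t \<le> 0" "0 < z" "z < zmax t" if "z \<in> {z1..z2}" "t \<in> {t0-\<tau>..t0}" for z t
  proof -
    show t: "t \<le> 0" using that t0 by auto
    show "0 < z" using that z0 by (auto simp: z1_def)
    show "z < zmax t" using d3(2)[OF t] that \<tau> by auto
  qed
  have RU: "(z, t) \<in> UF" if "z \<in> {z1..z2}" "t \<in> {t0-\<tau>..t0}" for z t using UFc R[OF that] by simp
  let ?eq = "\<lambda>C z t. \<exists>b c. \<bar>b\<bar> \<le> C \<and> \<bar>c\<bar> \<le> C \<and> dird (0, 1) Gz (z, t)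
       = dird (1, 0) (Gzz) (z, t) + b * Gzz (z, t) + c * Gz (z, t)"
  have ex: "\<forall>p\<in>R. \<exists>w. fst w > 0 \<and> (\<forall>t\<le>0. \<forall>z. \<bar>t - snd p\<bar> < fst w \<longrightarrow> \<bar>z - fst p\<bar> < fst w \<longrightarrow> ?eq (snd w) z t)"
  proof
    fix p assume "p \<in> R"
    then have p: "fst p \<in> {z1..z2}" "snd p \<in> {t0-\<tau>..t0}" by (auto simp: R_def)
    from Gz_equation[OF R(1)[OF p] R(2)[OF p] R(3)[OF p]]
    obtain e' C' where "e' > 0" "\<forall>t\<le>0. \<forall>z. \<bar>t - snd p\<bar> < e' \<longrightarrow> \<bar>z - fst p\<bar> < e' \<longrightarrow> ?eq C' z t"
      by (elim exE conjE) (rule that)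
    then show "\<exists>w. fst w > 0 \<and> (\<forall>t\<le>0. \<forall>z. \<bar>t - snd p\<bar> < fst w \<longrightarrow> \<bar>z - fst p\<bar> < fst w \<longrightarrow> ?eq (snd w) z t)"
      by (intro exI[of _ "(e', C')"]) simp
  qed
  obtain w where w: "\<forall>p\<in>R. fst (w p) > 0 \<and> (\<forall>t\<le>0. \<forall>z. \<bar>t - snd p\<bar> < fst (w p) \<longrightarrow> \<bar>z - fst p\<bar> < fst (w p) \<longrightarrow> ?eq (snd (w p)) z t)"
    using bchoice[OF ex] by (elim exE) (rule that)
  define e C where "e p = fst (w p)" and "C p = snd (w p)" for p
  have eC: "\<And>p. p \<in> R \<Longrightarrow> e p > 0"
      "\<And>p t z. p \<in> R \<Longrightarrow> t \<le> 0 \<Longrightarrow> \<bar>t - snd p\<bar> < e p \<Longrightarrow> \<bar>z - fst p\<bar> < e p \<Longrightarrow> ?eq (C p) z t"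
    using w unfolding e_def C_def by simp_all
  \<comment> \<open>The coefficient bounds are local. Finitely many neighbourhoods cover the
    rectangle, and the sum of their bounds serves everywhere.\<close>
  have "compact R" unfolding R_def by (intro compact_Times compact_Icc)
  moreover have "R \<subseteq> (\<Union>p\<in>R. ball p (e p))" using eC(1) by auto
  ultimately obtain Q where Q: "Q \<subseteq> R" "finite Q" "R \<subseteq> (\<Union>p\<in>Q. ball p (e p))"
    using compactE_image[of R R "\<lambda>p. ball p (e p)"] by auto
  define Bd where "Bd = (\<Sum>p\<in>Q. \<bar>C p\<bar>)"
  have eqB: "?eq Bd z t" if zt: "z \<in> {z1..z2}" "t \<in> {t0-\<tau>..t0}" for z t
  proof -
    obtain p where p: "p \<in> Q" "(z, t) \<in> ball p (e p)" using Q(3) zt unfolding R_def by blast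
    then have "\<bar>t - snd p\<bar> < e p" "\<bar>z - fst p\<bar> < e p"
      using dist_fst_le[of p "(z, t)"] dist_snd_le[of p "(z, t)"] by (auto simp: dist_real_def)
    moreover have "p \<in> R" using p(1) Q(1) by blast
    ultimately have "?eq (C p) z t" using eC(2) R(1)[OF zt] by blast
    then obtain b c where bc: "\<bar>b\<bar> \<le> C p" "\<bar>c\<bar> \<le> C p"
      "dird (0, 1) Gz (z, t) = dird (1, 0) (Gzz) (z, t) + b * Gzz (z, t) + c * Gz (z, t)"
      by (elim exE conjE) (rule that)
    have "C p \<le> Bd" using member_le_sum[of p Q "\<lambda>p. \<bar>C p\<bar>"] p Q by (simp add: Bd_def)
    then have "\<bar>b\<bar> \<le> Bd" "\<bar>c\<bar> \<le> Bd" using bc by auto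
    with bc(3) show ?thesis by blast
  qed
  have C2: "Cinf (Gzz) UF" by (intro Cinf_dird C1 B)
  have slice: "((\<lambda>z. f (z, t)) has_real_derivative dird (1, 0) f (z, t)) (at z)"
    if "Cinf f UF" "z \<in> {z1..z2}" "t \<in> {t0-\<tau>..t0}" for f z t
    unfolding has_real_derivative_iff_has_vector_derivative
    by (rule has_vector_derivative_slice_fst[OF Cinf_differentiable[OF that(1) RU[OF that(2,3)]]])
  have "0 < - Gz (z0, t0)"
  proof (rule strong_maximum_principle[of z1 z2 \<tau> "1/4" Bd t0 "\<lambda>z t. - Gz (z, t)" "\<lambda>z t. - Gzz (z, t)"
        "\<lambda>z t. - dird (1, 0) (Gzz) (z, t)" "\<lambda>z t. - dird (0, 1) Gz (z, t)"])
    show "0 \<le> Bd" by (simp add: Bd_def sum_nonneg)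
    fix z t assume a: "z \<in> {z1..z2}" "t \<in> {t0-\<tau>..t0}"
    show "((\<lambda>z. - Gz (z, t)) has_real_derivative - Gzz (z, t)) (at z)"
      using slice[OF C1 a] by (rule DERIV_minus)
    show "((\<lambda>z. - Gzz (z, t)) has_real_derivative - dird (1, 0) (Gzz) (z, t)) (at z)"
      using slice[OF C2 a] by (rule DERIV_minus)
    have "((\<lambda>t. Gz (z, t)) has_real_derivative dird (0, 1) Gz (z, t)) (at t within {..t0})"
      unfolding has_real_derivative_iff_has_vector_derivative
      by (rule has_vector_derivative_slice_snd[OF Cinf_differentiable[OF C1 RU[OF a]]])
    then show "((\<lambda>t. - Gz (z, t)) has_real_derivative - dird (0, 1) Gz (z, t)) (at t within {..t0})"
      by (rule DERIV_minus)
    obtain b c where "\<bar>b\<bar> \<le> Bd" "\<bar>c\<bar> \<le> Bd"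
      "dird (0, 1) Gz (z, t) = dird (1, 0) (Gzz) (z, t) + b * Gzz (z, t) + c * Gz (z, t)"
      using eqB[OF a] by (elim exE conjE) (rule that)
    then show "\<exists>b c. \<bar>b\<bar> \<le> Bd \<and> \<bar>c\<bar> \<le> Bd \<and> - dird (0, 1) Gz (z, t) =
       - dird (1, 0) (Gzz) (z, t) + b * - Gzz (z, t) + c * - Gz (z, t)"
      by (intro exI[of _ b] exI[of _ c]) simp
    show "0 \<le> - Gz (z, t)" using Gz_nonpos[of t z] R[OF a] by simp
  next
    show "1/4 \<le> - Gz (z2, t)" if "t \<in> {t0-\<tau>..t0}" for t
      using d2(2)[of "(z2, t)"] Gz2 that \<tau> by (auto simp: dist_Pair_Pair dist_real_def)
    have "continuous_on ({z1..z2} \<times> {t0-\<tau>..t0}) Gz"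
      by (rule continuous_on_subset[OF Cinf_continuous_on[OF C1]]) (use RU in auto)
    then have "continuous_on ({z1..z2} \<times> {t0-\<tau>..t0}) (\<lambda>p. - Gz p)" by (rule continuous_on_minus)
    then show "continuous_on ({z1..z2} \<times> {t0-\<tau>..t0}) (\<lambda>(z, t). - Gz (z, t))" by (simp add: case_prod_beta')
  qed (use z0 z2 \<tau> in \<open>auto simp: z1_def\<close>)
  then show ?thesis by simp
qed

lemma deriv_eq_near:
  assumes t: "t \<le> 0" and z: "0 < z" "z < zmax t"
    and f: "(f has_real_derivative d) (at z)" and eq: "\<And>s. 0 < s \<Longrightarrow> s < zmax t \<Longrightarrow> f s = h s"
  shows "(h has_real_derivative d) (at z)"
  by (rule has_field_derivative_transform_within_open[OF f, of "{0<..<zmax t}"]) (use z eq in auto)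

lemma derivs_G:
  assumes t: "t \<le> 0" and z: "0 < z" "z < zmax t"
  shows "d_z G z t = Gz (z, t)" "d_z (d_z G) z t = Gzz (z, t)"
    and "((\<lambda>s. G z s) has_vector_derivative Gt (z, t)) (at t within {..0})"
    and "d_t G z t = Gt (z, t)"
proof -
  have 1: "d_z G s t = Gz (s, t)" if "0 < s" "s < zmax t" for s
    unfolding d_z_def
    by (rule DERIV_imp_deriv, rule deriv_eq_near[OF t that dz(2)]) (use ext(4)[OF t] that in auto)
  then show "d_z G z t = Gz (z, t)" using z by simp
  show "d_z (d_z G) z t = Gzz (z, t)"
    unfolding d_z_def[of "d_z G"]
    by (rule DERIV_imp_deriv, rule deriv_eq_near[OF t z dz(4)]) (use ext(4)[OF t] z 1 in auto)
  have zU: "(z, t) \<in> UF" using ext(4)[OF t z] by blast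
  have 2: "((\<lambda>s. Gx (z, s)) has_vector_derivative Gt (z, t)) (at t within {..0})"
    by (rule has_vector_derivative_slice_snd[OF Cinf_differentiable[OF ext(3) zU]])
  have "zmax t - z > 0" using z by simp
  then obtain d where d: "d > 0" "\<forall>s\<in>{..0}. dist s t < d \<longrightarrow> dist (zmax s) (zmax t) < zmax t - z"
    using zmax t unfolding continuous_on_iff by (metis atMost_iff)
  show 3: "((\<lambda>s. G z s) has_vector_derivative Gt (z, t)) (at t within {..0})"
  proof (rule has_vector_derivative_transform_within[OF 2 d(1)])
    fix s assume s: "s \<in> {..0}" "dist s t < d"
    then have "z < zmax s" using d(2) by (force simp: dist_real_def)
    then show "Gx (z, s) = G z s" using ext(4)[of s z] s z by simp
  qed (use t in auto)
  show "d_t G z t = Gt (z, t)"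
    unfolding d_t_def by (rule vector_derivative_within[OF at_within_Iic_neq_bot[OF t] 3])
qed

text \<open>By \<open>Gz_neg\<close> the quotient may be formed, and near \<open>z\<close> it equals
  \<zeta> + K F_z / F. The local \<zeta> is only auxiliary: one differentiation replaces it by the
  Ricci term.\<close>

lemma Q_G_eq:
  assumes t: "t \<le> 0" and z: "0 < z" "z < zmax t"
    and k: "k = CARD('k)" and n: "real n = real CARD('k) + real CARD('l) - 1"
  shows "(\<lambda>s. inner_quotient n k G s t) differentiable (at z)"
    and "Q_G n k G z t = (Fz (z, t) / Fx (z, t))\<^sup>2"
proof -
  define K L where "K = real CARD('k) - 1" and "L = real CARD('l) - 1"
  have K: "K > 0" using dims by (simp add: K_def)
  have L2: "real CARD('l) - 2 = L - 1" by (simp add: L_def)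
  obtain e3 \<zeta> C where e3: "e3 > 0" and ev0: "\<And>s y. s \<le> 0 \<Longrightarrow> \<bar>s - t\<bar> < e3 \<Longrightarrow> \<bar>y - z\<bar> < e3 \<Longrightarrow> flow_equations \<zeta> C y s"
    using local_evolution[OF t z] by blast
  have ev: "0 < y" "y < zmax t" "((\<lambda>y. \<zeta> y t) has_real_derivative - K * Fzz (y, t) / Fx (y, t) - L * Gzz (y, t) / Gx (y, t)) (at y)"
     "Gt (y, t) = \<zeta> y t * Gz (y, t) + Gzz (y, t) + K * Fz (y, t) * Gz (y, t) / Fx (y, t)
      - (L - 1) * (1 - (Gz (y, t))\<^sup>2) / Gx (y, t)" if "\<bar>y - z\<bar> < e3" for y
    using ev0[OF t, unfolded flow_equations_def L2, folded K_def L_def, of y] that e3 by auto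
  have nk: "real n - real k - 1 = L - 1" "real n - real k = L" "real k - 1 = K" using n by (auto simp: k K_def L_def)
  have iq: "inner_quotient n k G y t = \<zeta> y t + K * Fz (y, t) / Fx (y, t)" if y: "\<bar>y - z\<bar> < e3" for y
  proof -
    note yz = ev(1,2)[OF y]
    have "Gz (y, t) \<noteq> 0" using Gz_neg[OF t yz] by simp
    moreover have "Gx (y, t) = G y t" using ext(4)[OF t yz] by simp
    ultimately show ?thesis
      unfolding inner_quotient_def nk derivs_G[OF t yz] ev(4)[OF y]
      by (simp add: field_simps)
  qed
  have Fpos: "Fx (z, t) > 0" "Gx (z, t) > 0" and zU: "(z, t) \<in> UF" and GG: "Gx (z, t) = G z t"
    using ext(4)[OF t z] pos[OF t z] by auto
  have d: "((\<lambda>y. \<zeta> y t + K * Fz (y, t) / Fx (y, t)) has_real_derivative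
     - K * Fzz (z, t) / Fx (z, t) - L * Gzz (z, t) / Gx (z, t) +
     (K * Fzz (z, t) * Fx (z, t) - K * Fz (z, t) * Fz (z, t)) / (Fx (z, t))\<^sup>2) (at z)"
    using Fpos dz[OF zU] e3
    by (auto intro!: derivative_eq_intros ev(3) simp: power2_eq_square)
  have d2: "((\<lambda>s. inner_quotient n k G s t) has_real_derivative
     - K * Fzz (z, t) / Fx (z, t) - L * Gzz (z, t) / Gx (z, t) +
     (K * Fzz (z, t) * Fx (z, t) - K * Fz (z, t) * Fz (z, t)) / (Fx (z, t))\<^sup>2) (at z)"
    by (rule has_field_derivative_transform_within_open[OF d, of "ball z e3"])
       (use e3 iq in \<open>auto simp: dist_real_def abs_minus_commute\<close>)
  then show "(\<lambda>s. inner_quotient n k G s t) differentiable (at z)"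
    using real_differentiable_def by blast
  show "Q_G n k G z t = (Fz (z, t) / Fx (z, t))\<^sup>2"
    unfolding Q_G_def nk d_z_def[of "inner_quotient n k G"] DERIV_imp_deriv[OF d2] derivs_G[OF t z] GG[symmetric]
    using Fpos K by (simp add: field_simps power2_eq_square)
qed

lemma sqrt_Q_G:
  assumes t: "t \<le> 0" and z: "0 < z" "z < zmax t"
    and k: "k = CARD('k)" and n: "real n = real CARD('k) + real CARD('l) - 1"
  shows "sqrt (Q_G n k G z t) = Fz (z, t) / Fx (z, t)"
  using Q_G_eq(2)[OF assms] Fz_nonneg[OF t, of z] ext(4)[OF t z] pos[OF t z] z by simp

text \<open>Concavity with F = 0 at the origin: the chord is at least as steep as the tangent. This
  makes F_z / F - 1/z nonpositive, so its integrability is automatically absolute.\<close>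

lemma F_le_linear:
  assumes t: "t \<le> 0" and z: "0 < z" "z \<le> zmax t"
  shows "z * Fz (z, t) \<le> F z t"
proof -
  have "((\<lambda>z. Fx (z, t)) has_real_derivative Fz (y, t)) (at y)" if "0 \<le> y" "y \<le> z" for y
    using dz(1) closed_ext[OF t, of y] that z by auto
  from MVT2[OF z(1) this] obtain y where y: "0 < y" "y < z" "Fx (z, t) - Fx (0, t) = (z - 0) * Fz (y, t)" by blast
  have "z * Fz (z, t) \<le> z * Fz (y, t)"
    using Fz_Gz_antimono(1)[OF t, of y z] y z by (intro mult_left_mono) auto
  then show ?thesis using y closed_ext[OF t, of 0] closed_ext[OF t, of z] z bdry[OF t] zpos[OF t] by simp
qed

lemma F_pos: "t \<le> 0 \<Longrightarrow> 0 < z \<Longrightarrow> z \<le> zmax t \<Longrightarrow> F z t > 0"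
  using pos[of t z] bdry[of t] by (cases "z = zmax t") auto

text \<open>\<open>r\<close> is F / z, continuous and positive on the closed interval with value 1
  at 0 because F_z = 1 there. Its logarithm is a primitive of the integrand, so the integral is ln
  (F / z); the two singular terms are never integrated separately.\<close>

lemma representation:
  assumes t: "t \<le> 0" and z: "0 < z" "z \<le> zmax t"
    and k: "k = CARD('k)" and n: "real n = real CARD('k) + real CARD('l) - 1"
  shows "(\<lambda>s. sqrt (Q_G n k G s t) - 1 / s) absolutely_integrable_on {0..z}" (is "?q absolutely_integrable_on _")
    and "F z t = F_formula n k G z t"
proof -
  define r where "r s = (if s = 0 then 1 else Fx (s, t) / s)" for s
  \<comment> \<open>Both endpoints get the value 0: \<open>Q_G\<close> uses two-sided derivatives,
    which need not have their intended values at the ends of the interval. Two points do not affect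
    the integral.\<close>
  define q where "q s = (if 0 < s \<and> s < z then Fz (s, t) / Fx (s, t) - 1 / s else 0)" for s
  have U: "(s, t) \<in> UF" "Fx (s, t) = F s t" if "s \<in> {0..z}" for s using closed_ext[OF t, of s] that z by auto
  have rpos: "r s > 0" if "s \<in> {0..z}" for s
    using that U[OF that] F_pos[OF t, of s] z by (auto simp: r_def)
  have F0: "Fx (0, t) = 0" using U(2)[of 0] z bdry[OF t] by simp
  have contr: "continuous_on {0..z} r"
    unfolding continuous_on_eq_continuous_within
  proof
    fix s assume s: "s \<in> {0..z}"
    have dF: "((\<lambda>z. Fx (z, t)) has_real_derivative Fz (s, t)) (at s within {0..z})"
      using dz(1)[OF U(1)[OF s]] .
    show "continuous (at s within {0..z}) r"
    proof (cases "s = 0")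
      case True
      have "((\<lambda>y. (Fx (y, t) - Fx (0, t)) / (y - 0)) \<longlongrightarrow> 1) (at 0 within {0..z})"
        using dF bdry1[OF t] unfolding True has_field_derivative_iff by simp
      then have "(r \<longlongrightarrow> 1) (at 0 within {0..z})"
        by (rule Lim_transform_eventually) (auto simp: r_def F0 eventually_at_filter)
      then show ?thesis unfolding True continuous_within by (simp add: r_def)
    next
      case False
      then have "continuous (at s within {0..z}) (\<lambda>s. Fx (s, t) / s)"
        using DERIV_continuous[OF dF] s by (intro continuous_intros) auto
      moreover have "\<forall>\<^sub>F y in at s within {0..z}. Fx (y, t) / y = r y"
      proof -
        have "\<forall>\<^sub>F y in at s within {0..z}. y \<noteq> 0"
          using False tendsto_imp_eventually_ne[OF tendsto_ident_at] by blast
        then show ?thesis by eventually_elim (simp add: r_def)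
      qed
      ultimately have "(r \<longlongrightarrow> Fx (s, t) / s) (at s within {0..z})"
        unfolding continuous_within by (rule Lim_transform_eventually)
      then show ?thesis
        unfolding continuous_within using False by (simp add: r_def)
    qed
  qed
  have hi: "(q has_integral (ln (r z) - ln (r 0))) {0..z}"
  proof (rule fundamental_theorem_of_calculus_interior)
    show "continuous_on {0..z} (\<lambda>s. ln (r s))"
      using rpos by (intro continuous_on_ln contr) force
    fix s assume s: "s \<in> {0<..<z}"
    then have s': "s \<in> {0..z}" by auto
    have Fp: "Fx (s, t) > 0" using U(2)[OF s'] F_pos[OF t, of s] s z by auto
    have "((\<lambda>s. ln (Fx (s, t) / s)) has_real_derivative q s) (at s)"
      using s Fp dz(1)[OF U(1)[OF s']] by (auto intro!: derivative_eq_intros simp: q_def field_simps)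
    then have "((\<lambda>s. ln (r s)) has_real_derivative q s) (at s)"
      by (rule has_field_derivative_transform_within_open[of _ _ _ "{0<..}"]) (use s in \<open>auto simp: r_def\<close>)
    then show "((\<lambda>s. ln (r s)) has_vector_derivative q s) (at s)"
      by (simp add: has_real_derivative_iff_has_vector_derivative)
  qed (use z in simp)
  have qeq: "q s = ?q s" if "s \<in> {0..z} - {0, z}" for s
    using that sqrt_Q_G[OF t _ _ k n, of s] z by (auto simp: q_def)
  have qle: "q s \<le> 0" if "s \<in> {0..z}" for s
  proof (cases "0 < s \<and> s < z")
    case True
    then have "s * Fz (s, t) \<le> Fx (s, t)" "Fx (s, t) > 0"
      using F_le_linear[OF t, of s] F_pos[OF t, of s] U(2)[OF that] z by auto
    then show ?thesis using True by (simp add: q_def field_simps)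
  qed (auto simp: q_def)
  have neg: "negligible {0, z}" by simp
  have "q absolutely_integrable_on {0..z}"
  proof -
    have "(\<lambda>s. - q s) integrable_on {0..z}" using hi by (intro integrable_neg) blast
    then have "(\<lambda>s. norm (q s)) integrable_on {0..z}"
      by (rule integrable_eq) (use qle in auto)
    then show ?thesis using hi unfolding absolutely_integrable_on_def by blast
  qed
  then show "?q absolutely_integrable_on {0..z}"
    by (rule absolutely_integrable_spike[OF _ neg]) (use qeq in auto)
  have "(?q has_integral (ln (r z) - ln (r 0))) {0..z}"
    by (rule has_integral_spike[OF neg _ hi]) (use qeq in auto)
  then have "integral {0..z} ?q = ln (F z t / z)"
    using U(2)[of z] z by (simp add: integral_unique r_def)
  then show "F z t = F_formula n k G z t"
    unfolding F_formula_def using z F_pos[OF t z] by simp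
qed

text \<open>By Hadamard's lemma the odd reflection of F is z H(z) with H smooth and H(0) = 1. Then
  F_z / F = 1/z + H'/H, so the integrand is the logarithmic derivative of H.\<close>

lemma integrand_smooth:
  assumes t: "t \<le> 0" and k: "k = CARD('k)" and n: "real n = real CARD('k) + real CARD('l) - 1"
  shows "\<exists>\<phi>. smooth_on \<phi> {0..<zmax t} \<and> (\<forall>z\<in>{0<..<zmax t}. \<phi> z = sqrt (Q_G n k G z t) - 1 / z)"
proof -
  define N where "N = {- zmax t<..<zmax t}"
  have zp: "zmax t > 0" using zpos[OF t] .
  obtain V h where V: "open V" "N \<subseteq> V" "Cinf h V" "\<forall>x\<in>N. h x = sgn x * F \<bar>x\<bar> t"
    using odd[OF t] unfolding smooth_on_iff N_def by blast
  have hN: "Cinf h N" using Cinf_subset V by blast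
  have hz: "h s = sgn s * F \<bar>s\<bar> t" if "s \<in> N" for s using V(4) that by blast
  have h0: "h 0 = 0" using hz[of 0] zp by (simp add: N_def)
  obtain H where H: "Cinf H N" "\<And>z. z \<in> N \<Longrightarrow> h z = z * H z" "H 0 = dird 1 h 0"
    using hadamard_quotient[OF zp hN[unfolded N_def] h0] unfolding N_def by blast
  \<comment> \<open>The derivative of the reflection is read off from the right, where it agrees
    with \<open>Fx\<close>.\<close>
  have dh0: "dird 1 h 0 = 1"
  proof -
    have zN: "0 \<in> N" using zp by (simp add: N_def)
    have d1: "(h has_vector_derivative dird 1 h 0) (at 0 within cbox 0 (zmax t / 2))"
      using dird_real[OF Cinf_differentiable[OF hN zN]] by (simp add: has_real_derivative_iff_has_vector_derivative)
    have d2: "(h has_vector_derivative 1) (at 0 within cbox 0 (zmax t / 2))"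
    proof (rule has_vector_derivative_transform)
      show "((\<lambda>z. Fx (z, t)) has_vector_derivative 1) (at 0 within cbox 0 (zmax t / 2))"
        using dz(1)[of 0 t "cbox 0 (zmax t / 2)"] closed_ext[OF t, of 0] zp bdry1[OF t]
        by (simp add: has_real_derivative_iff_has_vector_derivative)
      show "h z = Fx (z, t)" if "z \<in> cbox 0 (zmax t / 2)" for z
      proof (cases "z = 0")
        case False
        then have z: "0 < z" "z \<le> zmax t / 2" using that by auto
        then have "z \<in> N" using zp by (simp add: N_def)
        then show ?thesis using hz z closed_ext[OF t, of z] zp by simp
      qed (use h0 closed_ext[OF t, of 0] bdry[OF t] zp in simp)
    qed (use zp in auto)
    show ?thesis
      by (rule vector_derivative_unique_within_closed_interval[OF _ _ d1 d2]) (use zp in auto)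
  qed
  have Hnz: "H z \<noteq> 0" if "z \<in> N" for z
  proof (cases "z = 0")
    case False
    then have "F \<bar>z\<bar> t > 0" using that by (intro F_pos[OF t]) (auto simp: N_def)
    then have "h z \<noteq> 0" using hz[OF that] False by (simp add: sgn_zero_iff)
    then show ?thesis using H(2)[OF that] by auto
  qed (use H(3) dh0 in simp)
  have NO: "open N" by (simp add: N_def)
  show ?thesis
  proof (intro exI[of _ "\<lambda>x. dird 1 H x / H x"] conjI ballI)
    show "smooth_on (\<lambda>x. dird 1 H x / H x) {0..<zmax t}"
      unfolding smooth_on_iff
      by (intro exI[of _ N] exI[of _ "\<lambda>x. dird 1 H x / H x"] conjI NO Cinf_log_derivative H Hnz)
         (use zp in \<open>auto simp: N_def\<close>)
    fix z assume z: "z \<in> {0<..<zmax t}"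
    then have zN: "z \<in> N" using zp by (simp add: N_def)
    have eq: "s * H s = Fx (s, t)" if "s \<in> {0<..<zmax t}" for s
    proof -
      have "s \<in> N" using that zp by (simp add: N_def)
      then show ?thesis using H(2)[of s] hz[of s] that ext(4)[OF t, of s] by simp
    qed
    have "((\<lambda>s. s * H s) has_real_derivative H z + z * dird 1 H z) (at z)"
      using dird_real[OF Cinf_differentiable[OF H(1) zN], of UNIV] by (auto intro!: derivative_eq_intros)
    moreover have "((\<lambda>s. s * H s) has_real_derivative Fz (z, t)) (at z)"
    proof (rule has_field_derivative_transform_within_open)
      show "((\<lambda>s. Fx (s, t)) has_real_derivative Fz (z, t)) (at z)"
        using z ext(4)[OF t, of z] by (intro dz(1)) simp
      show "open {0<..<zmax t}" by simp
    qed (use z eq in auto)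
    ultimately have d: "Fz (z, t) = H z + z * dird 1 H z" using DERIV_unique by blast
    have "sqrt (Q_G n k G z t) = (H z + z * dird 1 H z) / (z * H z)"
      using sqrt_Q_G[OF t _ _ k n, of z] z d eq[OF z] by simp
    then show "dird 1 H z / H z = sqrt (Q_G n k G z t) - 1 / z"
      using z Hnz[OF zN] by (simp add: field_simps)
  qed
qed

text \<open>For positive z the formula is F itself, which is smooth up to both ends.\<close>

lemma formula_smooth:
  assumes t: "t \<le> 0" and k: "k = CARD('k)" and n: "real n = real CARD('k) + real CARD('l) - 1"
  shows "\<exists>f. smooth_on f {0..zmax t} \<and> f 0 = F 0 t \<and> (\<forall>z\<in>{0<..zmax t}. f z = F_formula n k G z t)"
proof (intro exI[of _ "\<lambda>z. F z t"] conjI ballI)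
  have L: "linear (\<lambda>z::real. (z, 0::real))" "\<And>b. b \<in> Basis \<Longrightarrow> (b::real, 0::real) \<in> Basis"
    by (auto simp: linear_iff Basis_prod_def)
  note a = Cinf_affine(1,3)[OF ext(1,2) L, of "(0, t)"]
  show "smooth_on (\<lambda>z. F z t) {0..zmax t}"
    unfolding smooth_on_iff
    by (intro exI[of _ "{z. (0, t) + (z, 0) \<in> UF}"] exI[of _ "\<lambda>z. Fx ((0, t) + (z, 0))"] conjI a)
       (use closed_ext[OF t] in auto)
  show "F z t = F_formula n k G z t" if "z \<in> {0<..zmax t}" for z
    using representation(2)[OF t _ _ k n, of z] that by auto
qed simp

end

section \<open>From the hypotheses to the locale, and comparison of two ovals\<close>

lemma profile_locale:
  fixes A :: "('a::{t2_space,second_countable_topology}, 'n::finite) chart set"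
    and \<rho> :: "real^'k::finite^'k \<Rightarrow> real^'l::finite^'l \<Rightarrow> 'a \<Rightarrow> 'a"
  assumes oval: "ancient_oval A g" and sym: "so_symmetric A g \<rho>" and prof: "profile_functions A g \<rho> zmax F G"
    and dims: "CARD('n) = CARD('k) + CARD('l) - 1" "2 \<le> CARD('k)" "3 \<le> CARD('l)"
  shows "\<exists>P Fx Gx UF. oval_profile A g \<rho> zmax F G P Fx Gx UF"
proof -
  define Dom where "Dom = {(z, t). t \<le> (0::real) \<and> 0 \<le> z \<and> z \<le> zmax t}"
  obtain \<kappa> where \<kappa>: "kappa_solution \<kappa> A g" using oval unfolding ancient_oval_def by blast
  obtain P where P: "polar_coordinates A g \<rho> zmax F G P" using prof unfolding profile_functions_def by blast
  have sm: "smooth_on zmax {..0}" "smooth_on (\<lambda>(z, t). F z t) Dom" "smooth_on (\<lambda>(z, t). G z t) Dom"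
    using prof unfolding profile_functions_def Dom_def by blast+
  note pf = prof[unfolded profile_functions_def, THEN conjunct2, THEN conjunct2, THEN conjunct2, THEN conjunct2, THEN spec, THEN mp]
  obtain UF Fx where Fx: "open UF" "Dom \<subseteq> UF" "Cinf Fx UF" "\<forall>x\<in>Dom. Fx x = (\<lambda>(z, t). F z t) x"
    using sm(2) unfolding smooth_on_iff by blast
  obtain UG Gx where Gx: "open UG" "Dom \<subseteq> UG" "Cinf Gx UG" "\<forall>x\<in>Dom. Gx x = (\<lambda>(z, t). G z t) x"
    using sm(3) unfolding smooth_on_iff by blast
  define U where "U = UF \<inter> UG"
  have U: "open U" "Cinf Fx U" "Cinf Gx U" using Fx Gx by (auto simp: U_def intro: Cinf_subset)
  have ext: "(z, t) \<in> U" "Fx (z, t) = F z t" "Gx (z, t) = G z t" if "t \<le> 0" "0 \<le> z" "z \<le> zmax t" for z t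
  proof -
    have "(z, t) \<in> Dom" using that by (simp add: Dom_def)
    then show "(z, t) \<in> U" "Fx (z, t) = F z t" "Gx (z, t) = G z t" using Fx Gx by (auto simp: U_def)
  qed
  have zpos: "zmax t > 0" if "t \<le> 0" for t using pf[OF that] by blast
  have posF: "F z t > 0" if "t \<le> 0" "0 < z" "z \<le> zmax t" for z t using pf[OF that(1)] that(2,3) by auto
  have posG: "G z t > 0" if "t \<le> 0" "0 \<le> z" "z < zmax t" for z t using pf[OF that(1)] that(2,3) by auto
  have zcont: "continuous_on {..0} zmax"
  proof -
    obtain V h where "{..0} \<subseteq> V" "Cinf h V" "\<forall>x\<in>{..0}. h x = zmax x"
      using sm(1) unfolding smooth_on_iff by blast
    then show ?thesis
      using continuous_on_subset[OF Cinf_continuous_on] continuous_on_cong[of "{..0}" "{..0}" h zmax] by blast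
  qed
  \<comment> \<open>One-sided derivatives on a nondegenerate interval are unique, so those
    prescribed at the singular orbits are the derivatives of the extension.\<close>
  have bdry: "dird (1, 0) f (z0, t) = d"
    if t: "t \<le> 0" and z0: "z0 \<in> {0..zmax t}" and f: "Cinf f U" and eq: "\<And>z. z \<in> {0..zmax t} \<Longrightarrow> f (z, t) = h z"
      and h: "(h has_real_derivative d) (at z0 within {0..zmax t})" for f z0 t h d
  proof (rule vector_derivative_unique_within_closed_interval[of 0 "zmax t"])
    have "(z0, t) \<in> U" using ext(1)[OF t] z0 by auto
    from has_vector_derivative_slice_fst[OF Cinf_differentiable[OF f this]]
    have "((\<lambda>z. f (z, t)) has_vector_derivative dird (1, 0) f (z0, t)) (at z0 within {0..zmax t})" .
    then have "(h has_vector_derivative dird (1, 0) f (z0, t)) (at z0 within {0..zmax t})"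
      by (rule has_vector_derivative_transform[OF z0, rotated]) (use eq in simp)
    then show "(h has_vector_derivative dird (1, 0) f (z0, t)) (at z0 within cbox 0 (zmax t))" by simp
    show "(h has_vector_derivative d) (at z0 within cbox 0 (zmax t))"
      using h by (simp add: has_real_derivative_iff_has_vector_derivative)
  qed (use zpos[OF t] z0 in auto)
  have "oval_profile A g \<rho> zmax F G P Fx Gx U"
  proof
    show "ancient_ricci_flow A g" using \<kappa> by (simp add: kappa_solution_def)
    show "at_point A (g t) curv_op_nonneg p" if "t \<le> 0" for t p using \<kappa> that by (simp add: kappa_solution_def)
    show "0 < F z t \<and> 0 < G z t" if "t \<le> 0" "0 < z" "z < zmax t" for t z using posF[of t z] posG[of t z] that by auto
    show "(z, t) \<in> U \<and> Fx (z, t) = F z t \<and> Gx (z, t) = G z t" if "t \<le> 0" "0 < z" "z < zmax t" for t z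
      using ext[of t z] that by auto
    show "(z, t) \<in> U \<and> Fx (z, t) = F z t \<and> Gx (z, t) = G z t" if "t \<le> 0" "0 \<le> z" "z \<le> zmax t" for t z
      using ext[of t z] that by auto
    fix t :: real assume t: "t \<le> 0"
    show "0 < zmax t" using zpos[OF t] .
    show "F 0 t = 0 \<and> G (zmax t) t = 0 \<and> 0 < F (zmax t) t" using pf[OF t] posF[OF t, of "zmax t"] zpos[OF t] by blast
    have m: "0 \<in> {0..zmax t}" "zmax t \<in> {0..zmax t}" using zpos[OF t] by auto
    have e: "Fx (z, t) = F z t" "Gx (z, t) = G z t" if "z \<in> {0..zmax t}" for z using ext[OF t] that by auto
    show "dird (1, 0) Fx (0, t) = 1 \<and> dird (1, 0) Gx (0, t) = 0 \<and> dird (1, 0) Fx (zmax t, t) = 0 \<and> dird (1, 0) Gx (zmax t, t) = - 1"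
      using pf[OF t] bdry[OF t m(1) U(2) e(1)] bdry[OF t m(1) U(3) e(2)] bdry[OF t m(2) U(2) e(1)] bdry[OF t m(2) U(3) e(2)] by blast
    show "smooth_on (\<lambda>z. sgn z * F \<bar>z\<bar> t) {- zmax t<..<zmax t}" using pf[OF t] by blast
  qed (use sym P zcont U dims in auto)
  then show ?thesis by blast
qed

text \<open>At an interior point \<open>Q_G\<close> depends on the germ of G in space and time only.
  Continuity of \<open>zmax\<close> keeps the point inside the interval at nearby times, which the
  time derivative requires.\<close>

lemma Q_G_cong:
  assumes zmax: "continuous_on {..0} zmax"
    and G: "\<And>t z. t \<le> 0 \<Longrightarrow> 0 < z \<Longrightarrow> z < zmax t \<Longrightarrow> G1 z t = G2 z t"
    and t: "t \<le> 0" and z: "0 < z" "z < zmax t"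
  shows "Q_G n k G1 z t = Q_G n k G2 z t"
proof -
  have dz: "d_z f s t = d_z h s t" if s: "0 < s" "s < zmax t" and eq: "\<And>r. 0 < r \<Longrightarrow> r < zmax t \<Longrightarrow> f r t = h r t" for f h s
    unfolding d_z_def
  proof (rule deriv_cong_ev)
    have "eventually (\<lambda>r. r \<in> {0<..<zmax t}) (nhds s)" using s by (intro eventually_nhds_in_open) auto
    then show "\<forall>\<^sub>F r in nhds s. f r t = h r t" by eventually_elim (use eq in auto)
  qed simp
  have dt: "d_t G1 s t = d_t G2 s t" if s: "0 < s" "s < zmax t" for s
  proof -
    have "zmax t - s > 0" using s by simp
    then obtain d where d: "d > 0" "\<forall>r\<in>{..0}. dist r t < d \<longrightarrow> dist (zmax r) (zmax t) < zmax t - s"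
      using zmax t unfolding continuous_on_iff by (metis atMost_iff)
    have eq: "G1 s r = G2 s r" if "r \<in> {..0}" "dist r t < d" for r
    proof -
      have "dist (zmax r) (zmax t) < zmax t - s" using d(2) that by blast
      then show ?thesis using G[of r s] s that(1) by (auto simp: dist_real_def)
    qed
    have "(G1 s has_vector_derivative D) (at t within {..0}) \<longleftrightarrow> (G2 s has_vector_derivative D) (at t within {..0})" for D
      using has_vector_derivative_transform_within[of "G1 s" D t "{..0}" d "G2 s"]
        has_vector_derivative_transform_within[of "G2 s" D t "{..0}" d "G1 s"] d(1) eq t by auto
    then show ?thesis by (simp add: d_t_def vector_derivative_def)
  qed
  have 1: "d_z G1 s t = d_z G2 s t" if "0 < s" "s < zmax t" for s using dz[OF that] G[OF t] by blast
  then have 2: "d_z (d_z G1) s t = d_z (d_z G2) s t" if "0 < s" "s < zmax t" for s using dz[OF that] by blast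
  have "inner_quotient n k G1 s t = inner_quotient n k G2 s t" if s: "0 < s" "s < zmax t" for s
    by (simp add: inner_quotient_def 1[OF s] 2[OF s] dt[OF s] G[OF t s])
  then have "d_z (inner_quotient n k G1) z t = d_z (inner_quotient n k G2) z t" using dz[OF z] by blast
  then show ?thesis by (simp add: Q_G_def 2[OF z] G[OF t z])
qed

theorem theorem1p6:
  fixes n k :: nat
  assumes "n = CARD('n::finite)" and "k = CARD('k::finite)" and "CARD('l::finite) = n - k + 1"
    and "4 \<le> n" and "2 \<le> k" and "k \<le> n - 2"
  shows
    "(\<forall>(A :: ('a::{t2_space,second_countable_topology}, 'n) chart set) g
        (\<rho> :: real^'k^'k \<Rightarrow> real^'l^'l \<Rightarrow> 'a \<Rightarrow> 'a) zmax F G.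
        ancient_oval A g \<and> so_symmetric A g \<rho> \<and> tangent_flow_cylinder A g k \<and>
        profile_functions A g \<rho> zmax F G \<longrightarrow>
        (\<forall>t\<le>0.
          \<comment> \<open>the expressions in the formula are well defined\<close>
          (\<forall>z\<in>{0<..<zmax t}. d_z G z t \<noteq> 0 \<and>
             (\<lambda>s. inner_quotient n k G s t) differentiable (at z) \<and> 0 \<le> Q_G n k G z t) \<and>
          (\<forall>z\<in>{0<..zmax t}.
             (\<lambda>s. sqrt (Q_G n k G s t) - 1 / s) absolutely_integrable_on {0..z} \<and>
             F z t = F_formula n k G z t) \<and>
          \<comment> \<open>smooth extension to z = 0, of the integrand and of the formula\<close>
          (\<exists>\<phi>. smooth_on \<phi> {0..<zmax t} \<and>
             (\<forall>z\<in>{0<..<zmax t}. \<phi> z = sqrt (Q_G n k G z t) - 1 / z)) \<and>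
          (\<exists>f. smooth_on f {0..zmax t} \<and> f 0 = F 0 t \<and>
             (\<forall>z\<in>{0<..zmax t}. f z = F_formula n k G z t))))
     \<and>
     (\<forall>(A\<^sub>1 :: ('a, 'n) chart set) g\<^sub>1 (\<rho>\<^sub>1 :: real^'k^'k \<Rightarrow> real^'l^'l \<Rightarrow> 'a \<Rightarrow> 'a) zmax\<^sub>1 F\<^sub>1 G\<^sub>1
        (A\<^sub>2 :: ('b::{t2_space,second_countable_topology}, 'n) chart set) g\<^sub>2
        (\<rho>\<^sub>2 :: real^'k^'k \<Rightarrow> real^'l^'l \<Rightarrow> 'b \<Rightarrow> 'b) zmax\<^sub>2 F\<^sub>2 G\<^sub>2.
        ancient_oval A\<^sub>1 g\<^sub>1 \<and> so_symmetric A\<^sub>1 g\<^sub>1 \<rho>\<^sub>1 \<and> tangent_flow_cylinder A\<^sub>1 g\<^sub>1 k \<and>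
        profile_functions A\<^sub>1 g\<^sub>1 \<rho>\<^sub>1 zmax\<^sub>1 F\<^sub>1 G\<^sub>1 \<and>
        ancient_oval A\<^sub>2 g\<^sub>2 \<and> so_symmetric A\<^sub>2 g\<^sub>2 \<rho>\<^sub>2 \<and> tangent_flow_cylinder A\<^sub>2 g\<^sub>2 k \<and>
        profile_functions A\<^sub>2 g\<^sub>2 \<rho>\<^sub>2 zmax\<^sub>2 F\<^sub>2 G\<^sub>2 \<and>
        (\<forall>t\<le>0. \<forall>z\<in>{0..min (zmax\<^sub>1 t) (zmax\<^sub>2 t)}. G\<^sub>1 z t = G\<^sub>2 z t) \<longrightarrow>
        (\<forall>t\<le>0. zmax\<^sub>1 t = zmax\<^sub>2 t \<and> (\<forall>z\<in>{0..zmax\<^sub>1 t}. F\<^sub>1 z t = F\<^sub>2 z t)))"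
proof -
  \<comment> \<open>\<open>k \<le> n - 2\<close> is what yields three coordinates in
    \<open>'l\<close>.\<close>
  have dims: "CARD('n) = CARD('k) + CARD('l) - 1" "2 \<le> CARD('k)" "3 \<le> CARD('l)"
    and nk: "real n = real CARD('k) + real CARD('l) - 1"
    using assms by auto
  show ?thesis
  proof ((rule conjI; intro allI impI), goal_cases)
    case (1 A g \<rho> zmax F G t)
    note H = 1(1) and t = 1(2)
    obtain P Fx Gx UF where "oval_profile A g \<rho> zmax F G P Fx Gx UF"
      using profile_locale[of A g \<rho> zmax F G] H dims by blast
    then interpret op: oval_profile A g \<rho> zmax F G P Fx Gx UF .
    have "d_z G z t \<noteq> 0 \<and> (\<lambda>s. inner_quotient n k G s t) differentiable (at z) \<and> 0 \<le> Q_G n k G z t"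
      if "z \<in> {0<..<zmax t}" for z
      using op.Q_G_eq[OF t _ _ assms(2) nk, of z] op.Gz_neg[OF t, of z] op.derivs_G(1)[OF t, of z] that by simp
    moreover have "(\<lambda>s. sqrt (Q_G n k G s t) - 1 / s) absolutely_integrable_on {0..z} \<and> F z t = F_formula n k G z t"
      if "z \<in> {0<..zmax t}" for z
      using op.representation[OF t _ _ assms(2) nk, of z] that by simp
    ultimately show ?case
      using op.integrand_smooth[OF t assms(2) nk] op.formula_smooth[OF t assms(2) nk] by blast
  next
    case (2 A1 g1 \<rho>1 zmax1 F1 G1 A2 g2 \<rho>2 zmax2 F2 G2 t)
    note H = 2(1) and t = 2(2)
    obtain P1 Fx1 Gx1 U1 where o1: "oval_profile A1 g1 \<rho>1 zmax1 F1 G1 P1 Fx1 Gx1 U1"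
      using profile_locale[of A1 g1 \<rho>1 zmax1 F1 G1] H dims by blast
    obtain P2 Fx2 Gx2 U2 where o2: "oval_profile A2 g2 \<rho>2 zmax2 F2 G2 P2 Fx2 Gx2 U2"
      using profile_locale[of A2 g2 \<rho>2 zmax2 F2 G2] H dims by blast
    interpret o1: oval_profile A1 g1 \<rho>1 zmax1 F1 G1 P1 Fx1 Gx1 U1 by (rule o1)
    interpret o2: oval_profile A2 g2 \<rho>2 zmax2 F2 G2 P2 Fx2 Gx2 U2 by (rule o2)
    have GG: "G1 z s = G2 z s" if "s \<le> 0" "0 \<le> z" "z \<le> zmax1 s" "z \<le> zmax2 s" for s z
      using H that by simp
    \<comment> \<open>G is positive before its end point and vanishes there, so profiles that agree
      on the common interval end at the same place.\<close>
    have zm: "zmax1 s = zmax2 s" if s: "s \<le> 0" for s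
    proof (rule linorder_cases[of "zmax1 s" "zmax2 s"])
      assume l: "zmax1 s < zmax2 s"
      then have "G2 (zmax1 s) s > 0" using o2.pos[OF s, of "zmax1 s"] o1.zpos[OF s] by simp
      then show ?thesis using GG[OF s, of "zmax1 s"] o1.bdry[OF s] o1.zpos[OF s] l by simp
    next
      assume l: "zmax2 s < zmax1 s"
      then have "G1 (zmax2 s) s > 0" using o1.pos[OF s, of "zmax2 s"] o2.zpos[OF s] by simp
      then show ?thesis using GG[OF s, of "zmax2 s"] o2.bdry[OF s] o2.zpos[OF s] l by simp
    qed
    have "F1 z t = F2 z t" if z: "z \<in> {0..zmax1 t}" for z
    proof (cases "z = 0")
      case False
      then have z': "0 < z" "z \<le> zmax1 t" "z \<le> zmax2 t" using z zm[OF t] by auto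
      \<comment> \<open>Agreement of the two \<open>Q_G\<close> is known in the interior, which
        suffices for the integrals.\<close>
      have "integral {0..z} (\<lambda>s. sqrt (Q_G n k G1 s t) - 1 / s) = integral {0..z} (\<lambda>s. sqrt (Q_G n k G2 s t) - 1 / s)"
      proof (rule integral_spike[of "{0, z}"])
        fix s assume "s \<in> {0..z} - {0, z}"
        then have s: "0 < s" "s < zmax1 t" using z' by auto
        have "Q_G n k G1 s t = Q_G n k G2 s t"
        proof (rule Q_G_cong[OF o1.zmax _ t s])
          fix t z assume a: "t \<le> 0" "0 < z" "z < zmax1 t"
          then show "G1 z t = G2 z t" using zm[OF a(1)] by (intro GG) auto
        qed
        then show "sqrt (Q_G n k G2 s t) - 1 / s = sqrt (Q_G n k G1 s t) - 1 / s" by simp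
      qed simp
      then show ?thesis
        using o1.representation(2)[OF t z'(1,2) assms(2) nk] o2.representation(2)[OF t z'(1,3) assms(2) nk]
        by (simp add: F_formula_def)
    qed (use o1.bdry[OF t] o2.bdry[OF t] in simp)
    then show ?case using zm[OF t] by blast
  qed
qed

end
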